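(* The operator $(\mathcal T_0,\mathscr D(\mathcal T_0))$ defined by $\mathscr D(\mathcal T_0)=\{\psi\in\mathscr D(\mathcal T_{\max}):\ \mathsf B^-\psi=0\}$ and $\mathcal T_0\psi=\mathcal T_{\max}\psi$ is the generator of a nonnegative $C_0$-semigroup of contractions $(U_0(t))_{t\ge0}$ in $L^1(\Omega,\mu)$, given by $$U_0(t)f(x)=f(\Phi(x,-t))\,\chi_{\{t<\tau_-(x)\}}(x),\qquad x\in\Omega,\ f\in L^1(\Omega,\mu),$$ where $\chi_A$ denotes the characteristic function of a set $A$.
   Context: Setting. $\mu$ is a positive Radon measure on $\mathbb R^N$ (a Borel measure, or the completion of one, finite on compact sets). $F:\mathbb R^N\to\mathbb R^N$ is a globally Lipschitz vector field. For $x\in\mathbb R^N$, $t\mapsto\Phi(x,t)$, $t\in\mathbb R$, is the unique global solution of $\frac{d}{dt}X(t)=F(X(t))$, $X(0)=x$. Standing assumption: $\mu(\Phi(A,t))=\mu(A)$ for every measurable $A\subset\mathbb R^N$ and $t\in\mathbb R$. $\Omega\subset\mathbb R^N$ is a (sufficiently smooth) open set. For $x\in\Omega$, $\tau_\pm(x)=\inf\{s>0:\Phi(x,\pm s)\notin\Omega\}$, with $\inf\varnothing=\infty$. The incoming ($-$) and outgoing ($+$) boundaries are $\Gamma_\pm=\{y\in\partial\Omega:\exists x\in\Omega,\ \tau_\pm(x)<\infty,\ y=\Phi(x,\pm\tau_\pm(x))\}$. For $y\in\Gamma_-$ (resp. $y\in\Gamma_+$), $\tau_+(y)$ (resp. $\tau_-(y)$)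 is the length of the integral curve in $\Omega$ having $y$ as left (resp. right) endpoint, i.e. $\tau_-(x)+\tau_+(x)$ for any $x\in\Omega$ with $y=\Phi(x,-\tau_-(x))$ (resp. $y=\Phi(x,\tau_+(x))$). Boundary measures: $\mu_\pm$ are the unique positive Borel measures on $\Gamma_\pm$ such that for all $T>0$ and $f\in L^1(\Omega\times(0,T),\mu\otimes dt)$, with $\wedge$ denoting minimum, $\int_{\Omega\times(0,T)}f\,d\mu\,dt=\int_0^Tdt\int_{\Gamma_+}d\mu_+(y)\int_0^{\tau_-(y)\wedge t}f(\Phi(y,-s),t-s)ds+\int_\Omega d\mu(x)\int_0^{\tau_-(x)\wedge T}f(\Phi(x,-s),T-s)ds$ and $\int_{\Omega\times(0,T)}f\,d\mu\,dt=\int_0^Tdt\int_{\Gamma_-}d\mu_-(y)\int_0^{\tau_+(y)\wedge(T-t)}f(\Phi(y,s),t+s)ds+\int_\Omega d\mu(x)\int_0^{\tau_+(x)\wedge T}f(\Phi(x,s),s)ds$. Support: the support of a measurable function on $\Omega$ is $\Omega\setminus\omega$, where $\omega$ is the maximal open subset of $\Omega$ on which the function vanishes $\mu$-a.e. Test functions: $\mathfrak Y$ is the set of all measurable bounded functions $\psi:\Omega\to\mathbb R$ with compact support in $\Omega$ such that for any $x\in\Omega$ the map $s\in(-\tau_-(x),\tau_+(x))\mapsto\psi(\Phi(x,s))$ is continuously differentiable, and $x\mapsto\frac{d}{ds}\psi(\Phi(x,s))|_{s=0}$ is measurable and bounded on $\Omega$. Maximal transport operator: $\mathscr D(\mathcal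 T_{\max})$ is the set of all $f\in L^1(\Omega,\mu)$ for which there is $g\in L^1(\Omega,\mu)$ with $\int_\Omega g\psi\,d\mu=\int_\Omega f(x)\frac{d}{ds}\psi(\Phi(x,s))|_{s=0}\,d\mu(x)$ for all $\psi\in\mathfrak Y$; then $\mathcal T_{\max}f:=g$. Traces: each $f\in\mathscr D(\mathcal T_{\max})$ has a representative $f^\sharp$ such that for $\mu$-a.e. $x\in\Omega$ and all $-\tau_-(x)<t_1\le t_2<\tau_+(x)$, $f^\sharp(\Phi(x,t_1))-f^\sharp(\Phi(x,t_2))=\int_{t_1}^{t_2}[\mathcal T_{\max}f](\Phi(x,s))ds$; the traces are $\mathsf B^+f(y)=\lim_{t\to0+}f^\sharp(\Phi(y,-t))$ for $\mu_+$-a.e. $y\in\Gamma_+$ and $\mathsf B^-f(y)=\lim_{t\to0+}f^\sharp(\Phi(y,t))$ for $\mu_-$-a.e. $y\in\Gamma_-$ (these limits exist a.e.). $\mathsf B^-\psi=0$ is meant $\mu_-$-a.e. *)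

theory Defs
  imports "HOL-Analysis.Analysis"
begin

section \<open>Measures and flows\<close>

definition radon_measure :: "(real ^ 'n::finite) measure \<Rightarrow> bool" where
  "radon_measure M \<longleftrightarrow>
    (\<exists>B. sets B = sets borel \<and> (\<forall>K. compact K \<longrightarrow> emeasure B K < \<infinity>) \<and>
         (M = B \<or> M = completion B))"

definition is_flow :: "(real ^ 'n::finite \<Rightarrow> real ^ 'n) \<Rightarrow> (real ^ 'n \<Rightarrow> real \<Rightarrow> real ^ 'n) \<Rightarrow> bool" where
  "is_flow F \<Phi> \<longleftrightarrow>
    (\<forall>x. \<Phi> x 0 = x \<and> (\<forall>t. (\<Phi> x has_vector_derivative F (\<Phi> x t)) (at t)))"

definition flow_invariant :: "(real ^ 'n::finite \<Rightarrow> real \<Rightarrow> real ^ 'n) \<Rightarrow> (real ^ 'n) measure \<Rightarrow> bool" where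
  "flow_invariant \<Phi> M \<longleftrightarrow>
    (\<forall>A\<in>sets M. \<forall>t. emeasure M ((\<lambda>x. \<Phi> x t) ` A) = emeasure M A)"


section \<open>Stay times and boundaries\<close>

text \<open>In \<^typ>\<open>ereal\<close> the infimum of the empty set is \<open>\<infinity>\<close>.\<close>

definition tau_plus :: "(real ^ 'n::finite \<Rightarrow> real \<Rightarrow> real ^ 'n) \<Rightarrow> (real ^ 'n) set \<Rightarrow> real ^ 'n \<Rightarrow> ereal" where
  "tau_plus \<Phi> \<Omega> x = Inf {ereal s | s. s > 0 \<and> \<Phi> x s \<notin> \<Omega>}"

definition tau_minus :: "(real ^ 'n::finite \<Rightarrow> real \<Rightarrow> real ^ 'n) \<Rightarrow> (real ^ 'n) set \<Rightarrow> real ^ 'n \<Rightarrow> ereal" where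
  "tau_minus \<Phi> \<Omega> x = Inf {ereal s | s. s > 0 \<and> \<Phi> x (- s) \<notin> \<Omega>}"

definition exits_at :: "(real ^ 'n::finite \<Rightarrow> real \<Rightarrow> real ^ 'n) \<Rightarrow> (real ^ 'n) set \<Rightarrow> real ^ 'n \<Rightarrow> real ^ 'n \<Rightarrow> bool" where
  "exits_at \<Phi> \<Omega> x y \<longleftrightarrow>
    x \<in> \<Omega> \<and> tau_plus \<Phi> \<Omega> x < \<infinity> \<and> y = \<Phi> x (real_of_ereal (tau_plus \<Phi> \<Omega> x))"

definition enters_at :: "(real ^ 'n::finite \<Rightarrow> real \<Rightarrow> real ^ 'n) \<Rightarrow> (real ^ 'n) set \<Rightarrow> real ^ 'n \<Rightarrow> real ^ 'n \<Rightarrow> bool" where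
  "enters_at \<Phi> \<Omega> x y \<longleftrightarrow>
    x \<in> \<Omega> \<and> tau_minus \<Phi> \<Omega> x < \<infinity> \<and> y = \<Phi> x (- real_of_ereal (tau_minus \<Phi> \<Omega> x))"

definition Gamma_plus :: "(real ^ 'n::finite \<Rightarrow> real \<Rightarrow> real ^ 'n) \<Rightarrow> (real ^ 'n) set \<Rightarrow> (real ^ 'n) set" where
  "Gamma_plus \<Phi> \<Omega> = {y \<in> frontier \<Omega>. \<exists>x. exits_at \<Phi> \<Omega> x y}"

definition Gamma_minus :: "(real ^ 'n::finite \<Rightarrow> real \<Rightarrow> real ^ 'n) \<Rightarrow> (real ^ 'n) set \<Rightarrow> (real ^ 'n) set" where
  "Gamma_minus \<Phi> \<Omega> = {y \<in> frontier \<Omega>. \<exists>x. enters_at \<Phi> \<Omega> x y}"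

text \<open>The values of \<open>\<tau>\<^sub>-\<close> on \<open>\<Gamma>\<^sub>+\<close> and of \<open>\<tau>\<^sub>+\<close> on \<open>\<Gamma>\<^sub>-\<close>, i.e. the length of the
  integral curve in \<open>\<Omega>\<close> ending resp. starting at \<open>y\<close>.  They do not depend on the point \<open>x\<close>
  chosen on that curve.  They need their own names, because a boundary point may belong to
  both \<open>\<Gamma>\<^sub>-\<close> and \<open>\<Gamma>\<^sub>+\<close> and the infimum formulas are only meant for points of \<open>\<Omega>\<close>.\<close>

definition tau_minus_bd :: "(real ^ 'n::finite \<Rightarrow> real \<Rightarrow> real ^ 'n) \<Rightarrow> (real ^ 'n) set \<Rightarrow> real ^ 'n \<Rightarrow> ereal" where
  "tau_minus_bd \<Phi> \<Omega> y =
    (THE r. \<exists>x. exits_at \<Phi> \<Omega> x y \<and> r = tau_minus \<Phi> \<Omega> x + tau_plus \<Phi> \<Omega> x)"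

definition tau_plus_bd :: "(real ^ 'n::finite \<Rightarrow> real \<Rightarrow> real ^ 'n) \<Rightarrow> (real ^ 'n) set \<Rightarrow> real ^ 'n \<Rightarrow> ereal" where
  "tau_plus_bd \<Phi> \<Omega> y =
    (THE r. \<exists>x. enters_at \<Phi> \<Omega> x y \<and> r = tau_minus \<Phi> \<Omega> x + tau_plus \<Phi> \<Omega> x)"


section \<open>Boundary measures\<close>

text \<open>The defining integral identities.  Since the Bochner integral of a non-integrable
  function is \<open>0\<close> by convention, the convergence of the iterated integrals, which is
  part of the meaning of the identities, is spelled out.  The integrals over \<open>s\<close>, \<open>t\<close> and
  \<open>y\<close> are taken with respect to completed measures, because \<open>M\<close> may itself be complete, in
  which case \<open>f\<close> restricted to integral curves need not be Borel.\<close>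

definition outgoing_measure ::
  "(real ^ 'n::finite) measure \<Rightarrow> (real ^ 'n \<Rightarrow> real \<Rightarrow> real ^ 'n) \<Rightarrow> (real ^ 'n) set \<Rightarrow> (real ^ 'n) measure \<Rightarrow> bool" where
  "outgoing_measure M \<Phi> \<Omega> \<mu>p \<longleftrightarrow>
    sets \<mu>p = sets (restrict_space borel (Gamma_plus \<Phi> \<Omega>)) \<and>
    (\<forall>T>0. \<forall>f :: (real ^ 'n) \<times> real \<Rightarrow> real.
      set_integrable (M \<Otimes>\<^sub>M lborel) (\<Omega> \<times> {0<..<T}) f \<longrightarrow>
      (let I = (\<lambda>t y. {s. 0 < s \<and> ereal s < min (tau_minus_bd \<Phi> \<Omega> y) (ereal t)});
           J = (\<lambda>x. {s. 0 < s \<and> ereal s < min (tau_minus \<Phi> \<Omega> x) (ereal T)});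
           p = (\<lambda>t y. LINT s:I t y|lebesgue. f (\<Phi> y (- s), t - s));
           q = (\<lambda>x. LINT s:J x|lebesgue. f (\<Phi> x (- s), T - s))
       in
         (AE t\<in>{0<..<T} in lebesgue. AE y in \<mu>p.
            set_integrable lebesgue (I t y) (\<lambda>s. f (\<Phi> y (- s), t - s))) \<and>
         (AE t\<in>{0<..<T} in lebesgue. integrable (completion \<mu>p) (p t)) \<and>
         set_integrable lebesgue {0<..<T} (\<lambda>t. LINT y|completion \<mu>p. p t y) \<and>
         (AE x\<in>\<Omega> in M. set_integrable lebesgue (J x) (\<lambda>s. f (\<Phi> x (- s), T - s))) \<and>
         set_integrable M \<Omega> q \<and>
         (LINT z:\<Omega> \<times> {0<..<T}|(M \<Otimes>\<^sub>M lborel). f z) =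
           (LINT t:{0<..<T}|lebesgue. LINT y|completion \<mu>p. p t y) + (LINT x:\<Omega>|M. q x)))"

definition incoming_measure ::
  "(real ^ 'n::finite) measure \<Rightarrow> (real ^ 'n \<Rightarrow> real \<Rightarrow> real ^ 'n) \<Rightarrow> (real ^ 'n) set \<Rightarrow> (real ^ 'n) measure \<Rightarrow> bool" where
  "incoming_measure M \<Phi> \<Omega> \<mu>m \<longleftrightarrow>
    sets \<mu>m = sets (restrict_space borel (Gamma_minus \<Phi> \<Omega>)) \<and>
    (\<forall>T>0. \<forall>f :: (real ^ 'n) \<times> real \<Rightarrow> real.
      set_integrable (M \<Otimes>\<^sub>M lborel) (\<Omega> \<times> {0<..<T}) f \<longrightarrow>
      (let I = (\<lambda>t y. {s. 0 < s \<and> ereal s < min (tau_plus_bd \<Phi> \<Omega> y) (ereal (T - t))});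
           J = (\<lambda>x. {s. 0 < s \<and> ereal s < min (tau_plus \<Phi> \<Omega> x) (ereal T)});
           p = (\<lambda>t y. LINT s:I t y|lebesgue. f (\<Phi> y s, t + s));
           q = (\<lambda>x. LINT s:J x|lebesgue. f (\<Phi> x s, s))
       in
         (AE t\<in>{0<..<T} in lebesgue. AE y in \<mu>m.
            set_integrable lebesgue (I t y) (\<lambda>s. f (\<Phi> y s, t + s))) \<and>
         (AE t\<in>{0<..<T} in lebesgue. integrable (completion \<mu>m) (p t)) \<and>
         set_integrable lebesgue {0<..<T} (\<lambda>t. LINT y|completion \<mu>m. p t y) \<and>
         (AE x\<in>\<Omega> in M. set_integrable lebesgue (J x) (\<lambda>s. f (\<Phi> x s, s))) \<and>
         set_integrable M \<Omega> q \<and>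
         (LINT z:\<Omega> \<times> {0<..<T}|(M \<Otimes>\<^sub>M lborel). f z) =
           (LINT t:{0<..<T}|lebesgue. LINT y|completion \<mu>m. p t y) + (LINT x:\<Omega>|M. q x)))"


section \<open>Test functions and the maximal transport operator\<close>

text \<open>A function on \<open>\<Omega>\<close> is represented by a function on the whole space whose values
  outside \<open>\<Omega>\<close> are irrelevant; \<open>L\<^sup>1(\<Omega>, M)\<close> consists of the functions integrable with
  respect to \<open>restrict_space M \<Omega>\<close>.  The maximal open null set of \<open>\<psi>\<close> is the union of all
  open subsets of \<open>\<Omega>\<close> on which \<open>\<psi>\<close> vanishes almost everywhere.\<close>

definition ess_support :: "(real ^ 'n::finite) measure \<Rightarrow> (real ^ 'n) set \<Rightarrow> (real ^ 'n \<Rightarrow> real) \<Rightarrow> (real ^ 'n) set" where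
  "ess_support M \<Omega> \<psi> =
    \<Omega> - \<Union>{V. open V \<and> V \<subseteq> \<Omega> \<and> (AE x\<in>V in M. \<psi> x = 0)}"

definition flow_deriv :: "(real ^ 'n::finite \<Rightarrow> real \<Rightarrow> real ^ 'n) \<Rightarrow> (real ^ 'n \<Rightarrow> real) \<Rightarrow> real ^ 'n \<Rightarrow> real" where
  "flow_deriv \<Phi> \<psi> x = deriv (\<lambda>s. \<psi> (\<Phi> x s)) 0"

definition test_functions ::
  "(real ^ 'n::finite) measure \<Rightarrow> (real ^ 'n \<Rightarrow> real \<Rightarrow> real ^ 'n) \<Rightarrow> (real ^ 'n) set \<Rightarrow> (real ^ 'n \<Rightarrow> real) set" where
  "test_functions M \<Phi> \<Omega> = {\<psi>.
     \<psi> \<in> borel_measurable (restrict_space M \<Omega>) \<and> bounded (\<psi> ` \<Omega>) \<and>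
     compact (ess_support M \<Omega> \<psi>) \<and>
     (\<forall>x\<in>\<Omega>. (\<lambda>s. \<psi> (\<Phi> x s)) C1_differentiable_on
        {s. - tau_minus \<Phi> \<Omega> x < ereal s \<and> ereal s < tau_plus \<Phi> \<Omega> x}) \<and>
     flow_deriv \<Phi> \<psi> \<in> borel_measurable (restrict_space M \<Omega>) \<and>
     bounded (flow_deriv \<Phi> \<psi> ` \<Omega>)}"

text \<open>Operators in \<open>L\<^sup>1\<close> are represented by their graphs, as relations between integrable
  functions that are saturated under equality almost everywhere: \<open>(f, g) \<in> T_max M \<Phi> \<Omega>\<close>
  means that (the class of) \<open>f\<close> is in the domain and is mapped to (the class of) \<open>g\<close>.\<close>

definition T_max ::
  "(real ^ 'n::finite) measure \<Rightarrow> (real ^ 'n \<Rightarrow> real \<Rightarrow> real ^ 'n) \<Rightarrow> (real ^ 'n) set \<Rightarrow>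
   ((real ^ 'n \<Rightarrow> real) \<times> (real ^ 'n \<Rightarrow> real)) set" where
  "T_max M \<Phi> \<Omega> = {(f, g).
     integrable (restrict_space M \<Omega>) f \<and> integrable (restrict_space M \<Omega>) g \<and>
     (\<forall>\<psi>\<in>test_functions M \<Phi> \<Omega>.
        (LINT x|restrict_space M \<Omega>. g x * \<psi> x) =
        (LINT x|restrict_space M \<Omega>. f x * flow_deriv \<Phi> \<psi> x))}"


section \<open>Incoming trace and the operator with zero incoming trace\<close>

definition sharp_representative ::
  "(real ^ 'n::finite) measure \<Rightarrow> (real ^ 'n \<Rightarrow> real \<Rightarrow> real ^ 'n) \<Rightarrow> (real ^ 'n) set \<Rightarrow>
   (real ^ 'n \<Rightarrow> real) \<Rightarrow> (real ^ 'n \<Rightarrow> real) \<Rightarrow> bool" where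
  "sharp_representative M \<Phi> \<Omega> f h \<longleftrightarrow>
     h \<in> borel_measurable (restrict_space M \<Omega>) \<and>
     (AE x in restrict_space M \<Omega>. h x = f x) \<and>
     (\<exists>g. (f, g) \<in> T_max M \<Phi> \<Omega> \<and>
       (AE x in restrict_space M \<Omega>. \<forall>t1 t2.
          - tau_minus \<Phi> \<Omega> x < ereal t1 \<and> t1 \<le> t2 \<and> ereal t2 < tau_plus \<Phi> \<Omega> x \<longrightarrow>
          h (\<Phi> x t1) - h (\<Phi> x t2) = (LINT s:{t1..t2}|lebesgue. g (\<Phi> x s))))"

text \<open>\<open>b\<close> is the incoming trace of \<open>f\<close>; like the trace itself, it is determined
  \<open>\<mu>m\<close>-almost everywhere, independently of the representative.\<close>

definition has_incoming_trace ::
  "(real ^ 'n::finite) measure \<Rightarrow> (real ^ 'n \<Rightarrow> real \<Rightarrow> real ^ 'n) \<Rightarrow> (real ^ 'n) set \<Rightarrow> (real ^ 'n) measure \<Rightarrow>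
   (real ^ 'n \<Rightarrow> real) \<Rightarrow> (real ^ 'n \<Rightarrow> real) \<Rightarrow> bool" where
  "has_incoming_trace M \<Phi> \<Omega> \<mu>m f b \<longleftrightarrow>
     (\<exists>h. sharp_representative M \<Phi> \<Omega> f h \<and>
          (AE y in \<mu>m. ((\<lambda>t. h (\<Phi> y t)) \<longlongrightarrow> b y) (at_right 0)))"

definition T_zero ::
  "(real ^ 'n::finite) measure \<Rightarrow> (real ^ 'n \<Rightarrow> real \<Rightarrow> real ^ 'n) \<Rightarrow> (real ^ 'n) set \<Rightarrow> (real ^ 'n) measure \<Rightarrow>
   ((real ^ 'n \<Rightarrow> real) \<times> (real ^ 'n \<Rightarrow> real)) set" where
  "T_zero M \<Phi> \<Omega> \<mu>m =
     {(\<psi>, g) \<in> T_max M \<Phi> \<Omega>. has_incoming_trace M \<Phi> \<Omega> \<mu>m \<psi> (\<lambda>_. 0)}"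


section \<open>Strongly continuous semigroups in \<open>L\<^sup>1\<close>\<close>

text \<open>Bounded operators in \<open>L\<^sup>1(m)\<close> are represented by maps on integrable functions that are
  compatible with equality almost everywhere; all identities between elements of \<open>L\<^sup>1(m)\<close> are
  equalities almost everywhere.\<close>

definition L1_bounded_operator :: "'a measure \<Rightarrow> (('a \<Rightarrow> real) \<Rightarrow> ('a \<Rightarrow> real)) \<Rightarrow> bool" where
  "L1_bounded_operator m A \<longleftrightarrow>
     (\<forall>f. integrable m f \<longrightarrow> integrable m (A f)) \<and>
     (\<forall>f g. integrable m f \<longrightarrow> integrable m g \<longrightarrow> (AE x in m. f x = g x) \<longrightarrow>
        (AE x in m. A f x = A g x)) \<and>
     (\<forall>f g. \<forall>a b :: real. integrable m f \<longrightarrow> integrable m g \<longrightarrow>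
        (AE x in m. A (\<lambda>x. a * f x + b * g x) x = a * A f x + b * A g x)) \<and>
     (\<exists>C. \<forall>f. integrable m f \<longrightarrow> (LINT x|m. \<bar>A f x\<bar>) \<le> C * (LINT x|m. \<bar>f x\<bar>))"

definition L1_C0_semigroup :: "'a measure \<Rightarrow> (real \<Rightarrow> ('a \<Rightarrow> real) \<Rightarrow> ('a \<Rightarrow> real)) \<Rightarrow> bool" where
  "L1_C0_semigroup m U \<longleftrightarrow>
     (\<forall>t\<ge>0. L1_bounded_operator m (U t)) \<and>
     (\<forall>f. integrable m f \<longrightarrow> (AE x in m. U 0 f x = f x)) \<and>
     (\<forall>t\<ge>0. \<forall>s\<ge>0. \<forall>f. integrable m f \<longrightarrow> (AE x in m. U (t + s) f x = U t (U s f) x)) \<and>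
     (\<forall>f. integrable m f \<longrightarrow> ((\<lambda>t. LINT x|m. \<bar>U t f x - f x\<bar>) \<longlongrightarrow> 0) (at_right 0))"

definition L1_contractive :: "'a measure \<Rightarrow> (real \<Rightarrow> ('a \<Rightarrow> real) \<Rightarrow> ('a \<Rightarrow> real)) \<Rightarrow> bool" where
  "L1_contractive m U \<longleftrightarrow>
     (\<forall>t\<ge>0. \<forall>f. integrable m f \<longrightarrow> (LINT x|m. \<bar>U t f x\<bar>) \<le> (LINT x|m. \<bar>f x\<bar>))"

definition L1_nonnegative :: "'a measure \<Rightarrow> (real \<Rightarrow> ('a \<Rightarrow> real) \<Rightarrow> ('a \<Rightarrow> real)) \<Rightarrow> bool" where
  "L1_nonnegative m U \<longleftrightarrow>
     (\<forall>t\<ge>0. \<forall>f. integrable m f \<longrightarrow> (AE x in m. 0 \<le> f x) \<longrightarrow> (AE x in m. 0 \<le> U t f x))"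

definition L1_generator ::
  "'a measure \<Rightarrow> (real \<Rightarrow> ('a \<Rightarrow> real) \<Rightarrow> ('a \<Rightarrow> real)) \<Rightarrow> (('a \<Rightarrow> real) \<times> ('a \<Rightarrow> real)) set" where
  "L1_generator m U = {(f, g). integrable m f \<and> integrable m g \<and>
     ((\<lambda>t. LINT x|m. \<bar>(U t f x - f x) / t - g x\<bar>) \<longlongrightarrow> 0) (at_right 0)}"

definition U_zero ::
  "(real ^ 'n::finite \<Rightarrow> real \<Rightarrow> real ^ 'n) \<Rightarrow> (real ^ 'n) set \<Rightarrow> real \<Rightarrow> (real ^ 'n \<Rightarrow> real) \<Rightarrow> (real ^ 'n \<Rightarrow> real)" where
  "U_zero \<Phi> \<Omega> t f =
     (\<lambda>x. f (\<Phi> x (- t)) * indicator {x. ereal t < tau_minus \<Phi> \<Omega> x} x)"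

end

theory Submission
  imports Defs
begin

text \<open>Along an orbit that runs inside \<open>\<Omega>\<close> the semigroup is a
  translation with zero inflow, and the transport operator is \<open>- d/ds\<close>.  So everything is a
  one-dimensional statement about orbits, made uniform in \<open>x\<close> by Tonelli's theorem and by the
  invariance of the measure.

  Invariance makes transport along the flow a contraction of \<open>L\<^sup>1\<close> whose adjoint is transport
  in the opposite direction (\<open>integral_shift_adjoint\<close>).  Strong continuity is checked for the
  indicators of bounded open sets and spreads to all integrable functions, because it survives
  limits in \<open>L\<^sup>1\<close> (\<open>strongly_cont_integrable\<close>).

  The generator is compared with \<open>T_zero\<close> in two steps.

  \<^item> An element of \<open>T_zero\<close> satisfies the integrated equation
    \<open>h (\<Phi> x t\<^sub>1) - h (\<Phi> x t\<^sub>2) = \<integral> g (\<Phi> x s) ds\<close> along almost every orbit, and \<open>h\<close> tends to \<open>0\<close> at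
    the entry point of the orbit.  Together these say that \<open>U t h - h = \<integral> U s g ds\<close> over
    \<open>0 < s < t\<close>, also when the orbit of \<open>x\<close> enters \<open>\<Omega>\<close> during that time; dividing by \<open>t\<close> and using
    strong continuity gives membership in the generator (\<open>orbit_eq_imp_generator\<close>).  Two facts
    are needed on the way: \<open>T_max\<close> is single-valued, because averages of continuous functions over
    short pieces of orbit are test functions (\<open>T_max_unique\<close>), and a property of almost every
    point of the incoming boundary holds at the entry point of almost every orbit
    (\<open>AE_incoming_imp_AE\<close>).

  \<^item> Conversely, let \<open>(f, g)\<close> be in the generator, put \<open>u = f - g\<close> and let \<open>h\<close> be the integral of
    \<open>exp (- s) U s u\<close> over \<open>s > 0\<close>.  This \<open>h\<close> is given by an explicit integral along each orbit,
    so the integrated equation with right-hand side \<open>h - u\<close> and the vanishing of the trace can be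
    read off.  By the first step \<open>(h, h - u)\<close> is in the generator, and then
    \<open>f - h\<close> is an eigenfunction of the generator for the eigenvalue \<open>1\<close>, hence \<open>0\<close> by
    contractivity.  That the generator lies in \<open>T_max\<close> follows by moving the difference quotient
    onto the test function (\<open>generator_imp_T_max\<close>).\<close>

section \<open>The flow of a Lipschitz field\<close>

lemma inner_deriv_bound:
  fixes a b :: "'a::real_inner"
  assumes "norm b \<le> L * norm a"
  shows "\<bar>2 * (a \<bullet> b)\<bar> \<le> 2 * L * (norm a)\<^sup>2"
proof -
  have "\<bar>a \<bullet> b\<bar> \<le> norm a * norm b"
    by (rule Cauchy_Schwarz_ineq2)
  also have "\<dots> \<le> norm a * (L * norm a)"
    using assms by (intro mult_left_mono) auto
  finally show ?thesis
    by (simp add: abs_mult power2_eq_square algebra_simps)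
qed

text \<open>Gronwall's inequality for the squared distance \<open>D\<close>: since \<open>\<bar>D'\<bar> \<le> 2 L D\<close>, the function
  \<open>exp (- 2 L t) D t\<close> decreases and \<open>exp (2 L t) D t\<close> increases.  It yields both the uniqueness of
  orbits and their continuous dependence on the starting point.\<close>

lemma solutions_dist_bound:
  fixes F :: "real ^ 'n::finite \<Rightarrow> real ^ 'n"
  assumes L: "L-lipschitz_on UNIV F"
    and X: "\<And>t. (X has_vector_derivative F (X t)) (at t)"
    and Y: "\<And>t. (Y has_vector_derivative F (Y t)) (at t)"
  shows "dist (X t) (Y t) \<le> exp (L * \<bar>t\<bar>) * dist (X 0) (Y 0)"
proof -
  define D where "D t = (X t - Y t) \<bullet> (X t - Y t)" for t
  define D' where "D' t = 2 * ((X t - Y t) \<bullet> (F (X t) - F (Y t)))" for t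
  have L0: "0 \<le> L"
    using L by (rule lipschitz_on_nonneg)
  have dD: "(D has_real_derivative D' t) (at t)" for t
  proof -
    have XY: "((\<lambda>t. X t - Y t) has_derivative (\<lambda>h. h *\<^sub>R (F (X t) - F (Y t)))) (at t)"
      using has_vector_derivative_diff[OF X Y] unfolding has_vector_derivative_def .
    have "(D has_derivative (\<lambda>h. (X t - Y t) \<bullet> (h *\<^sub>R (F (X t) - F (Y t)))
        + (h *\<^sub>R (F (X t) - F (Y t))) \<bullet> (X t - Y t))) (at t)"
      unfolding D_def by (rule has_derivative_inner[OF XY XY])
    then show ?thesis
      unfolding has_field_derivative_def D'_def
      by (rule has_derivative_eq_rhs) (auto simp: inner_commute algebra_simps)
  qed
  have D'_bound: "\<bar>D' t\<bar> \<le> 2 * L * D t" for t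
  proof -
    have "norm (F (X t) - F (Y t)) \<le> L * norm (X t - Y t)"
      using lipschitz_onD[OF L, of "X t" "Y t"] by (simp add: dist_norm)
    from inner_deriv_bound[OF this] show ?thesis
      by (simp add: D_def D'_def power2_norm_eq_inner)
  qed
  have "D t \<le> exp (2 * L * \<bar>t\<bar>) * D 0"
  proof (cases "0 \<le> t")
    case True
    have "exp (- 2 * L * t) * D t \<le> exp (- 2 * L * 0) * D 0"
    proof (rule DERIV_nonpos_imp_nonincreasing[OF True])
      fix s :: real
      have "((\<lambda>s. exp (- 2 * L * s) * D s) has_real_derivative
          exp (- 2 * L * s) * (D' s - 2 * L * D s)) (at s)"
        by (auto intro!: derivative_eq_intros dD simp: algebra_simps)
      moreover have "exp (- 2 * L * s) * (D' s - 2 * L * D s) \<le> 0"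
        using D'_bound[of s] by (intro mult_nonneg_nonpos) auto
      ultimately show "\<exists>y. ((\<lambda>s. exp (- 2 * L * s) * D s) has_real_derivative y) (at s) \<and> y \<le> 0"
        by blast
    qed
    then show ?thesis
      using True by (simp add: exp_minus field_simps)
  next
    case False
    have "exp (2 * L * t) * D t \<le> exp (2 * L * 0) * D 0"
    proof (rule DERIV_nonneg_imp_nondecreasing[of t 0])
      fix s :: real
      have "((\<lambda>s. exp (2 * L * s) * D s) has_real_derivative
          exp (2 * L * s) * (D' s + 2 * L * D s)) (at s)"
        by (auto intro!: derivative_eq_intros dD simp: algebra_simps)
      moreover have "exp (2 * L * s) * (D' s + 2 * L * D s) \<ge> 0"
        using D'_bound[of s] by (intro mult_nonneg_nonneg) auto
      ultimately show "\<exists>y. ((\<lambda>s. exp (2 * L * s) * D s) has_real_derivative y) (at s) \<and> 0 \<le> y"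
        by blast
    qed (use False in simp)
    then show ?thesis
      using False by (simp add: exp_minus field_simps)
  qed
  then have "(dist (X t) (Y t))\<^sup>2 \<le> (exp (L * \<bar>t\<bar>) * dist (X 0) (Y 0))\<^sup>2"
    by (simp add: D_def dist_norm power2_norm_eq_inner power_mult_distrib exp_double[symmetric] mult.assoc)
  then show ?thesis
    by (rule power2_le_imp_le) auto
qed

locale lipschitz_flow =
  fixes F :: "real ^ 'n::finite \<Rightarrow> real ^ 'n"
    and \<Phi> :: "real ^ 'n \<Rightarrow> real \<Rightarrow> real ^ 'n"
  assumes lipschitz: "\<exists>L. L-lipschitz_on UNIV F"
    and flow: "is_flow F \<Phi>"
begin

lemma flow_zero [simp]: "\<Phi> x 0 = x"
  using flow by (simp add: is_flow_def)

lemma flow_deriv_vec: "(\<Phi> x has_vector_derivative F (\<Phi> x t)) (at t)"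
  using flow by (simp add: is_flow_def)

lemma flow_flow [simp]: "\<Phi> (\<Phi> x s) t = \<Phi> x (s + t)"
proof -
  obtain L where L: "L-lipschitz_on UNIV F"
    using lipschitz by blast
  have "((\<lambda>t. \<Phi> x (s + t)) has_vector_derivative F (\<Phi> x (s + t))) (at t)" for t
  proof -
    have 1: "((\<lambda>t. s + t) has_vector_derivative 1) (at t)"
      by (auto intro!: derivative_eq_intros)
    show ?thesis
      using vector_diff_chain_at[OF 1 flow_deriv_vec[of x "s + t"]] by (simp add: o_def)
  qed
  from solutions_dist_bound[OF L flow_deriv_vec[of "\<Phi> x s"] this, of t]
  show ?thesis by simp
qed

lemma continuous_flow: "continuous_on UNIV (\<lambda>z. \<Phi> (fst z) (snd z))"
proof -
  obtain L where L: "L-lipschitz_on UNIV F"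
    using lipschitz by blast
  have "isCont (\<lambda>z. \<Phi> (fst z) (snd z)) (x, t)" for x t
  proof -
    have ct: "isCont (\<Phi> x) t"
      using flow_deriv_vec has_vector_derivative_continuous by blast
    have "isCont (\<lambda>z. \<Phi> x (snd z)) (x, t)"
      by (rule isCont_o2[where f=snd and g="\<Phi> x"]) (use ct in \<open>auto intro!: continuous_intros\<close>)
    then have "isCont (\<lambda>z. exp (L * \<bar>snd z\<bar>) * dist (fst z) x + dist (\<Phi> x (snd z)) (\<Phi> x t)) (x, t)"
      by (intro continuous_intros)
    then have lim: "((\<lambda>z. exp (L * \<bar>snd z\<bar>) * dist (fst z) x + dist (\<Phi> x (snd z)) (\<Phi> x t)) \<longlongrightarrow> 0) (at (x, t))"
      by (simp add: isCont_def)
    have "((\<lambda>z. \<Phi> (fst z) (snd z)) \<longlongrightarrow> \<Phi> x t) (at (x, t))"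
    proof (rule metric_tendsto_imp_tendsto[OF lim], rule always_eventually, safe)
      fix y s
      have "dist (\<Phi> y s) (\<Phi> x t) \<le> dist (\<Phi> y s) (\<Phi> x s) + dist (\<Phi> x s) (\<Phi> x t)"
        by (rule dist_triangle)
      also have "dist (\<Phi> y s) (\<Phi> x s) \<le> exp (L * \<bar>s\<bar>) * dist y x"
        using solutions_dist_bound[OF L flow_deriv_vec[of y] flow_deriv_vec[of x], of s] by simp
      finally show "dist (\<Phi> (fst (y, s)) (snd (y, s))) (\<Phi> x t)
          \<le> dist (exp (L * \<bar>snd (y, s)\<bar>) * dist (fst (y, s)) x + dist (\<Phi> x (snd (y, s))) (\<Phi> x t)) 0"
        by simp
    qed
    then show ?thesis
      by (simp add: isCont_def)
  qed
  then show ?thesis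
    by (simp add: continuous_on_eq_continuous_within continuous_at_imp_continuous_at_within)
qed

lemma continuous_on_flow [continuous_intros]:
  assumes "continuous_on S f" "continuous_on S g"
  shows "continuous_on S (\<lambda>x. \<Phi> (f x) (g x))"
  using continuous_on_compose2[OF continuous_flow continuous_on_Pair[OF assms]] by simp

lemma measurable_flow [measurable]: "(\<lambda>z. \<Phi> (fst z) (snd z)) \<in> borel_measurable (borel \<Otimes>\<^sub>M borel)"
  using borel_measurable_continuous_onI[OF continuous_flow] by (simp add: borel_prod)

lemma measurable_flow_at [measurable (raw)]:
  assumes "f \<in> borel_measurable N" "g \<in> borel_measurable N"
  shows "(\<lambda>x. \<Phi> (f x) (g x)) \<in> borel_measurable N"
  using measurable_compose[OF measurable_Pair[OF assms] measurable_flow] by simp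

lemma image_flow: "(\<lambda>x. \<Phi> x t) ` A = (\<lambda>x. \<Phi> x (- t)) -` A"
  by (force simp: image_iff)

end

section \<open>Orbit pieces inside an open set\<close>

locale flow_in_open = lipschitz_flow F \<Phi>
  for F :: "real ^ 'n::finite \<Rightarrow> real ^ 'n" and \<Phi> +
  fixes \<Omega> :: "(real ^ 'n) set"
  assumes open_dom: "open \<Omega>"
begin

text \<open>The closed segment lets one predicate serve both directions of time.  For \<open>x \<in> \<Omega>\<close> the times
  \<open>t\<close> with \<open>stays x t\<close> form the interval \<open>(- \<tau>\<^sub>- x, \<tau>\<^sub>+ x)\<close>, without reference to infinite values.\<close>

definition stays :: "real ^ 'n \<Rightarrow> real \<Rightarrow> bool" where
  "stays x t \<longleftrightarrow> (\<forall>r\<in>closed_segment 0 t. \<Phi> x r \<in> \<Omega>)"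

lemma stays_0 [simp]: "stays x 0 \<longleftrightarrow> x \<in> \<Omega>"
  by (simp add: stays_def)

lemma stays_imp_start: "stays x t \<Longrightarrow> x \<in> \<Omega>"
  unfolding stays_def by (metis ends_in_segment(1) flow_zero)

lemma stays_imp_end: "stays x t \<Longrightarrow> \<Phi> x t \<in> \<Omega>"
  unfolding stays_def by auto

lemma stays_between: "stays x a \<Longrightarrow> r \<in> closed_segment 0 a \<Longrightarrow> stays x r"
  unfolding stays_def by (meson ends_in_segment(1) subsetD subset_closed_segment)

lemma stays_interval:
  assumes "stays x a" "stays x b" "a \<le> r" "r \<le> b"
  shows "stays x r"
proof -
  have "r \<in> closed_segment 0 a \<or> r \<in> closed_segment 0 b"
    using assms(3,4) by (auto simp: closed_segment_eq_real_ivl)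
  then show ?thesis
    using assms stays_between by blast
qed

text \<open>Restarting at a point of the orbit piece translates the interval of admissible times.\<close>

lemma stays_shift:
  assumes "stays x a"
  shows "stays (\<Phi> x a) b \<longleftrightarrow> stays x (a + b)"
proof
  assume b: "stays (\<Phi> x a) b"
  show "stays x (a + b)"
    unfolding stays_def
  proof
    fix r assume r: "r \<in> closed_segment 0 (a + b)"
    show "\<Phi> x r \<in> \<Omega>"
    proof (cases "r \<in> closed_segment 0 a")
      case True
      then show ?thesis using assms by (simp add: stays_def)
    next
      case False
      then have "r - a \<in> closed_segment 0 b"
        using r by (auto simp: closed_segment_eq_real_ivl split: if_splits)
      then have "\<Phi> (\<Phi> x a) (r - a) \<in> \<Omega>"
        using b unfolding stays_def by blast
      then show ?thesis by simp
    qed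
  qed
next
  assume ab: "stays x (a + b)"
  show "stays (\<Phi> x a) b"
    unfolding stays_def
  proof
    fix r assume r: "r \<in> closed_segment 0 b"
    have "a + r \<in> closed_segment 0 a \<or> a + r \<in> closed_segment 0 (a + b)"
      using r by (auto simp: closed_segment_eq_real_ivl split: if_splits)
    then show "\<Phi> (\<Phi> x a) r \<in> \<Omega>"
      using assms ab by (auto simp: stays_def)
  qed
qed

lemma stays_reverse: "stays (\<Phi> x t) (- t) \<longleftrightarrow> stays x t"
proof -
  have "(\<forall>r\<in>closed_segment 0 (-t). \<Phi> (\<Phi> x t) r \<in> \<Omega>) \<longleftrightarrow> (\<forall>r\<in>closed_segment 0 t. \<Phi> x r \<in> \<Omega>)"
  proof safe
    fix r assume *: "\<forall>r\<in>closed_segment 0 (-t). \<Phi> (\<Phi> x t) r \<in> \<Omega>" "r \<in> closed_segment 0 t"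
    then have "r - t \<in> closed_segment 0 (-t)"
      by (auto simp: closed_segment_eq_real_ivl split: if_splits)
    with * have "\<Phi> (\<Phi> x t) (r - t) \<in> \<Omega>" by blast
    then show "\<Phi> x r \<in> \<Omega>" by simp
  next
    fix r assume *: "\<forall>r\<in>closed_segment 0 t. \<Phi> x r \<in> \<Omega>" "r \<in> closed_segment 0 (-t)"
    then have "t + r \<in> closed_segment 0 t"
      by (auto simp: closed_segment_eq_real_ivl split: if_splits)
    with * show "\<Phi> (\<Phi> x t) r \<in> \<Omega>" by simp
  qed
  then show ?thesis by (simp add: stays_def)
qed

text \<open>The complement is the projection of a closed set along the compact parameter interval
  \<open>[0, 1]\<close> of the segment.  Openness jointly in \<open>x\<close> and \<open>t\<close> makes the later functions of \<open>x\<close> and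
  \<open>t\<close> measurable.\<close>

lemma open_stays: "open {z. stays (fst z) (snd z)}"
proof -
  have eq: "- {z. stays (fst z) (snd z)} =
      {z. \<exists>l. l \<in> {0..1} \<and> (l, z) \<in> (\<lambda>w. \<Phi> (fst (snd w)) (fst w * snd (snd w))) -` (- \<Omega>)}"
    by (auto simp: stays_def closed_segment_def)
  have "closed ((\<lambda>w::real \<times> (real^'n) \<times> real. \<Phi> (fst (snd w)) (fst w * snd (snd w))) -` (- \<Omega>))"
    using open_dom by (intro closed_vimage continuous_intros) auto
  from closed_compact_projection[OF compact_Icc this]
  show ?thesis
    unfolding eq open_closed .
qed

lemma open_stays_time: "open {t. stays x t}"
proof -
  have "open ((\<lambda>t. (x, t)) -` {z. stays (fst z) (snd z)})"
    by (intro open_vimage open_stays continuous_intros)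
  then show ?thesis by (simp add: vimage_def)
qed

lemma open_stays_point: "open {x. stays x t}"
proof -
  have "open ((\<lambda>x. (x, t)) -` {z. stays (fst z) (snd z)})"
    by (intro open_vimage open_stays continuous_intros)
  then show ?thesis by (simp add: vimage_def)
qed

lemma measurable_stays [measurable (raw)]:
  assumes "f \<in> borel_measurable N" "g \<in> borel_measurable N"
  shows "Measurable.pred N (\<lambda>x. stays (f x) (g x))"
proof -
  have "Measurable.pred (borel \<Otimes>\<^sub>M borel) (\<lambda>z. stays (fst z) (snd z))"
    using open_stays by (simp add: borel_prod pred_def)
  from measurable_compose[OF measurable_Pair[OF assms] this]
  show ?thesis by simp
qed

lemma tau_plus_gt_iff:
  assumes x: "x \<in> \<Omega>" and t: "0 \<le> t"
  shows "ereal t < tau_plus \<Phi> \<Omega> x \<longleftrightarrow> stays x t"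
proof
  assume lt: "ereal t < tau_plus \<Phi> \<Omega> x"
  show "stays x t"
    unfolding stays_def
  proof (rule ccontr)
    assume "\<not> (\<forall>r\<in>closed_segment 0 t. \<Phi> x r \<in> \<Omega>)"
    then obtain r where r: "0 \<le> r" "r \<le> t" "\<Phi> x r \<notin> \<Omega>"
      using t by (auto simp: closed_segment_eq_real_ivl)
    then have "r > 0" using x by (cases "r = 0") auto
    then have "tau_plus \<Phi> \<Omega> x \<le> ereal r"
      unfolding tau_plus_def using r by (auto intro!: Inf_lower)
    then show False
      using lt r by (meson ereal_less_eq(3) leD le_less_trans order.strict_trans2 not_le)
  qed
next
  assume st: "stays x t"
  then obtain e where e: "e > 0" "\<And>s. dist s t < e \<Longrightarrow> stays x s"
    using open_stays_time[of x] unfolding open_dist by auto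
  have "ereal (t + e/2) \<le> tau_plus \<Phi> \<Omega> x"
    unfolding tau_plus_def
  proof (rule Inf_greatest, safe)
    fix s assume s: "0 < s" "\<Phi> x s \<notin> \<Omega>"
    have "stays x (t + e/2)"
      using e by (auto simp: dist_real_def)
    then have "\<not> s \<le> t + e/2"
      using s by (auto simp: stays_def closed_segment_eq_real_ivl)
    then show "ereal (t + e/2) \<le> ereal s" by simp
  qed
  then show "ereal t < tau_plus \<Phi> \<Omega> x"
    using e(1) by (meson ereal_less_eq(3) less_add_same_cancel1 half_gt_zero less_le_trans less_ereal.simps(1))
qed

lemma tau_minus_gt_iff:
  assumes x: "x \<in> \<Omega>" and t: "0 \<le> t"
  shows "ereal t < tau_minus \<Phi> \<Omega> x \<longleftrightarrow> stays x (- t)"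
proof
  assume lt: "ereal t < tau_minus \<Phi> \<Omega> x"
  show "stays x (- t)"
    unfolding stays_def
  proof (rule ccontr)
    assume "\<not> (\<forall>r\<in>closed_segment 0 (- t). \<Phi> x r \<in> \<Omega>)"
    then obtain r where r: "- t \<le> r" "r \<le> 0" "\<Phi> x r \<notin> \<Omega>"
      using t by (auto simp: closed_segment_eq_real_ivl split: if_splits)
    then have "r < 0" using x by (cases "r = 0") auto
    then have "tau_minus \<Phi> \<Omega> x \<le> ereal (- r)"
      unfolding tau_minus_def using r by (intro Inf_lower CollectI exI[of _ "- r"]) auto
    also have "\<dots> \<le> ereal t" using r by simp
    finally show False using lt by simp
  qed
next
  assume st: "stays x (- t)"
  then obtain e where e: "e > 0" "\<And>s. dist s (- t) < e \<Longrightarrow> stays x s"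
    using open_stays_time[of x] unfolding open_dist by auto
  have "ereal (t + e/2) \<le> tau_minus \<Phi> \<Omega> x"
    unfolding tau_minus_def
  proof (rule Inf_greatest, safe)
    fix s assume s: "0 < s" "\<Phi> x (- s) \<notin> \<Omega>"
    have "stays x (- (t + e/2))"
      using e by (auto simp: dist_real_def)
    then have "\<not> s \<le> t + e/2"
      using s by (auto simp: stays_def closed_segment_eq_real_ivl split: if_splits)
    then show "ereal (t + e/2) \<le> ereal s" by simp
  qed
  moreover have "ereal t < ereal (t + e/2)" using e(1) by simp
  ultimately show "ereal t < tau_minus \<Phi> \<Omega> x"
    by (rule less_le_trans[rotated])
qed

lemma tau_plus_pos: "x \<in> \<Omega> \<Longrightarrow> 0 < tau_plus \<Phi> \<Omega> x"
  using tau_plus_gt_iff[of x 0] by (simp add: zero_ereal_def)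

lemma tau_minus_pos: "x \<in> \<Omega> \<Longrightarrow> 0 < tau_minus \<Phi> \<Omega> x"
  using tau_minus_gt_iff[of x 0] by (simp add: zero_ereal_def)

lemma stays_iff:
  assumes x: "x \<in> \<Omega>"
  shows "stays x t \<longleftrightarrow> - tau_minus \<Phi> \<Omega> x < ereal t \<and> ereal t < tau_plus \<Phi> \<Omega> x"
proof (cases "0 \<le> t")
  case True
  then have "- tau_minus \<Phi> \<Omega> x < ereal t"
    using tau_minus_pos[OF x] by (metis ereal_less_eq(5) ereal_minus_less_minus ereal_uminus_zero less_le_trans)
  then show ?thesis
    using tau_plus_gt_iff[OF x True] by simp
next
  case False
  then have "ereal t < tau_plus \<Phi> \<Omega> x"
    using tau_plus_pos[OF x] by (metis ereal_less(1) less_trans not_le ereal_less_eq(4) less_imp_le order.strict_trans1)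
  moreover have "stays x t \<longleftrightarrow> ereal (- t) < tau_minus \<Phi> \<Omega> x"
    using tau_minus_gt_iff[OF x, of "- t"] False by simp
  ultimately show ?thesis
    by (metis ereal_minus_less_minus ereal_uminus_uminus uminus_ereal.simps(1))
qed

text \<open>The two summands are the parts of one orbit piece before and after \<open>x\<close>.  Their sum is
  therefore governed by the times at which the orbit of \<open>y\<close> itself is inside \<open>\<Omega>\<close>, and this is why
  the definite description that defines \<open>tau_plus_bd\<close> has a unique solution.\<close>

lemma enters_length_gt_iff:
  assumes en: "enters_at \<Phi> \<Omega> x y" and s: "0 < s"
  shows "ereal s < tau_minus \<Phi> \<Omega> x + tau_plus \<Phi> \<Omega> x \<longleftrightarrow> (\<forall>r\<in>{0<..s}. \<Phi> y r \<in> \<Omega>)"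
proof -
  from en have x: "x \<in> \<Omega>" and fin: "tau_minus \<Phi> \<Omega> x < \<infinity>"
    and y: "y = \<Phi> x (- real_of_ereal (tau_minus \<Phi> \<Omega> x))"
    by (auto simp: enters_at_def)
  obtain a where a: "tau_minus \<Phi> \<Omega> x = ereal a" "0 < a"
    using tau_minus_pos[OF x] fin by (cases "tau_minus \<Phi> \<Omega> x") auto
  have ya: "\<Phi> y r = \<Phi> x (r - a)" for r
    by (simp add: y a)
  have inside: "\<Phi> y r \<in> \<Omega>" if "0 < r" "r \<le> a" for r
    unfolding ya using that tau_minus_gt_iff[OF x, of "a - r"] stays_imp_end[of x "r - a"] a by simp
  show ?thesis
  proof (cases "s \<le> a")
    case True
    then have "ereal s \<le> ereal a + 0" by simp
    also have "\<dots> < ereal a + tau_plus \<Phi> \<Omega> x"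
      using tau_plus_pos[OF x] by (cases "tau_plus \<Phi> \<Omega> x") auto
    finally show ?thesis
      using True inside a(1) by auto
  next
    case False
    have "ereal s < ereal a + tau_plus \<Phi> \<Omega> x \<longleftrightarrow> ereal (s - a) < tau_plus \<Phi> \<Omega> x"
      by (cases "tau_plus \<Phi> \<Omega> x") auto
    also have "\<dots> \<longleftrightarrow> stays x (s - a)"
      using False by (intro tau_plus_gt_iff x) auto
    also have "\<dots> \<longleftrightarrow> (\<forall>r\<in>{0<..s}. \<Phi> y r \<in> \<Omega>)"
    proof
      assume st: "stays x (s - a)"
      show "\<forall>r\<in>{0<..s}. \<Phi> y r \<in> \<Omega>"
      proof
        fix r assume "r \<in> {0<..s}"
        then show "\<Phi> y r \<in> \<Omega>"
          using inside[of r] st False by (cases "r \<le> a") (auto simp: ya stays_def closed_segment_eq_real_ivl)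
      qed
    next
      assume *: "\<forall>r\<in>{0<..s}. \<Phi> y r \<in> \<Omega>"
      show "stays x (s - a)"
        unfolding stays_def
      proof
        fix r assume "r \<in> closed_segment 0 (s - a)"
        then have "r + a \<in> {0<..s}"
          using False a(2) by (auto simp: closed_segment_eq_real_ivl)
        with * have "\<Phi> y (r + a) \<in> \<Omega>" by blast
        then show "\<Phi> x r \<in> \<Omega>" using ya[of "r + a"] by simp
      qed
    qed
    finally show ?thesis by (simp add: a)
  qed
qed

lemma tau_plus_bd_gt_iff:
  assumes y: "y \<in> Gamma_minus \<Phi> \<Omega>" and s: "0 < s"
  shows "ereal s < tau_plus_bd \<Phi> \<Omega> y \<longleftrightarrow> (\<forall>r\<in>{0<..s}. \<Phi> y r \<in> \<Omega>)"
proof -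
  let ?l = "\<lambda>x. tau_minus \<Phi> \<Omega> x + tau_plus \<Phi> \<Omega> x"
  obtain x where x: "enters_at \<Phi> \<Omega> x y"
    using y by (auto simp: Gamma_minus_def)
  have pos: "0 < ?l x'" if "enters_at \<Phi> \<Omega> x' y" for x'
    using that tau_minus_pos[of x'] tau_plus_pos[of x']
    by (cases "tau_minus \<Phi> \<Omega> x'"; cases "tau_plus \<Phi> \<Omega> x'") (auto simp: enters_at_def)
  have le: "?l x1 \<le> ?l x2" if en: "enters_at \<Phi> \<Omega> x1 y" "enters_at \<Phi> \<Omega> x2 y" for x1 x2
  proof (rule ccontr)
    assume "\<not> ?l x1 \<le> ?l x2"
    then obtain r where r: "?l x2 < ereal r" "ereal r < ?l x1"
      using ereal_dense2[of "?l x2" "?l x1"] by (auto simp: not_le)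
    have "0 < ereal r" using pos[OF en(2)] r(1) by (rule less_trans)
    then show False
      using r enters_length_gt_iff[OF en(1), of r] enters_length_gt_iff[OF en(2), of r] by auto
  qed
  have "tau_plus_bd \<Phi> \<Omega> y = ?l x"
    unfolding tau_plus_bd_def
  proof (rule the_equality)
    show "\<exists>xa. enters_at \<Phi> \<Omega> xa y \<and> ?l x = ?l xa"
      using x by blast
    fix l assume "\<exists>x. enters_at \<Phi> \<Omega> x y \<and> l = ?l x"
    then show "l = ?l x" using le x by (auto intro: antisym)
  qed
  then show ?thesis
    using enters_length_gt_iff[OF x s] by simp
qed

lemma Gamma_minus_orbit:
  assumes y: "y \<in> Gamma_minus \<Phi> \<Omega>" and s: "0 < s" "ereal s < tau_plus_bd \<Phi> \<Omega> y"
  shows "\<Phi> y s \<in> \<Omega>" and "tau_minus \<Phi> \<Omega> (\<Phi> y s) = ereal s"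
proof -
  have in\<Omega>: "\<forall>r\<in>{0<..s}. \<Phi> y r \<in> \<Omega>"
    using tau_plus_bd_gt_iff[OF y s(1)] s(2) by simp
  have y\<Omega>: "y \<notin> \<Omega>"
    using y open_dom by (auto simp: Gamma_minus_def frontier_def interior_open)
  show "\<Phi> y s \<in> \<Omega>"
    using in\<Omega> s(1) by auto
  show "tau_minus \<Phi> \<Omega> (\<Phi> y s) = ereal s"
    unfolding tau_minus_def
  proof (rule antisym)
    show "Inf {ereal sa |sa. 0 < sa \<and> \<Phi> (\<Phi> y s) (- sa) \<notin> \<Omega>} \<le> ereal s"
      using s(1) y\<Omega> by (intro Inf_lower) auto
    show "ereal s \<le> Inf {ereal sa |sa. 0 < sa \<and> \<Phi> (\<Phi> y s) (- sa) \<notin> \<Omega>}"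
    proof (rule Inf_greatest, safe)
      fix r assume r: "0 < r" "\<Phi> (\<Phi> y s) (- r) \<notin> \<Omega>"
      then have "s - r \<notin> {0<..s}"
        using in\<Omega> by (auto simp flip: diff_conv_add_uminus)
      then show "ereal s \<le> ereal r" using r by simp
    qed
  qed
qed

lemma Gamma_minus_tau_plus_bd_pos:
  assumes y: "y \<in> Gamma_minus \<Phi> \<Omega>"
  shows "\<exists>s>0. ereal s < tau_plus_bd \<Phi> \<Omega> y"
proof -
  obtain x where en: "enters_at \<Phi> \<Omega> x y"
    using y by (auto simp: Gamma_minus_def)
  then have x: "x \<in> \<Omega>" and fin: "tau_minus \<Phi> \<Omega> x < \<infinity>"
    and yx: "y = \<Phi> x (- real_of_ereal (tau_minus \<Phi> \<Omega> x))"
    by (auto simp: enters_at_def)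
  obtain a where a: "tau_minus \<Phi> \<Omega> x = ereal a" "0 < a"
    using tau_minus_pos[OF x] fin by (cases "tau_minus \<Phi> \<Omega> x") auto
  have "\<Phi> y r \<in> \<Omega>" if "0 < r" "r \<le> a" for r
    using that tau_minus_gt_iff[OF x, of "a - r"] stays_imp_end[of x "r - a"] a by (simp add: yx)
  then show ?thesis
    using tau_plus_bd_gt_iff[OF y a(2)] a(2) by auto
qed

lemma entry_point_in_Gamma_minus:
  assumes x: "x \<in> \<Omega>" and a: "tau_minus \<Phi> \<Omega> x = ereal a"
  shows "\<Phi> x (- a) \<in> Gamma_minus \<Phi> \<Omega>"
proof -
  have a0: "0 < a" using tau_minus_pos[OF x] a by simp
  have in\<Omega>: "\<Phi> x (- r) \<in> \<Omega>" if "0 \<le> r" "r < a" for r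
    using that tau_minus_gt_iff[OF x, of r] a stays_imp_end[of x "- r"] by simp
  have "\<not> stays x (- a)"
    using tau_minus_gt_iff[OF x, of a] a a0 by simp
  then obtain r where "0 \<le> r" "r \<le> a" "\<Phi> x (- r) \<notin> \<Omega>"
    using a0 by (auto simp: stays_def closed_segment_eq_real_ivl split: if_splits)
       (metis add.inverse_inverse neg_0_le_iff_le neg_le_iff_le minus_le_iff)
  with in\<Omega>[of r] have out: "\<Phi> x (- a) \<notin> \<Omega>"
    by (cases "r = a") auto
  have cont: "((\<lambda>r. \<Phi> x (- r)) \<longlongrightarrow> \<Phi> x (- a)) (at_left a)"
  proof -
    have "continuous_on UNIV (\<lambda>r. \<Phi> x (- r))"
      by (intro continuous_intros)
    then show ?thesis
      by (simp add: continuous_on_def filterlim_at_split)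
  qed
  have "eventually (\<lambda>r. r \<in> {0<..<a}) (at_left a)"
    using a0 eventually_at_left_real by blast
  then have "eventually (\<lambda>r. \<Phi> x (- r) \<in> closure \<Omega>) (at_left a)"
    by eventually_elim (use in\<Omega> closure_subset in force)
  with cont have "\<Phi> x (- a) \<in> closure \<Omega>"
    by (intro Lim_in_closed_set[OF closed_closure]) auto
  then have "\<Phi> x (- a) \<in> frontier \<Omega>"
    using out open_dom by (simp add: frontier_def interior_open)
  then show ?thesis
    using x a by (auto simp: Gamma_minus_def enters_at_def)
qed

end

section \<open>Radon measures invariant under the flow\<close>

locale invariant_flow = flow_in_open F \<Phi> \<Omega>
  for F :: "real ^ 'n::finite \<Rightarrow> real ^ 'n" and \<Phi> \<Omega> +
  fixes M :: "(real ^ 'n) measure"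
  assumes radon: "radon_measure M"
    and invariant: "flow_invariant \<Phi> M"
begin

abbreviation "m \<equiv> restrict_space M \<Omega>"

lemma radon_cases:
  obtains (base) "sets M = sets borel"
  | (compl) B where "sets B = sets borel" "M = completion B"
  using radon by (auto simp: radon_measure_def)

lemma sets_borel_subset: "sets borel \<subseteq> sets M"
  by (cases rule: radon_cases) auto

lemma space_M [simp]: "space M = UNIV"
  using radon sets_eq_imp_space_eq[of _ borel] by (auto simp: radon_measure_def)

lemma emeasure_bounded_finite:
  assumes A: "A \<in> sets borel" "bounded A"
  shows "emeasure M A < \<infinity>"
proof -
  obtain B where B: "sets B = sets borel" "\<forall>K. compact K \<longrightarrow> emeasure B K < \<infinity>"
    "M = B \<or> M = completion B"
    using radon by (auto simp: radon_measure_def)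
  have "emeasure M A = emeasure B A"
    using A B by auto
  also have "\<dots> \<le> emeasure B (closure A)"
    using B by (intro emeasure_mono closure_subset) auto
  also have "\<dots> < \<infinity>"
    using B(2) A by (simp add: compact_closure)
  finally show ?thesis .
qed

lemma sigma_finite_M: "sigma_finite_measure M"
proof
  show "\<exists>A. countable A \<and> A \<subseteq> sets M \<and> \<Union>A = space M \<and> (\<forall>a\<in>A. emeasure M a \<noteq> \<infinity>)"
  proof (intro exI conjI ballI)
    show "countable (range (\<lambda>n::nat. ball (0::real^'n) (real n)))" by simp
    show "range (\<lambda>n::nat. ball (0::real^'n) (real n)) \<subseteq> sets M"
      using sets_borel_subset by auto
    show "\<Union> (range (\<lambda>n::nat. ball (0::real^'n) (real n))) = space M"
      by (auto simp: reals_Archimedean2)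
    fix a :: "(real^'n) set" assume "a \<in> range (\<lambda>n::nat. ball 0 (real n))"
    then show "emeasure M a \<noteq> \<infinity>"
      using emeasure_bounded_finite[of a] by auto
  qed
qed

lemma measurable_ident_M: "(\<lambda>x. x) \<in> measurable M borel"
  using sets_borel_subset by (auto simp: measurable_def)

lemma borel_measurable_M:
  "f \<in> borel_measurable borel \<Longrightarrow> f \<in> borel_measurable M"
  by (rule measurable_compose[OF measurable_ident_M])

lemma \<Omega>_borel [measurable]: "\<Omega> \<in> sets borel"
  using open_dom by simp

lemma \<Omega>_sets [simp]: "\<Omega> \<in> sets M"
  using sets_borel_subset by auto

lemma space_m [simp]: "space m = \<Omega>"
  by (simp add: space_restrict_space)

sublocale m: sigma_finite_measure m
  by (intro sigma_finite_measure_restrict_space sigma_finite_M) simp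

sublocale mt: pair_sigma_finite m "lborel :: real measure"
  by standard

lemma measurable_ident_m [measurable]: "(\<lambda>x. x) \<in> measurable m borel"
  by (intro measurable_restrict_space1 measurable_ident_M)

lemma measurable_fst_borel [measurable]: "fst \<in> borel_measurable (m \<Otimes>\<^sub>M N)"
  by (rule measurable_compose[OF measurable_fst measurable_ident_m])

lemma borel_measurable_m: "f \<in> borel_measurable borel \<Longrightarrow> f \<in> borel_measurable m"
  by (rule measurable_compose[OF measurable_ident_m])

lemma sets_m_borel: "A \<in> sets borel \<Longrightarrow> A \<inter> \<Omega> \<in> sets m"
  using sets_borel_subset by (auto simp: sets_restrict_space)

lemma sets_m_open: "open A \<Longrightarrow> A \<subseteq> \<Omega> \<Longrightarrow> A \<in> sets m"
  using sets_m_borel[of A] by (simp add: Int_absorb2)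

text \<open>A measure that is only the completion of a Borel measure has measurable sets whose traces on
  orbits, or preimages in space-time, need not be measurable.  Replacing null sets and functions by
  Borel ones restores Fubini's theorem.\<close>

lemma borel_null_cover:
  assumes "N \<in> null_sets M"
  obtains N' where "N' \<in> sets borel" "N' \<in> null_sets M" "N \<subseteq> N'"
proof (cases rule: radon_cases)
  case base
  then show ?thesis using that[of N] assms by auto
next
  case (compl B)
  then obtain N' where "N' \<in> null_sets B" "N \<subseteq> N'"
    using assms by (auto simp: null_sets_completion_iff2)
  then show ?thesis
    using that[of N'] compl by (auto intro: null_sets_completionI)
qed

lemma AE_m_borel:
  assumes "AE x in m. P x"
  obtains N where "N \<in> sets borel" "N \<in> null_sets M" "\<And>x. x \<in> \<Omega> \<Longrightarrow> x \<notin> N \<Longrightarrow> P x"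
proof -
  from assms have "AE x in M. x \<in> \<Omega> \<longrightarrow> P x"
    by (simp add: AE_restrict_space_iff)
  then obtain N0 where N0: "N0 \<in> null_sets M" "{x. \<not> (x \<in> \<Omega> \<longrightarrow> P x)} \<subseteq> N0"
    by (auto simp: eventually_ae_filter)
  obtain N where "N \<in> sets borel" "N \<in> null_sets M" "N0 \<subseteq> N"
    by (rule borel_null_cover[OF N0(1)])
  then show ?thesis
    using N0(2) by (intro that[of N]) auto
qed

lemma AE_m_null: "N \<in> null_sets M \<Longrightarrow> AE x in m. x \<notin> N"
  by (auto simp: AE_restrict_space_iff dest: AE_not_in)

lemma borel_version:
  fixes f :: "real ^ 'n \<Rightarrow> real"
  assumes "f \<in> borel_measurable m"
  obtains f' where "f' \<in> borel_measurable borel" "AE x in m. f x = f' x"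
proof -
  have f: "(\<lambda>x. f x * indicator \<Omega> x) \<in> borel_measurable M"
    using assms by (simp add: borel_measurable_restrict_space_iff mult.commute)
  have "\<exists>f'\<in>borel_measurable borel. AE x in M. f x * indicator \<Omega> x = f' x"
  proof (cases rule: radon_cases)
    case base
    with f have "(\<lambda>x. f x * indicator \<Omega> x) \<in> borel_measurable borel"
      by (simp cong: measurable_cong_sets)
    then show ?thesis by auto
  next
    case (compl B)
    with f obtain f' where "f' \<in> borel_measurable B" "AE x in B. f x * indicator \<Omega> x = f' x"
      using completion_ex_borel_measurable_real by blast
    then show ?thesis
      using compl by (intro bexI[of _ f']) (auto simp: AE_completion cong: measurable_cong_sets)
  qed
  then obtain f' where f': "f' \<in> borel_measurable borel" "AE x in M. f x * indicator \<Omega> x = f' x"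
    by blast
  have "AE x in m. f x = f' x"
    using f'(2) by (auto simp: AE_restrict_space_iff)
  with f'(1) that show ?thesis by blast
qed

lemma emeasure_vimage_flow:
  assumes "A \<in> sets M"
  shows "emeasure M ((\<lambda>x. \<Phi> x t) -` A) = emeasure M A"
  using invariant assms image_flow[of "- t" A] by (metis flow_invariant_def minus_minus)

lemma distr_flow: "distr M borel (\<lambda>x. \<Phi> x t) = distr M borel (\<lambda>x. x)"
proof (rule measure_eqI)
  fix A assume "A \<in> sets (distr M borel (\<lambda>x. \<Phi> x t))"
  then have A: "A \<in> sets borel" by simp
  have meas: "(\<lambda>x. \<Phi> x t) \<in> measurable M borel"
    by (intro borel_measurable_M measurable_flow_at) auto
  show "emeasure (distr M borel (\<lambda>x. \<Phi> x t)) A = emeasure (distr M borel (\<lambda>x. x)) A"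
    using A sets_borel_subset emeasure_vimage_flow[of A t]
    by (auto simp: emeasure_distr meas measurable_ident_M)
qed simp

lemma nn_integral_flow:
  assumes k: "k \<in> borel_measurable borel"
  shows "(\<integral>\<^sup>+x. k (\<Phi> x t) \<partial>M) = (\<integral>\<^sup>+x. k x \<partial>M)"
proof -
  have meas: "(\<lambda>x. \<Phi> x t) \<in> measurable M borel"
    by (intro borel_measurable_M measurable_flow_at) auto
  have "(\<integral>\<^sup>+x. k (\<Phi> x t) \<partial>M) = (\<integral>\<^sup>+x. k x \<partial>distr M borel (\<lambda>x. \<Phi> x t))"
    using k by (simp add: nn_integral_distr meas)
  also have "\<dots> = (\<integral>\<^sup>+x. k x \<partial>M)"
    using k by (simp add: distr_flow nn_integral_distr measurable_ident_M)
  finally show ?thesis .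
qed

lemma vimage_flow_null:
  assumes "N \<in> sets borel" "N \<in> null_sets M"
  shows "(\<lambda>x. \<Phi> x t) -` N \<in> null_sets M"
proof -
  have "(\<lambda>x. \<Phi> x t) -` N \<inter> space borel \<in> sets borel"
    using assms(1) by measurable
  then show ?thesis
    using assms(2) sets_borel_subset emeasure_vimage_flow[of N t] by (auto simp: null_sets_def)
qed

text \<open>For a completed measure, measurability of a map involves the preimages of null sets, which are
  null by invariance.\<close>

lemma measurable_flow_M: "(\<lambda>x. \<Phi> x t) \<in> measurable M M"
proof (cases rule: radon_cases)
  case base
  have "(\<lambda>x. \<Phi> x t) \<in> measurable borel borel" by measurable
  with base show ?thesis by (simp cong: measurable_cong_sets)
next
  case (compl B)
  have meas: "(\<lambda>x. \<Phi> x t) \<in> measurable (completion B) B"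
    using compl borel_measurable_M[OF measurable_flow_at[of "\<lambda>x. x" borel "\<lambda>_. t"]]
    by (simp cong: measurable_cong_sets)
  have "null_sets B \<subseteq> null_sets (distr (completion B) B (\<lambda>x. \<Phi> x t))"
  proof
    fix N assume N: "N \<in> null_sets B"
    then have "(\<lambda>x. \<Phi> x t) -` N \<in> null_sets M"
      using compl by (intro vimage_flow_null) (auto intro: null_sets_completionI)
    then show "N \<in> null_sets (distr (completion B) B (\<lambda>x. \<Phi> x t))"
      using emeasure_distr[OF meas, of N] N space_M by (auto simp: null_sets_def compl(2))
  qed
  from completion.measurable_completion2[OF meas this]
  show ?thesis by (simp add: compl)
qed

text \<open>The change of variables \<open>z = \<Phi> x t\<close>: the piece of orbit from \<open>x\<close> to \<open>z\<close> stays in \<open>\<Omega>\<close>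
  regardless of the end from which it is run through.\<close>

lemma nn_integral_flow_stays:
  fixes k :: "real ^ 'n \<Rightarrow> ennreal"
  assumes [measurable]: "k \<in> borel_measurable borel"
  shows "(\<integral>\<^sup>+x. k (\<Phi> x t) * indicator {x. stays x t} x \<partial>m) =
    (\<integral>\<^sup>+x. k x * indicator {x. stays x (- t)} x \<partial>m)"
proof -
  have restr: "(\<integral>\<^sup>+x. h x * indicator {x. stays x s} x \<partial>m) = (\<integral>\<^sup>+x. h x * indicator {x. stays x s} x \<partial>M)"
    for h :: "real ^ 'n \<Rightarrow> ennreal" and s
    by (subst nn_integral_restrict_space)
       (auto intro!: nn_integral_cong simp: indicator_def dest: stays_imp_start)
  have "(\<integral>\<^sup>+x. k (\<Phi> x t) * indicator {x. stays x t} x \<partial>M) =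
      (\<integral>\<^sup>+x. k (\<Phi> x t) * indicator {x. stays x (- t)} (\<Phi> x t) \<partial>M)"
    by (intro nn_integral_cong) (simp add: indicator_def stays_reverse)
  also have "\<dots> = (\<integral>\<^sup>+x. k x * indicator {x. stays x (- t)} x \<partial>M)"
    by (rule nn_integral_flow[where k="\<lambda>x. k x * indicator {x. stays x (- t)} x"]) measurable
  finally show ?thesis
    by (simp add: restr)
qed

lemma AE_flow:
  assumes "AE x in m. P x"
  shows "AE x in m. stays x t \<longrightarrow> P (\<Phi> x t)"
proof -
  obtain N where N: "N \<in> sets borel" "N \<in> null_sets M" "\<And>x. x \<in> \<Omega> \<Longrightarrow> x \<notin> N \<Longrightarrow> P x"
    using AE_m_borel[OF assms] by blast
  show ?thesis
    using AE_m_null[OF vimage_flow_null[OF N(1,2), of t]]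
    by eventually_elim (auto intro: N(3) stays_imp_end)
qed

text \<open>By invariance each time slice of the exceptional set is null, so Fubini's theorem applies to
  the exceptional set in space-time.\<close>

lemma AE_orbit:
  assumes "AE x in m. P x"
  shows "AE x in m. AE t in lborel. stays x t \<longrightarrow> P (\<Phi> x t)"
proof -
  obtain N where N: "N \<in> sets borel" "N \<in> null_sets M" "\<And>x. x \<in> \<Omega> \<Longrightarrow> x \<notin> N \<Longrightarrow> P x"
    using AE_m_borel[OF assms] by blast
  note [measurable] = N(1)
  have "AE x in m. \<Phi> x t \<notin> N" for t
    using AE_m_null[OF vimage_flow_null[OF N(1,2), of t]] by simp
  then have "AE t in lborel. AE x in m. \<Phi> x t \<notin> N"
    by (rule AE_I2)
  moreover have "Measurable.pred (m \<Otimes>\<^sub>M lborel) (\<lambda>z. \<Phi> (fst z) (snd z) \<notin> N)"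
  proof -
    have "(\<lambda>z. \<Phi> (fst z) (snd z)) \<in> borel_measurable (m \<Otimes>\<^sub>M lborel)"
      by (intro measurable_flow_at measurable_fst_borel) measurable
    then show ?thesis by measurable
  qed
  ultimately have "AE x in m. AE t in lborel. \<Phi> x t \<notin> N"
    by (subst mt.AE_commute) (auto simp: pred_def)
  then show ?thesis
    by (auto elim!: eventually_mono intro: N(3) stays_imp_end)
qed

end

section \<open>Transport along the flow\<close>

context invariant_flow
begin

text \<open>For \<open>t \<ge> 0\<close> the operator \<open>shift (- t)\<close> is \<open>U t\<close> on \<open>\<Omega>\<close>, and \<open>shift t\<close> is its adjoint.\<close>

definition shift :: "real \<Rightarrow> (real ^ 'n \<Rightarrow> real) \<Rightarrow> real ^ 'n \<Rightarrow> real" where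
  "shift t f x = f (\<Phi> x t) * indicator {x. stays x t} x"

lemma shift_stays [simp]: "stays x t \<Longrightarrow> shift t f x = f (\<Phi> x t)"
  by (simp add: shift_def)

lemma shift_not_stays [simp]: "\<not> stays x t \<Longrightarrow> shift t f x = 0"
  by (simp add: shift_def)

lemma shift_shift:
  assumes "0 \<le> s * t"
  shows "shift s (shift t f) x = shift (s + t) f x"
proof (cases "stays x s")
  case True
  then show ?thesis
    by (cases "stays x (s + t)") (simp_all add: shift_def[of t] stays_shift)
next
  case False
  have "s \<in> closed_segment 0 (s + t)"
    using assms by (auto simp: closed_segment_eq_real_ivl zero_le_mult_iff split: if_splits)
  with False have "\<not> stays x (s + t)"
    using stays_between by blast
  with False show ?thesis by simp
qed

lemma U_zero_eq_shift: "x \<in> \<Omega> \<Longrightarrow> 0 \<le> t \<Longrightarrow> U_zero \<Phi> \<Omega> t f x = shift (- t) f x"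
  by (simp add: U_zero_def shift_def indicator_def tau_minus_gt_iff)

lemma measurable_shift:
  assumes "f \<in> borel_measurable m"
  shows "shift t f \<in> borel_measurable m"
proof -
  have f: "(\<lambda>x. f x * indicator \<Omega> x) \<in> borel_measurable M"
    using assms by (simp add: borel_measurable_restrict_space_iff mult.commute)
  have "indicator {x. stays x t} \<in> borel_measurable M"
    using open_stays_point by (intro borel_measurable_M) auto
  then have "(\<lambda>x. f (\<Phi> x t) * indicator \<Omega> (\<Phi> x t) * indicator {x. stays x t} x) \<in> borel_measurable M"
    using borel_measurable_times[OF measurable_compose[OF measurable_flow_M f, of t]] by blast
  also have "(\<lambda>x. f (\<Phi> x t) * indicator \<Omega> (\<Phi> x t) * indicator {x. stays x t} x) = shift t f"
    by (auto simp: shift_def indicator_def fun_eq_iff dest: stays_imp_end)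
  finally show ?thesis
    by (rule measurable_restrict_space1)
qed

lemma measurable_shift_pair [measurable (raw)]:
  assumes [measurable]: "f \<in> borel_measurable borel" "g \<in> borel_measurable N" "h \<in> borel_measurable N"
  shows "(\<lambda>z. shift (g z) f (h z)) \<in> borel_measurable N"
proof -
  have "(\<lambda>z. f (\<Phi> (h z) (g z)) * (if stays (h z) (g z) then 1 else 0)) \<in> borel_measurable N"
    by measurable
  also have "(\<lambda>z. f (\<Phi> (h z) (g z)) * (if stays (h z) (g z) then 1 else 0)) = (\<lambda>z. shift (g z) f (h z))"
    by (auto simp: shift_def)
  finally show ?thesis .
qed

lemma shift_cong_AE: "AE x in m. f x = g x \<Longrightarrow> AE x in m. shift t f x = shift t g x"
  by (drule AE_flow[of _ t]) (auto simp: shift_def indicator_def elim!: eventually_mono)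

lemma integral_flow_stays:
  fixes k :: "real ^ 'n \<Rightarrow> real"
  assumes [measurable]: "k \<in> borel_measurable borel"
  shows "(LINT x|m. k (\<Phi> x t) * indicator {x. stays x t} x) =
    (LINT x|m. k x * indicator {x. stays x (- t)} x)"
proof -
  have restr: "(LINT x|m. h x * indicator {x. stays x s} x) = (LINT x|M. h x * indicator {x. stays x s} x)"
    for h :: "real ^ 'n \<Rightarrow> real" and s
    by (subst integral_restrict_space)
       (auto intro!: Bochner_Integration.integral_cong simp: indicator_def dest: stays_imp_start)
  have ms: "Measurable.pred borel (\<lambda>x. stays x (- t))"
    by measurable
  have meas: "(\<lambda>x. \<Phi> x t) \<in> measurable M borel"
    by (intro borel_measurable_M measurable_flow_at) auto
  let ?h = "\<lambda>x. k x * indicator {x. stays x (- t)} x"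
  have h: "?h \<in> borel_measurable borel"
    using ms by measurable
  have "(LINT x|M. k (\<Phi> x t) * indicator {x. stays x t} x) = (LINT x|M. ?h (\<Phi> x t))"
    by (intro Bochner_Integration.integral_cong) (auto simp: indicator_def stays_reverse)
  also have "\<dots> = (LINT x|M. ?h x)"
    using integral_distr[OF meas h] integral_distr[OF measurable_ident_M h] by (simp add: distr_flow)
  finally show ?thesis
    by (simp add: restr)
qed

text \<open>The substitution \<open>z = \<Phi> x (- t)\<close> moves the flow from one factor to the other, and staying
  inside \<open>\<Omega>\<close> is symmetric in the two ends of an orbit piece.\<close>

lemma integral_shift_adjoint:
  assumes f: "f \<in> borel_measurable m" and k: "k \<in> borel_measurable m"
  shows "(LINT x|m. shift (- t) f x * k x) = (LINT x|m. f x * shift t k x)"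
proof -
  obtain f' where f'[measurable]: "f' \<in> borel_measurable borel" "AE x in m. f x = f' x"
    using borel_version[OF f] by blast
  obtain k' where k'[measurable]: "k' \<in> borel_measurable borel" "AE x in m. k x = k' x"
    using borel_version[OF k] by blast
  note bm = borel_measurable_m[OF f'(1)] borel_measurable_m[OF k'(1)]
  have "(LINT x|m. shift (- t) f x * k x) = (LINT x|m. shift (- t) f' x * k' x)"
    by (rule integral_cong_AE)
       (use f k bm shift_cong_AE[OF f'(2), of "- t"] k'(2) in \<open>auto intro!: borel_measurable_times measurable_shift elim: eventually_elim2\<close>)
  also have "\<dots> = (LINT x|m. (f' (\<Phi> x (- t)) * k' (\<Phi> (\<Phi> x (- t)) t)) * indicator {x. stays x (- t)} x)"
    by (intro Bochner_Integration.integral_cong) (auto simp: shift_def)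
  also have "\<dots> = (LINT x|m. f' x * k' (\<Phi> x t) * indicator {x. stays x (- (- t))} x)"
    by (rule integral_flow_stays) measurable
  also have "\<dots> = (LINT x|m. f' x * shift t k' x)"
    by (intro Bochner_Integration.integral_cong) (auto simp: shift_def)
  also have "\<dots> = (LINT x|m. f x * shift t k x)"
    by (rule integral_cong_AE)
       (use f k bm shift_cong_AE[OF k'(2), of t] f'(2) in \<open>auto intro!: borel_measurable_times measurable_shift elim: eventually_elim2\<close>)
  finally show ?thesis .
qed

lemma nn_integral_shift_le:
  assumes f: "f \<in> borel_measurable m"
  shows "(\<integral>\<^sup>+x. ennreal \<bar>shift t f x\<bar> \<partial>m) \<le> (\<integral>\<^sup>+x. ennreal \<bar>f x\<bar> \<partial>m)"
proof -
  obtain f' where f'[measurable]: "f' \<in> borel_measurable borel" "AE x in m. f x = f' x"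
    using borel_version[OF f] by blast
  have "(\<integral>\<^sup>+x. ennreal \<bar>shift t f x\<bar> \<partial>m) = (\<integral>\<^sup>+x. ennreal \<bar>f' (\<Phi> x t)\<bar> * indicator {x. stays x t} x \<partial>m)"
    using shift_cong_AE[OF f'(2), of t]
    by (intro nn_integral_cong_AE) (auto simp: indicator_def shift_def elim!: eventually_mono)
  also have "\<dots> = (\<integral>\<^sup>+x. ennreal \<bar>f' x\<bar> * indicator {x. stays x (- t)} x \<partial>m)"
    by (rule nn_integral_flow_stays) measurable
  also have "\<dots> \<le> (\<integral>\<^sup>+x. ennreal \<bar>f x\<bar> \<partial>m)"
    using f'(2) by (intro nn_integral_mono_AE) (auto simp: indicator_def elim!: eventually_mono)
  finally show ?thesis .
qed

lemma integrable_shift: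
  assumes f: "integrable m f"
  shows "integrable m (shift t f)"
  using f nn_integral_shift_le[of f t] measurable_shift[of f t]
  by (auto simp: integrable_iff_bounded intro: le_less_trans)

lemma integral_shift_le:
  assumes f: "integrable m f"
  shows "(LINT x|m. \<bar>shift t f x\<bar>) \<le> (LINT x|m. \<bar>f x\<bar>)"
proof -
  have "ennreal (LINT x|m. \<bar>shift t f x\<bar>) \<le> ennreal (LINT x|m. \<bar>f x\<bar>)"
    using nn_integral_shift_le[of f t] f integrable_shift[OF f, of t]
    by (simp add: nn_integral_eq_integral integrable_abs)
  then show ?thesis
    by (simp add: integral_nonneg_AE)
qed

section \<open>Strong continuity\<close>

text \<open>Bounded open subsets of \<open>\<Omega>\<close> are stable under intersection and generate the Borel sets, so this
  is a Dynkin argument.  The last premise covers sets that are measurable only for a completed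
  measure.  The rule serves both strong continuity and the uniqueness of \<open>T_max\<close>.\<close>

lemma bounded_sets_induct [consumes 2, case_names empty "open" diff union cong]:
  assumes A: "A \<in> sets m" and bd: "bounded A"
    and empty: "P {}"
    and op: "\<And>V. open V \<Longrightarrow> V \<subseteq> \<Omega> \<Longrightarrow> bounded V \<Longrightarrow> P V"
    and diff: "\<And>V B. V \<in> sets m \<Longrightarrow> bounded V \<Longrightarrow> P V \<Longrightarrow> B \<in> sets m \<Longrightarrow> B \<subseteq> V \<Longrightarrow> P B \<Longrightarrow> P (V - B)"
    and union: "\<And>B V. disjoint_family B \<Longrightarrow> V \<in> sets m \<Longrightarrow> bounded V \<Longrightarrow> (\<And>i::nat. B i \<in> sets m) \<Longrightarrow>
      (\<And>i. B i \<subseteq> V) \<Longrightarrow> (\<And>i. P (B i)) \<Longrightarrow> P (\<Union>i. B i)"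
    and cong: "\<And>B C. B \<in> sets m \<Longrightarrow> C \<in> sets m \<Longrightarrow> P B \<Longrightarrow> (AE x in m. x \<in> B \<longleftrightarrow> x \<in> C) \<Longrightarrow> P C"
  shows "P A"
proof -
  obtain r where r: "A \<subseteq> ball 0 r"
    using bd bounded_subset_ballD by blast
  define V where "V = \<Omega> \<inter> ball 0 r"
  have V: "open V" "V \<subseteq> \<Omega>" "bounded V"
    using open_dom by (auto simp: V_def intro: bounded_Int)
  have A\<Omega>: "A \<subseteq> \<Omega>"
    using sets.sets_into_space[OF A] by simp
  define G where "G = {W. open W \<and> W \<subseteq> V}"
  have sub: "B \<in> sets m \<and> B \<subseteq> V" if "B \<in> sigma_sets V G" for B
    using that
  proof induction
    case (Basic B)
    then show ?case using V(2) by (auto simp: G_def intro: sets_m_open)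
  next
    case (Compl B)
    then show ?case using sets_m_open[OF V(1,2)] by auto
  next
    case (Union B)
    then show ?case by blast
  qed auto
  have borel_P: "P B" if "B \<in> sigma_sets V G" for B
  proof (rule sigma_sets_induct_disjoint[OF _ _ that, where P=P])
    show "Int_stable G" by (auto simp: Int_stable_def G_def)
    show "G \<subseteq> Pow V" by (auto simp: G_def)
    show "P W" if "W \<in> G" for W
      using that V by (intro op) (auto simp: G_def intro: bounded_subset)
    show "P {}" by fact
    show "P (V - B)" if "B \<in> sigma_sets V G" "P B" for B
      using sub[OF that(1)] that(2) V(3) op[OF V] sets_m_open[OF V(1,2)] by (intro diff) auto
    show "P (\<Union>i. B i)" if "disjoint_family B" "range B \<subseteq> sigma_sets V G" "\<And>i. P (B i)" for B :: "nat \<Rightarrow> _"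
      using that sub V(3) sets_m_open[OF V(1,2)] by (intro union[of B V]) auto
  qed
  have "indicator A \<in> borel_measurable m"
    using A by measurable
  then obtain f' :: "real ^ 'n \<Rightarrow> real" where f': "f' \<in> borel_measurable borel" "AE x in m. indicator A x = f' x"
    using borel_version by blast
  define C where "C = V \<inter> (f' -` {1} \<inter> space borel)"
  have C: "C \<in> sets borel" "C \<subseteq> V"
    using measurable_sets[OF f'(1), of "{1}"] V(1) by (auto simp: C_def intro!: sets.Int)
  have "C \<in> sigma_sets V G"
  proof -
    have "sigma_sets V G = sigma_sets V ((\<inter>) V ` {S. open S})"
    proof (rule arg_cong[where f="sigma_sets V"])
      show "G = (\<inter>) V ` {S. open S}"
        using V(1) by (auto simp: G_def)
    qed
    also have "\<dots> = (\<inter>) V ` sets borel"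
      using sigma_sets_Int[of V UNIV "{S. open S}"] V(1) by (auto simp: borel_def)
    finally show ?thesis
      using C by blast
  qed
  from borel_P[OF this] sub[OF this] A show ?thesis
  proof (elim conjE, intro cong[of C A])
    show "AE x in m. x \<in> C \<longleftrightarrow> x \<in> A"
      using f'(2) AE_space
      by eventually_elim (use r A\<Omega> in \<open>auto simp: C_def V_def indicator_def split: if_splits\<close>)
  qed auto
qed

lemma dominated_convergence_at_right:
  fixes s :: "real \<Rightarrow> 'a \<Rightarrow> real"
  assumes f: "f \<in> borel_measurable N" and s: "\<And>t. s t \<in> borel_measurable N" and w: "integrable N w"
    and lim: "AE x in N. ((\<lambda>t. s t x) \<longlongrightarrow> f x) (at_right 0)"
    and bound: "\<forall>\<^sub>F t in at_right 0. AE x in N. \<bar>s t x\<bar> \<le> w x"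
  shows "((\<lambda>t. LINT x|N. s t x) \<longlongrightarrow> (LINT x|N. f x)) (at_right 0)"
  unfolding filterlim_at_right_to_top
proof (rule integral_dominated_convergence_at_top[OF f s w])
  show "AE x in N. ((\<lambda>i. s (inverse i) x) \<longlongrightarrow> f x) at_top"
    using lim by (simp add: filterlim_at_right_to_top)
  show "\<forall>\<^sub>F i in at_top. AE x in N. norm (s (inverse i) x) \<le> w x"
    using bound by (simp add: eventually_at_right_to_top)
qed

definition strongly_cont :: "(real ^ 'n \<Rightarrow> real) \<Rightarrow> bool" where
  "strongly_cont f \<longleftrightarrow> ((\<lambda>t. LINT x|m. \<bar>shift (- t) f x - f x\<bar>) \<longlongrightarrow> 0) (at_right 0)"

lemma integrable_shift_diff: "integrable m f \<Longrightarrow> integrable m (\<lambda>x. \<bar>shift t f x - f x\<bar>)"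
  by (intro integrable_abs Bochner_Integration.integrable_diff integrable_shift)

text \<open>An \<open>\<epsilon>/3\<close> argument: the transported error is no larger than the error itself.\<close>

lemma strongly_cont_approx:
  assumes f: "integrable m f"
    and approx: "\<And>e. 0 < e \<Longrightarrow> \<exists>g. integrable m g \<and> strongly_cont g \<and> (LINT x|m. \<bar>f x - g x\<bar>) \<le> e"
  shows "strongly_cont f"
  unfolding strongly_cont_def
proof (rule order_tendstoI)
  fix a :: real assume "a < 0"
  then show "\<forall>\<^sub>F t in at_right 0. a < (LINT x|m. \<bar>shift (- t) f x - f x\<bar>)"
    by (auto intro!: always_eventually less_le_trans[of a 0] integral_nonneg_AE)
next
  fix a :: real assume a: "0 < a"
  obtain g where g: "integrable m g" "strongly_cont g" "(LINT x|m. \<bar>f x - g x\<bar>) \<le> a / 3"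
    using approx[of "a / 3"] a by auto
  have "\<forall>\<^sub>F t in at_right 0. (LINT x|m. \<bar>shift (- t) g x - g x\<bar>) < a / 3"
    using order_tendstoD(2)[OF g(2)[unfolded strongly_cont_def], of "a / 3"] a by simp
  then show "\<forall>\<^sub>F t in at_right 0. (LINT x|m. \<bar>shift (- t) f x - f x\<bar>) < a"
  proof eventually_elim
    case (elim t)
    let ?d = "\<lambda>x. f x - g x"
    have d: "integrable m ?d" using f g(1) by simp
    have "(LINT x|m. \<bar>shift (- t) f x - f x\<bar>)
        \<le> (LINT x|m. \<bar>shift (- t) ?d x\<bar> + \<bar>shift (- t) g x - g x\<bar> + \<bar>?d x\<bar>)"
    proof (rule integral_mono)
      show "integrable m (\<lambda>x. \<bar>shift (- t) f x - f x\<bar>)"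
        by (rule integrable_shift_diff[OF f])
      show "integrable m (\<lambda>x. \<bar>shift (- t) ?d x\<bar> + \<bar>shift (- t) g x - g x\<bar> + \<bar>?d x\<bar>)"
        using integrable_shift[OF d] integrable_shift_diff[OF g(1)] d
        by (intro Bochner_Integration.integrable_add) auto
      show "\<bar>shift (- t) f x - f x\<bar> \<le> \<bar>shift (- t) ?d x\<bar> + \<bar>shift (- t) g x - g x\<bar> + \<bar>?d x\<bar>" for x
        by (cases "stays x (- t)") auto
    qed
    also have "\<dots> = (LINT x|m. \<bar>shift (- t) ?d x\<bar>) + (LINT x|m. \<bar>shift (- t) g x - g x\<bar>) + (LINT x|m. \<bar>?d x\<bar>)"
      using integrable_shift[OF d, of "- t"] integrable_shift_diff[OF g(1), of "- t"] d
      by simp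
    also have "\<dots> < a"
      using integral_shift_le[OF d, of "- t"] elim g(3) by simp
    finally show ?case .
  qed
qed

lemma strongly_cont_limit:
  assumes f: "integrable m f" and s: "\<And>i. integrable m (s i)" "\<And>i::nat. strongly_cont (s i)"
    and lim: "\<And>x. x \<in> \<Omega> \<Longrightarrow> (\<lambda>i. s i x) \<longlonglongrightarrow> f x"
    and w: "integrable m w" "\<And>i x. x \<in> \<Omega> \<Longrightarrow> \<bar>s i x\<bar> \<le> w x"
  shows "strongly_cont f"
proof (rule strongly_cont_approx[OF f])
  fix e :: real assume e: "0 < e"
  have "(\<lambda>i. LINT x|m. \<bar>f x - s i x\<bar>) \<longlonglongrightarrow> (LINT x|m. 0)"
  proof (rule integral_dominated_convergence[where w="\<lambda>x. \<bar>f x\<bar> + w x"])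
    show "AE x in m. (\<lambda>i. \<bar>f x - s i x\<bar>) \<longlonglongrightarrow> 0"
    proof (rule AE_I2)
      fix x assume "x \<in> space m"
      then have "(\<lambda>i. \<bar>f x - s i x\<bar>) \<longlonglongrightarrow> \<bar>f x - f x\<bar>"
        by (intro tendsto_intros lim) simp
      then show "(\<lambda>i. \<bar>f x - s i x\<bar>) \<longlonglongrightarrow> 0" by simp
    qed
    show "AE x in m. norm \<bar>f x - s i x\<bar> \<le> \<bar>f x\<bar> + w x" for i
    proof (rule AE_I2)
      fix x assume "x \<in> space m"
      then show "norm \<bar>f x - s i x\<bar> \<le> \<bar>f x\<bar> + w x"
        using w(2)[of x i] by simp
    qed
  qed (use f s w in auto)
  then have "\<forall>\<^sub>F i in sequentially. (LINT x|m. \<bar>f x - s i x\<bar>) < e"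
    using e by (auto dest: order_tendstoD(2))
  then obtain i where "(LINT x|m. \<bar>f x - s i x\<bar>) < e"
    by (auto simp: eventually_sequentially)
  then show "\<exists>g. integrable m g \<and> strongly_cont g \<and> (LINT x|m. \<bar>f x - g x\<bar>) \<le> e"
    using s by (intro exI[of _ "s i"]) auto
qed

lemma strongly_cont_lincomb:
  assumes f: "integrable m f" "strongly_cont f" and g: "integrable m g" "strongly_cont g"
  shows "strongly_cont (\<lambda>x. a * f x + b * g x)"
  unfolding strongly_cont_def
proof (rule tendsto_sandwich[OF _ _ tendsto_const])
  let ?D = "\<lambda>f t. LINT x|m. \<bar>shift (- t) f x - f x\<bar>"
  show "((\<lambda>t. \<bar>a\<bar> * ?D f t + \<bar>b\<bar> * ?D g t) \<longlongrightarrow> 0) (at_right 0)"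
    using tendsto_add[OF tendsto_mult_left[OF f(2)[unfolded strongly_cont_def], of "\<bar>a\<bar>"]
        tendsto_mult_left[OF g(2)[unfolded strongly_cont_def], of "\<bar>b\<bar>"]] by simp
  show "\<forall>\<^sub>F t in at_right 0. ?D (\<lambda>x. a * f x + b * g x) t \<le> \<bar>a\<bar> * ?D f t + \<bar>b\<bar> * ?D g t"
  proof (rule always_eventually, rule allI)
    fix t
    have "?D (\<lambda>x. a * f x + b * g x) t
        \<le> (LINT x|m. \<bar>a\<bar> * \<bar>shift (- t) f x - f x\<bar> + \<bar>b\<bar> * \<bar>shift (- t) g x - g x\<bar>)"
    proof (rule integral_mono)
      show "integrable m (\<lambda>x. \<bar>shift (- t) (\<lambda>x. a * f x + b * g x) x - (a * f x + b * g x)\<bar>)"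
        using f(1) g(1) by (intro integrable_shift_diff) auto
      show "integrable m (\<lambda>x. \<bar>a\<bar> * \<bar>shift (- t) f x - f x\<bar> + \<bar>b\<bar> * \<bar>shift (- t) g x - g x\<bar>)"
        using integrable_shift_diff[OF f(1)] integrable_shift_diff[OF g(1)] by auto
      fix x
      have "shift (- t) (\<lambda>x. a * f x + b * g x) x - (a * f x + b * g x)
          = a * (shift (- t) f x - f x) + b * (shift (- t) g x - g x)"
        by (simp add: shift_def algebra_simps)
      then show "\<bar>shift (- t) (\<lambda>x. a * f x + b * g x) x - (a * f x + b * g x)\<bar>
          \<le> \<bar>a\<bar> * \<bar>shift (- t) f x - f x\<bar> + \<bar>b\<bar> * \<bar>shift (- t) g x - g x\<bar>"
        using abs_triangle_ineq[of "a * (shift (- t) f x - f x)" "b * (shift (- t) g x - g x)"]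
        by (simp only: abs_mult)
    qed
    also have "\<dots> = \<bar>a\<bar> * ?D f t + \<bar>b\<bar> * ?D g t"
      using integrable_shift_diff[OF f(1), of "- t"] integrable_shift_diff[OF g(1), of "- t"] by simp
    finally show "?D (\<lambda>x. a * f x + b * g x) t \<le> \<bar>a\<bar> * ?D f t + \<bar>b\<bar> * ?D g t" .
  qed
  show "\<forall>\<^sub>F t in at_right 0. 0 \<le> ?D (\<lambda>x. a * f x + b * g x) t"
    by (auto intro!: always_eventually integral_nonneg_AE)
qed

lemma strongly_cont_cong_AE:
  assumes "strongly_cont f" "AE x in m. f x = g x"
    "f \<in> borel_measurable m" "g \<in> borel_measurable m"
  shows "strongly_cont g"
proof -
  have "(LINT x|m. \<bar>shift (- t) f x - f x\<bar>) = (LINT x|m. \<bar>shift (- t) g x - g x\<bar>)" for t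
  proof (rule integral_cong_AE)
    show "AE x in m. \<bar>shift (- t) f x - f x\<bar> = \<bar>shift (- t) g x - g x\<bar>"
      using shift_cong_AE[OF assms(2), of "- t"] assms(2) by eventually_elim simp
  qed (intro borel_measurable_abs borel_measurable_diff measurable_shift assms)+
  with assms(1) show ?thesis by (simp add: strongly_cont_def)
qed

lemma integrable_indicator_bounded:
  assumes "A \<in> sets m" "bounded A"
  shows "integrable m (indicator A :: _ \<Rightarrow> real)"
proof -
  have "A \<subseteq> \<Omega>" "A \<in> sets M"
    using assms(1) by (auto simp: sets_restrict_space_iff)
  have "emeasure m A = emeasure M A"
    using \<open>A \<subseteq> \<Omega>\<close> by (simp add: emeasure_restrict_space)
  also have "\<dots> \<le> emeasure M (closure A)"
    using sets_borel_subset by (intro emeasure_mono closure_subset) auto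
  also have "\<dots> < \<infinity>"
    using assms(2) by (intro emeasure_bounded_finite) auto
  finally show ?thesis
    using assms(1) by (intro integrable_real_indicator)
qed

text \<open>For an open set strong continuity is a matter of one inequality: points of the set remain
  in it for a short time, and the transported set is not larger than the set itself.\<close>

lemma strongly_cont_open:
  assumes V: "open V" "V \<subseteq> \<Omega>" "bounded V"
  shows "strongly_cont (indicator V)"
  unfolding strongly_cont_def
proof (rule tendsto_sandwich[OF _ _ tendsto_const])
  let ?v = "indicator V :: _ \<Rightarrow> real"
  \<comment> \<open>\<open>lost t\<close> marks the points of \<open>V\<close> that the transported indicator no longer covers.  As the
    transported mass does not exceed that of \<open>V\<close>, the points gained weigh no more than the
    points lost.\<close>
  define lost where "lost t x = ?v x * (1 - shift (- t) ?v x)" for t x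
  have int: "integrable m ?v"
    using V by (intro integrable_indicator_bounded sets_m_open)
  have lost_meas: "lost t \<in> borel_measurable m" for t
    unfolding lost_def using int measurable_shift[of ?v "- t"] by measurable
  have lost_le: "\<bar>lost t x\<bar> \<le> ?v x" for t x
    by (simp add: lost_def shift_def indicator_def)
  have lost_int: "integrable m (lost t)" for t
    by (rule Bochner_Integration.integrable_bound[OF int lost_meas]) (use lost_le in auto)
  have "((\<lambda>t. LINT x|m. lost t x) \<longlongrightarrow> (LINT x|m. 0)) (at_right 0)"
  proof (rule dominated_convergence_at_right[OF _ lost_meas int])
    show "AE x in m. ((\<lambda>t. lost t x) \<longlongrightarrow> 0) (at_right 0)"
    proof (rule AE_I2)
      fix x assume "x \<in> space m"
      show "((\<lambda>t. lost t x) \<longlongrightarrow> 0) (at_right 0)"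
      proof (cases "x \<in> V")
        case True
        have "open ((\<lambda>t. - t) -` {t. stays x t} \<inter> (\<lambda>t. \<Phi> x (- t)) -` V)"
          by (intro open_Int open_vimage open_stays_time V continuous_intros)
        then have "\<forall>\<^sub>F t in nhds 0. t \<in> (\<lambda>t. - t) -` {t. stays x t} \<inter> (\<lambda>t. \<Phi> x (- t)) -` V"
          using True V by (intro eventually_nhds_in_open) auto
        then have "\<forall>\<^sub>F t in at_right 0. t \<in> (\<lambda>t. - t) -` {t. stays x t} \<inter> (\<lambda>t. \<Phi> x (- t)) -` V"
          by (auto simp: at_within_def intro: filter_leD[OF inf_le1])
        then have "\<forall>\<^sub>F t in at_right 0. lost t x = 0"
          by eventually_elim (simp add: lost_def)
        then show ?thesis
          by (rule tendsto_eventually)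
      qed (simp add: lost_def)
    qed
  qed (use lost_le in auto)
  then show "((\<lambda>t. 2 * (LINT x|m. lost t x)) \<longlongrightarrow> 0) (at_right 0)"
    by (auto intro: tendsto_mult_right_zero)
  show "\<forall>\<^sub>F t in at_right 0. (LINT x|m. \<bar>shift (- t) ?v x - ?v x\<bar>) \<le> 2 * (LINT x|m. lost t x)"
  proof (rule always_eventually, rule allI)
    fix t
    have "(LINT x|m. \<bar>shift (- t) ?v x - ?v x\<bar>) = (LINT x|m. \<bar>shift (- t) ?v x\<bar> - \<bar>?v x\<bar> + 2 * lost t x)"
      by (intro Bochner_Integration.integral_cong) (auto simp: lost_def shift_def indicator_def)
    also have "\<dots> = (LINT x|m. \<bar>shift (- t) ?v x\<bar>) - (LINT x|m. \<bar>?v x\<bar>) + 2 * (LINT x|m. lost t x)"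
      using integrable_shift[OF int, of "- t"] int lost_int[of t] by simp
    also have "\<dots> \<le> 2 * (LINT x|m. lost t x)"
      using integral_shift_le[OF int, of "- t"] by simp
    finally show "(LINT x|m. \<bar>shift (- t) ?v x - ?v x\<bar>) \<le> 2 * (LINT x|m. lost t x)" .
  qed
  show "\<forall>\<^sub>F t in at_right 0. 0 \<le> (LINT x|m. \<bar>shift (- t) ?v x - ?v x\<bar>)"
    by (auto intro!: always_eventually integral_nonneg_AE)
qed

lemma strongly_cont_bounded_set:
  assumes "A \<in> sets m" "bounded A"
  shows "strongly_cont (indicator A)"
  using assms
proof (induction rule: bounded_sets_induct)
  case empty
  show ?case by (simp add: strongly_cont_def shift_def)
next
  case (diff V B)
  have "strongly_cont (\<lambda>x. 1 * indicator V x + (- 1) * indicator B x)"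
    using diff by (intro strongly_cont_lincomb integrable_indicator_bounded) (auto intro: bounded_subset)
  also have "(\<lambda>x. 1 * indicator V x + (- 1) * indicator B x) = (indicator (V - B) :: _ \<Rightarrow> real)"
    using diff by (auto simp: indicator_def fun_eq_iff)
  finally show ?case .
next
  case (union B V)
  have intV: "integrable m (indicator V :: _ \<Rightarrow> real)"
    using union by (intro integrable_indicator_bounded) auto
  have intB: "integrable m (indicator (B i) :: _ \<Rightarrow> real)" for i
    using union by (intro integrable_indicator_bounded) (auto intro: bounded_subset)
  have partial: "strongly_cont (\<lambda>x. \<Sum>i<n. indicator (B i) x)" for n
  proof (induction n)
    case 0
    then show ?case by (simp add: strongly_cont_def shift_def)
  next
    case (Suc n)
    have "strongly_cont (\<lambda>x. 1 * (\<Sum>i<n. indicator (B i) x) + 1 * indicator (B n) x)"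
      using Suc union intB by (intro strongly_cont_lincomb) auto
    then show ?case by simp
  qed
  have le: "(\<Sum>i<n. indicator (B i) x :: real) \<le> indicator V x" for n x
  proof -
    have "(\<Sum>i<n. indicator (B i) x :: real) = indicator (\<Union>i<n. B i) x"
      using union(1) by (intro indicator_UN_disjoint[symmetric]) (auto intro: disjoint_family_on_mono)
    also have "\<dots> \<le> indicator V x"
      using union by (auto simp: indicator_def)
    finally show ?thesis .
  qed
  show ?case
  proof (rule strongly_cont_limit[where s="\<lambda>n x. \<Sum>i<n. indicator (B i) x" and w="indicator V"])
    show "(\<lambda>n. \<Sum>i<n. indicator (B i) x) \<longlonglongrightarrow> (indicator (\<Union>i. B i) x :: real)" for x
      using indicator_sums[of B x] union(1) by (auto simp: sums_def disjoint_family_on_def)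
    show "integrable m (indicator (\<Union>i. B i) :: _ \<Rightarrow> real)"
      using union by (intro integrable_indicator_bounded sets.countable_UN) (auto intro: bounded_subset)
    show "\<bar>\<Sum>i<n. indicator (B i) x\<bar> \<le> (indicator V x :: real)" for n x
      using le[where n=n and x=x] by (subst abs_of_nonneg) (auto intro: sum_nonneg)
  qed (use intV intB partial in auto)
next
  case (cong B C)
  from cong(3) have "AE x in m. indicator B x = (indicator C x :: real)"
    by eventually_elim (simp add: indicator_def)
  from strongly_cont_cong_AE[OF cong(4) this] cong(1,2) show ?case
    by simp
qed (rule strongly_cont_open)

text \<open>A set of finite measure is exhausted by its bounded parts; the rest is approximation in
  \<open>L\<^sup>1\<close>.\<close>

theorem strongly_cont_integrable:
  assumes "integrable m f"
  shows "strongly_cont f"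
  using assms
proof (induction rule: integrable_induct)
  case (base A c)
  have A: "A \<subseteq> \<Omega>" using sets.sets_into_space[OF base(1)] by simp
  have intA: "integrable m (indicator A :: _ \<Rightarrow> real)"
    using base by (intro integrable_real_indicator)
  have sets: "A \<inter> ball 0 (real n) \<in> sets m" for n
  proof -
    have "A \<inter> (ball 0 (real n) \<inter> \<Omega>) \<in> sets m"
      using base by (intro sets.Int sets_m_borel) auto
    moreover have "A \<inter> (ball 0 (real n) \<inter> \<Omega>) = A \<inter> ball 0 (real n)" using A by auto
    ultimately show ?thesis by simp
  qed
  have "strongly_cont (indicator A)"
  proof (rule strongly_cont_limit[where s="\<lambda>n. indicator (A \<inter> ball 0 (real n))" and w="indicator A"])
    show "(\<lambda>n. indicator (A \<inter> ball 0 (real n)) x) \<longlonglongrightarrow> (indicator A x :: real)" for x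
    proof (rule tendsto_eventually)
      have "\<forall>\<^sub>F n in sequentially. norm x < real n"
        using reals_Archimedean2 by (metis eventually_at_top_linorder le_less_trans of_nat_le_iff order_less_le_trans)
      then show "\<forall>\<^sub>F n in sequentially. indicator (A \<inter> ball 0 (real n)) x = (indicator A x :: real)"
        by eventually_elim (auto simp: indicator_def)
    qed
  qed (use intA sets in \<open>auto intro!: strongly_cont_bounded_set integrable_indicator_bounded simp: indicator_def\<close>)
  from strongly_cont_lincomb[OF intA this intA this, of c 0]
  show ?case by (simp add: mult.commute)
next
  case (add f g)
  from strongly_cont_lincomb[OF add(1,3,2,4), of 1 1]
  show ?case by simp
next
  case (lim f s)
  then show ?case
    by (intro strongly_cont_limit[of f s "\<lambda>x. 2 * \<bar>f x\<bar>"]) auto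
qed

end

lemma abs_mult_le_const:
  fixes a c C :: real
  assumes "\<bar>c\<bar> \<le> C"
  shows "\<bar>a * c\<bar> \<le> C * \<bar>a\<bar>" and "\<bar>a * c\<bar> \<le> \<bar>C * a\<bar>"
proof -
  show *: "\<bar>a * c\<bar> \<le> C * \<bar>a\<bar>"
    using mult_right_mono[OF assms, of "\<bar>a\<bar>"] by (simp add: abs_mult mult.commute)
  have "C * \<bar>a\<bar> \<le> \<bar>C * a\<bar>"
    by (simp add: abs_mult mult_right_mono)
  with * show "\<bar>a * c\<bar> \<le> \<bar>C * a\<bar>" by linarith
qed

lemma integral_abs_diff_le:
  fixes a b :: "'a \<Rightarrow> real"
  assumes a: "integrable N a" and b: "integrable N b"
  shows "(LINT x|N. \<bar>a x - b x\<bar>) \<le> (LINT x|N. \<bar>a x\<bar>) + (LINT x|N. \<bar>b x\<bar>)"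
proof -
  have "(LINT x|N. \<bar>a x - b x\<bar>) \<le> (LINT x|N. \<bar>a x\<bar> + \<bar>b x\<bar>)"
    using a b by (intro integral_mono) auto
  then show ?thesis using a b by simp
qed

section \<open>The semigroup\<close>

context invariant_flow
begin

lemma U_AE: "0 \<le> t \<Longrightarrow> AE x in m. U_zero \<Phi> \<Omega> t f x = shift (- t) f x"
  by (intro AE_I2) (simp add: U_zero_eq_shift)

lemma integrable_U: 
  assumes "0 \<le> t" "integrable m f"
  shows "integrable m (U_zero \<Phi> \<Omega> t f)"
proof -
  have "integrable m (U_zero \<Phi> \<Omega> t f) \<longleftrightarrow> integrable m (shift (- t) f)"
    using assms(1) by (intro Bochner_Integration.integrable_cong) (auto simp: U_zero_eq_shift)
  then show ?thesis using assms(2) by (simp add: integrable_shift)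
qed

lemma integral_U_le:
  assumes "0 \<le> t" "integrable m f"
  shows "(LINT x|m. \<bar>U_zero \<Phi> \<Omega> t f x\<bar>) \<le> (LINT x|m. \<bar>f x\<bar>)"
proof -
  have "(LINT x|m. \<bar>U_zero \<Phi> \<Omega> t f x\<bar>) = (LINT x|m. \<bar>shift (- t) f x\<bar>)"
    using assms(1) by (intro Bochner_Integration.integral_cong) (auto simp: U_zero_eq_shift)
  then show ?thesis using integral_shift_le[OF assms(2)] by simp
qed

lemma U_contractive: "L1_contractive m (U_zero \<Phi> \<Omega>)"
  by (simp add: L1_contractive_def integral_U_le)

lemma U_nonnegative: "L1_nonnegative m (U_zero \<Phi> \<Omega>)"
  unfolding L1_nonnegative_def
proof (intro allI impI)
  fix t :: real and f :: "real ^ 'n \<Rightarrow> real"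
  assume t: "0 \<le> t" and f: "AE x in m. 0 \<le> f x"
  from AE_flow[OF f, of "- t"] U_AE[OF t, of f]
  show "AE x in m. 0 \<le> U_zero \<Phi> \<Omega> t f x"
    by eventually_elim (auto simp: shift_def indicator_def)
qed

lemma U_bounded_operator:
  assumes t: "0 \<le> t"
  shows "L1_bounded_operator m (U_zero \<Phi> \<Omega> t)"
  unfolding L1_bounded_operator_def
proof (intro conjI allI impI)
  show "integrable m (U_zero \<Phi> \<Omega> t f)" if "integrable m f" for f
    using t that by (rule integrable_U)
  show "AE x in m. U_zero \<Phi> \<Omega> t f x = U_zero \<Phi> \<Omega> t g x" if "AE x in m. f x = g x" for f g
    using shift_cong_AE[OF that, of "- t"] U_AE[OF t, of f] U_AE[OF t, of g]
    by eventually_elim simp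
  show "AE x in m. U_zero \<Phi> \<Omega> t (\<lambda>x. a * f x + b * g x) x = a * U_zero \<Phi> \<Omega> t f x + b * U_zero \<Phi> \<Omega> t g x"
    for f g a b
    by (simp add: U_zero_def algebra_simps)
  show "\<exists>C. \<forall>f. integrable m f \<longrightarrow> (LINT x|m. \<bar>U_zero \<Phi> \<Omega> t f x\<bar>) \<le> C * (LINT x|m. \<bar>f x\<bar>)"
    using integral_U_le[OF t] by (intro exI[of _ 1]) auto
qed

lemma U_semigroup: "L1_C0_semigroup m (U_zero \<Phi> \<Omega>)"
  unfolding L1_C0_semigroup_def
proof (intro conjI allI impI)
  show "AE x in m. U_zero \<Phi> \<Omega> 0 f x = f x" for f
    by (intro AE_I2) (simp add: U_zero_eq_shift)
  show "AE x in m. U_zero \<Phi> \<Omega> (t + s) f x = U_zero \<Phi> \<Omega> t (U_zero \<Phi> \<Omega> s f) x"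
    if "0 \<le> t" "0 \<le> s" for t s f
  proof (rule AE_I2)
    fix x assume "x \<in> space m"
    then have x: "x \<in> \<Omega>" by simp
    have "U_zero \<Phi> \<Omega> t (U_zero \<Phi> \<Omega> s f) x = shift (- t) (U_zero \<Phi> \<Omega> s f) x"
      using x that by (simp add: U_zero_eq_shift)
    also have "\<dots> = shift (- t) (shift (- s) f) x"
      using that by (cases "stays x (- t)") (auto simp: U_zero_eq_shift dest: stays_imp_end)
    also have "\<dots> = shift (- (t + s)) f x"
      using that by (subst shift_shift) auto
    finally show "U_zero \<Phi> \<Omega> (t + s) f x = U_zero \<Phi> \<Omega> t (U_zero \<Phi> \<Omega> s f) x"
      using x that by (simp add: U_zero_eq_shift)
  qed
  show "((\<lambda>t. LINT x|m. \<bar>U_zero \<Phi> \<Omega> t f x - f x\<bar>) \<longlongrightarrow> 0) (at_right 0)" if "integrable m f" for f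
  proof (rule Lim_transform_eventually)
    show "((\<lambda>t. LINT x|m. \<bar>shift (- t) f x - f x\<bar>) \<longlongrightarrow> 0) (at_right 0)"
      using strongly_cont_integrable[OF that] by (simp add: strongly_cont_def)
    show "\<forall>\<^sub>F t in at_right 0. (LINT x|m. \<bar>shift (- t) f x - f x\<bar>) = (LINT x|m. \<bar>U_zero \<Phi> \<Omega> t f x - f x\<bar>)"
      using eventually_at_right_less
      by eventually_elim (auto intro!: Bochner_Integration.integral_cong simp: U_zero_eq_shift)
  qed
qed (rule U_bounded_operator)

section \<open>The generator\<close>

abbreviation "gen \<equiv> L1_generator m (U_zero \<Phi> \<Omega>)"

lemma generator_iff:
  "(f, g) \<in> gen \<longleftrightarrow> integrable m f \<and> integrable m g \<and>
    ((\<lambda>t. LINT x|m. \<bar>(shift (- t) f x - f x) / t - g x\<bar>) \<longlongrightarrow> 0) (at_right 0)"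
proof -
  have "\<forall>\<^sub>F t in at_right 0. (LINT x|m. \<bar>(U_zero \<Phi> \<Omega> t f x - f x) / t - g x\<bar>) =
      (LINT x|m. \<bar>(shift (- t) f x - f x) / t - g x\<bar>)"
    using eventually_at_right_less
    by eventually_elim (auto intro!: Bochner_Integration.integral_cong simp: U_zero_eq_shift)
  from filterlim_cong[OF refl refl this]
  show ?thesis by (simp add: L1_generator_def)
qed

lemma integrable_quotient:
  assumes "integrable m f" "integrable m g"
  shows "integrable m (\<lambda>x. (shift s f x - f x) / t - g x)"
  using assms integrable_shift[OF assms(1), of s] by auto

lemma generator_diff:
  assumes "(f, g) \<in> gen" "(f', g') \<in> gen"
  shows "((\<lambda>x. f x - f' x), (\<lambda>x. g x - g' x)) \<in> gen"
proof -
  let ?q = "\<lambda>f g t x. (shift (- t) f x - f x) / t - g x"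
  have int: "integrable m f" "integrable m g" "integrable m f'" "integrable m g'"
    and lim: "((\<lambda>t. LINT x|m. \<bar>?q f g t x\<bar>) \<longlongrightarrow> 0) (at_right 0)"
      "((\<lambda>t. LINT x|m. \<bar>?q f' g' t x\<bar>) \<longlongrightarrow> 0) (at_right 0)"
    using assms by (auto simp: generator_iff)
  note iq = integrable_quotient[OF int(1,2)] integrable_quotient[OF int(3,4)]
  have "((\<lambda>t. LINT x|m. \<bar>?q (\<lambda>x. f x - f' x) (\<lambda>x. g x - g' x) t x\<bar>) \<longlongrightarrow> 0) (at_right 0)"
  proof (rule tendsto_sandwich[OF _ _ tendsto_const])
    show "((\<lambda>t. (LINT x|m. \<bar>?q f g t x\<bar>) + (LINT x|m. \<bar>?q f' g' t x\<bar>)) \<longlongrightarrow> 0) (at_right 0)"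
      using tendsto_add[OF lim] by simp
    show "\<forall>\<^sub>F t in at_right 0. (LINT x|m. \<bar>?q (\<lambda>x. f x - f' x) (\<lambda>x. g x - g' x) t x\<bar>)
        \<le> (LINT x|m. \<bar>?q f g t x\<bar>) + (LINT x|m. \<bar>?q f' g' t x\<bar>)"
    proof (rule always_eventually, rule allI)
      fix t
      have eq: "?q (\<lambda>x. f x - f' x) (\<lambda>x. g x - g' x) t x = ?q f g t x - ?q f' g' t x" for x
        by (simp add: shift_def left_diff_distrib diff_divide_distrib)
      show "(LINT x|m. \<bar>?q (\<lambda>x. f x - f' x) (\<lambda>x. g x - g' x) t x\<bar>)
        \<le> (LINT x|m. \<bar>?q f g t x\<bar>) + (LINT x|m. \<bar>?q f' g' t x\<bar>)"
        unfolding eq by (rule integral_abs_diff_le[OF iq])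
    qed
    show "\<forall>\<^sub>F t in at_right 0. 0 \<le> (LINT x|m. \<bar>?q (\<lambda>x. f x - f' x) (\<lambda>x. g x - g' x) t x\<bar>)"
      by (auto intro!: always_eventually integral_nonneg_AE)
  qed
  then show ?thesis
    using int by (auto simp: generator_iff)
qed

lemma generator_cong_AE:
  assumes fg: "(f, g) \<in> gen" and f': "integrable m f'" "AE x in m. f x = f' x"
    and g': "integrable m g'" "AE x in m. g x = g' x"
  shows "(f', g') \<in> gen"
proof -
  have int: "integrable m f" "integrable m g" using fg by (auto simp: generator_iff)
  have "(LINT x|m. \<bar>(shift (- t) f x - f x) / t - g x\<bar>) = (LINT x|m. \<bar>(shift (- t) f' x - f' x) / t - g' x\<bar>)" for t
  proof (rule integral_cong_AE)
    show "AE x in m. \<bar>(shift (- t) f x - f x) / t - g x\<bar> = \<bar>(shift (- t) f' x - f' x) / t - g' x\<bar>"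
      using shift_cong_AE[OF f'(2), of "- t"] f'(2) g'(2) by eventually_elim simp
    show "(\<lambda>x. \<bar>(shift (- t) f x - f x) / t - g x\<bar>) \<in> borel_measurable m"
      using integrable_quotient[OF int, of "- t" t] by (intro borel_measurable_integrable) auto
    show "(\<lambda>x. \<bar>(shift (- t) f' x - f' x) / t - g' x\<bar>) \<in> borel_measurable m"
      using integrable_quotient[OF f'(1) g'(1), of "- t" t] by (intro borel_measurable_integrable) auto
  qed
  then show ?thesis
    using fg f'(1) g'(1) by (simp add: generator_iff)
qed

text \<open>A contraction semigroup cannot grow like \<open>exp t\<close> to first order, so \<open>1\<close> is not an
  eigenvalue of its generator.\<close>

lemma generator_dissipative:
  assumes "(k, k) \<in> gen"
  shows "AE x in m. k x = 0"
proof -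
  let ?n = "LINT x|m. \<bar>k x\<bar>"
  let ?q = "\<lambda>t x. (shift (- t) k x - k x) / t - k x"
  have k: "integrable m k" and lim: "((\<lambda>t. LINT x|m. \<bar>?q t x\<bar>) \<longlongrightarrow> 0) (at_right 0)"
    using assms by (auto simp: generator_iff)
  have "?n \<le> 0"
  proof (rule tendsto_lowerbound[OF lim])
    show "\<forall>\<^sub>F t in at_right 0. ?n \<le> (LINT x|m. \<bar>?q t x\<bar>)"
      using eventually_at_right_less
    proof eventually_elim
      case (elim t)
      have pw: "(1 + t) * \<bar>k x\<bar> \<le> \<bar>shift (- t) k x\<bar> + t * \<bar>?q t x\<bar>" for x
      proof -
        have "(1 + t) * k x = shift (- t) k x - t * ?q t x"
          using elim by (simp add: field_simps)
        then have "\<bar>(1 + t) * k x\<bar> \<le> \<bar>shift (- t) k x\<bar> + \<bar>t * ?q t x\<bar>"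
          by (metis abs_triangle_ineq4)
        then show ?thesis
          using elim by (simp add: abs_mult)
      qed
      have "(1 + t) * ?n = (LINT x|m. (1 + t) * \<bar>k x\<bar>)" by simp
      also have "\<dots> \<le> (LINT x|m. \<bar>shift (- t) k x\<bar> + t * \<bar>?q t x\<bar>)"
        using k integrable_shift[OF k] integrable_quotient[OF k k] pw
        by (intro integral_mono Bochner_Integration.integrable_add integrable_mult_right integrable_abs)
      also have "\<dots> = (LINT x|m. \<bar>shift (- t) k x\<bar>) + t * (LINT x|m. \<bar>?q t x\<bar>)"
      proof -
        have "integrable m (\<lambda>x. t * \<bar>?q t x\<bar>)"
          by (intro integrable_mult_right integrable_abs integrable_quotient k)
        then show ?thesis
          using Bochner_Integration.integral_add[OF integrable_abs[OF integrable_shift[OF k, of "- t"]]]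
          by (simp only: integral_mult_right_zero)
      qed
      also have "\<dots> \<le> ?n + t * (LINT x|m. \<bar>?q t x\<bar>)"
        using integral_shift_le[OF k] by simp
      finally have "t * ?n \<le> t * (LINT x|m. \<bar>?q t x\<bar>)"
        by (simp add: algebra_simps)
      then show ?case using elim by simp
    qed
  qed simp
  moreover have "0 \<le> ?n" by (intro integral_nonneg_AE) auto
  ultimately have "?n = 0" by simp
  then show ?thesis
    using k by (subst (asm) integral_nonneg_eq_0_iff_AE) auto
qed

section \<open>The generator is a restriction of the maximal transport operator\<close>

text \<open>A compact subset of \<open>\<Omega>\<close> cannot be left in arbitrarily short time.  This keeps the difference
  quotients of test functions bounded up to the boundary.\<close>

lemma compact_stays:
  assumes "compact K" "K \<subseteq> \<Omega>"
  obtains d where "0 < d" "\<And>x t. x \<in> K \<Longrightarrow> \<bar>t\<bar> < d \<Longrightarrow> stays x t"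
proof -
  have "K \<times> {0} \<subseteq> {z. stays (fst z) (snd z)}" using assms(2) by auto
  then obtain e where e: "0 < e" "(\<Union>z\<in>K \<times> {0}. ball z e) \<subseteq> {z. stays (fst z) (snd z)}"
    using compact_subset_open_imp_ball_epsilon_subset[OF _ open_stays, of "K \<times> {0}"] assms(1)
    by (auto simp: compact_Times)
  have "stays x t" if "x \<in> K" "\<bar>t\<bar> < e" for x t
  proof -
    have "(x, t) \<in> ball (x, 0) e"
      using that(2) by (simp add: dist_Pair_Pair)
    then show ?thesis using e(2) that(1) by force
  qed
  with e(1) that show thesis by blast
qed

text \<open>The maximal open null set may be a union of uncountably many sets; Lindelof's theorem reduces it
  to a countable one.\<close>

lemma AE_ess_support: "AE x in m. x \<notin> ess_support M \<Omega> \<psi> \<longrightarrow> \<psi> x = 0"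
proof -
  let ?F = "{V. open V \<and> V \<subseteq> \<Omega> \<and> (AE x\<in>V in M. \<psi> x = 0)}"
  obtain F' where F': "F' \<subseteq> ?F" "countable F'" "\<Union>F' = \<Union>?F"
    using Lindelof[of ?F] by auto
  have "AE x in M. \<forall>V\<in>F'. x \<in> V \<longrightarrow> \<psi> x = 0"
    using F' by (intro AE_ball_countable') auto
  then have "AE x in M. x \<in> \<Union>?F \<longrightarrow> \<psi> x = 0"
    unfolding F'(3)[symmetric] by (auto elim!: eventually_mono)
  then show ?thesis
    by (auto simp: AE_restrict_space_iff ess_support_def elim!: eventually_mono)
qed

lemma test_function_deriv:
  assumes \<psi>: "\<psi> \<in> test_functions M \<Phi> \<Omega>" and st: "stays x t"
  shows "((\<lambda>s. \<psi> (\<Phi> x s)) has_real_derivative flow_deriv \<Phi> \<psi> (\<Phi> x t)) (at t)"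
proof -
  have x: "x \<in> \<Omega>" using st by (rule stays_imp_start)
  have "(\<lambda>s. \<psi> (\<Phi> x s)) C1_differentiable_on {s. stays x s}"
    using \<psi> x by (auto simp: test_functions_def stays_iff)
  then obtain D where "((\<lambda>s. \<psi> (\<Phi> x s)) has_vector_derivative D t) (at t)"
    using st by (auto simp: C1_differentiable_on_def)
  then have D: "((\<lambda>s. \<psi> (\<Phi> x s)) has_real_derivative D t) (at t)"
    by (simp add: has_real_derivative_iff_has_vector_derivative)
  then have "((\<lambda>s. \<psi> (\<Phi> (\<Phi> x t) s)) has_real_derivative D t) (at 0)"
    using DERIV_shift[of "\<lambda>s. \<psi> (\<Phi> x s)" "D t" 0 t] by (simp add: add.commute)
  then have "flow_deriv \<Phi> \<psi> (\<Phi> x t) = D t"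
    unfolding flow_deriv_def by (rule DERIV_imp_deriv)
  with D show ?thesis by simp
qed

lemma test_function_increment:
  assumes \<psi>: "\<psi> \<in> test_functions M \<Phi> \<Omega>" and C: "\<And>x. x \<in> \<Omega> \<Longrightarrow> \<bar>flow_deriv \<Phi> \<psi> x\<bar> \<le> C"
    and st: "stays x t" and t: "0 < t"
  shows "\<bar>\<psi> (\<Phi> x t) - \<psi> x\<bar> \<le> C * t"
proof -
  have st': "stays x s" if "0 \<le> s" "s \<le> t" for s
    using stays_between[OF st] that t by (simp add: closed_segment_eq_real_ivl)
  obtain z where z: "0 < z" "z < t" "\<psi> (\<Phi> x t) - \<psi> (\<Phi> x 0) = (t - 0) * flow_deriv \<Phi> \<psi> (\<Phi> x z)"
    using MVT2[OF t, of "\<lambda>s. \<psi> (\<Phi> x s)" "\<lambda>s. flow_deriv \<Phi> \<psi> (\<Phi> x s)"] test_function_deriv[OF \<psi> st'] by auto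
  have "\<bar>flow_deriv \<Phi> \<psi> (\<Phi> x z)\<bar> \<le> C"
    using z st'[of z] by (intro C stays_imp_end) auto
  then show ?thesis
    using z t by (simp add: abs_mult mult.commute mult_left_mono)
qed

text \<open>The difference quotient of \<open>f\<close> tested against \<open>\<psi>\<close> is \<open>f\<close> tested against the difference
  quotient of \<open>\<psi>\<close> in forward time, which converges pointwise to \<open>flow_deriv \<Phi> \<psi>\<close>.  It is bounded by the
  mean value theorem where the orbit stays in \<open>\<Omega>\<close>; where it does not, \<open>\<psi>\<close> already vanishes, the
  support being compact.  Dominated convergence does the rest.\<close>

lemma generator_imp_T_max:
  assumes "(f, g) \<in> gen"
  shows "(f, g) \<in> T_max M \<Phi> \<Omega>"
proof -
  let ?q = "\<lambda>t x. (shift (- t) f x - f x) / t"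
  have f: "integrable m f" and g: "integrable m g"
    and lim: "((\<lambda>t. LINT x|m. \<bar>?q t x - g x\<bar>) \<longlongrightarrow> 0) (at_right 0)"
    using assms by (auto simp: generator_iff)
  have "(LINT x|m. g x * \<psi> x) = (LINT x|m. f x * flow_deriv \<Phi> \<psi> x)" if \<psi>: "\<psi> \<in> test_functions M \<Phi> \<Omega>" for \<psi>
  proof -
    let ?K = "ess_support M \<Omega> \<psi>"
    have \<psi>m: "\<psi> \<in> borel_measurable m" and dm: "flow_deriv \<Phi> \<psi> \<in> borel_measurable m"
      and K: "compact ?K" "?K \<subseteq> \<Omega>"
      using \<psi> by (auto simp: test_functions_def ess_support_def)
    obtain C0 where C0: "\<And>x. x \<in> \<Omega> \<Longrightarrow> \<bar>\<psi> x\<bar> \<le> C0"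
      using \<psi> by (auto simp: test_functions_def bounded_iff)
    obtain C1 where C1: "\<And>x. x \<in> \<Omega> \<Longrightarrow> \<bar>flow_deriv \<Phi> \<psi> x\<bar> \<le> C1"
      using \<psi> by (auto simp: test_functions_def bounded_iff)
    obtain d where d: "0 < d" "\<And>x t. x \<in> ?K \<Longrightarrow> \<bar>t\<bar> < d \<Longrightarrow> stays x t"
      using compact_stays[OF K] by blast
    have C0': "AE x in m. \<bar>\<psi> x\<bar> \<le> C0" using C0 by (intro AE_I2) simp
    have times_\<psi>: "integrable m (\<lambda>x. h x * \<psi> x)" if "integrable m h" for h
    proof (rule Bochner_Integration.integrable_bound)
      show "integrable m (\<lambda>x. C0 * h x)" using that by simp
      show "AE x in m. norm (h x * \<psi> x) \<le> norm (C0 * h x)"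
        using C0' by eventually_elim (simp only: real_norm_def abs_mult_le_const)
    qed (use that \<psi>m in auto)
    \<comment> \<open>The limit of the tested difference quotients is computed in two ways.\<close>
    have lim1: "((\<lambda>t. LINT x|m. ?q t x * \<psi> x) \<longlongrightarrow> (LINT x|m. g x * \<psi> x)) (at_right 0)"
    proof (rule metric_tendsto_imp_tendsto)
      show "((\<lambda>t. C0 * (LINT x|m. \<bar>?q t x - g x\<bar>)) \<longlongrightarrow> 0) (at_right 0)"
        using tendsto_mult_left[OF lim, of C0] by simp
      show "\<forall>\<^sub>F t in at_right 0. dist (LINT x|m. ?q t x * \<psi> x) (LINT x|m. g x * \<psi> x)
          \<le> dist (C0 * (LINT x|m. \<bar>?q t x - g x\<bar>)) 0"
      proof (rule always_eventually, rule allI)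
        fix t
        have iq: "integrable m (?q t)"
          using f integrable_shift[OF f, of "- t"] by auto
        have iqg: "integrable m (\<lambda>x. ?q t x - g x)"
          by (rule integrable_quotient[OF f g])
        have "(LINT x|m. ?q t x * \<psi> x) - (LINT x|m. g x * \<psi> x) = (LINT x|m. (?q t x - g x) * \<psi> x)"
          unfolding left_diff_distrib
          using times_\<psi>[OF iq] times_\<psi>[OF g] by (rule Bochner_Integration.integral_diff[symmetric])
        then have "dist (LINT x|m. ?q t x * \<psi> x) (LINT x|m. g x * \<psi> x) = \<bar>LINT x|m. (?q t x - g x) * \<psi> x\<bar>"
          by (simp add: dist_real_def)
        also have "\<dots> \<le> (LINT x|m. \<bar>(?q t x - g x) * \<psi> x\<bar>)"
          by (rule integral_abs_bound)
        also have "\<dots> \<le> (LINT x|m. C0 * \<bar>?q t x - g x\<bar>)"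
        proof (rule integral_mono_AE)
          show "AE x in m. \<bar>(?q t x - g x) * \<psi> x\<bar> \<le> C0 * \<bar>?q t x - g x\<bar>"
            using C0' by eventually_elim (rule abs_mult_le_const)
          show "integrable m (\<lambda>x. \<bar>(?q t x - g x) * \<psi> x\<bar>)"
            using times_\<psi>[OF iqg] by (rule integrable_abs)
          show "integrable m (\<lambda>x. C0 * \<bar>?q t x - g x\<bar>)"
            using iqg by (intro integrable_mult_right integrable_abs)
        qed
        also have "\<dots> \<le> dist (C0 * (LINT x|m. \<bar>?q t x - g x\<bar>)) 0"
          by simp
        finally show "dist (LINT x|m. ?q t x * \<psi> x) (LINT x|m. g x * \<psi> x)
          \<le> dist (C0 * (LINT x|m. \<bar>?q t x - g x\<bar>)) 0" .
      qed
    qed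
    have swap: "(LINT x|m. ?q t x * \<psi> x) = (LINT x|m. f x * ((shift t \<psi> x - \<psi> x) / t))" for t
    proof -
      have i1: "integrable m (\<lambda>x. shift (- t) f x * \<psi> x)" "integrable m (\<lambda>x. f x * \<psi> x)"
        using times_\<psi> integrable_shift[OF f] f by auto
      have i2: "integrable m (\<lambda>x. f x * shift t \<psi> x)"
      proof (rule Bochner_Integration.integrable_bound)
        show "integrable m (\<lambda>x. C0 * f x)" using f by simp
        show "AE x in m. norm (f x * shift t \<psi> x) \<le> norm (C0 * f x)"
          using C0' AE_flow[OF C0', of t]
        proof eventually_elim
          case (elim x)
          then have "\<bar>shift t \<psi> x\<bar> \<le> C0"
            by (cases "stays x t") auto
          then show ?case by (simp only: real_norm_def abs_mult_le_const)
        qed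
      qed (use f measurable_shift[OF \<psi>m] in auto)
      have "(LINT x|m. ?q t x * \<psi> x) = (LINT x|m. (shift (- t) f x * \<psi> x - f x * \<psi> x) / t)"
        by (simp add: algebra_simps)
      also have "\<dots> = ((LINT x|m. shift (- t) f x * \<psi> x) - (LINT x|m. f x * \<psi> x)) / t"
        using i1 by simp
      also have "\<dots> = ((LINT x|m. f x * shift t \<psi> x) - (LINT x|m. f x * \<psi> x)) / t"
        using f \<psi>m by (subst integral_shift_adjoint) auto
      also have "\<dots> = (LINT x|m. (f x * shift t \<psi> x - f x * \<psi> x) / t)"
        using i1 i2 by simp
      finally show ?thesis by (simp add: algebra_simps)
    qed
    have lim2: "((\<lambda>t. LINT x|m. f x * ((shift t \<psi> x - \<psi> x) / t)) \<longlongrightarrow> (LINT x|m. f x * flow_deriv \<Phi> \<psi> x)) (at_right 0)"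
    proof (rule dominated_convergence_at_right[where w="\<lambda>x. C1 * \<bar>f x\<bar>"])
      show "(\<lambda>x. f x * ((shift t \<psi> x - \<psi> x) / t)) \<in> borel_measurable m" for t
        using f \<psi>m measurable_shift[OF \<psi>m] by (auto intro!: borel_measurable_times borel_measurable_divide borel_measurable_diff)
      show "AE x in m. ((\<lambda>t. f x * ((shift t \<psi> x - \<psi> x) / t)) \<longlongrightarrow> f x * flow_deriv \<Phi> \<psi> x) (at_right 0)"
      proof (rule AE_I2)
        fix x assume "x \<in> space m"
        then have "stays x 0" by simp
        from test_function_deriv[OF \<psi> this]
        have "((\<lambda>t. (\<psi> (\<Phi> x t) - \<psi> x) / t) \<longlongrightarrow> flow_deriv \<Phi> \<psi> x) (at 0)"
          by (simp add: DERIV_def)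
        then have *: "((\<lambda>t. (\<psi> (\<Phi> x t) - \<psi> x) / t) \<longlongrightarrow> flow_deriv \<Phi> \<psi> x) (at_right 0)"
          by (rule filterlim_mono) (auto intro: at_le)
        have "\<forall>\<^sub>F t in nhds 0. t \<in> {t. stays x t}"
          using \<open>stays x 0\<close> by (intro eventually_nhds_in_open open_stays_time) auto
        then have "\<forall>\<^sub>F t in at_right 0. stays x t"
          by (auto simp: at_within_def intro: filter_leD[OF inf_le1])
        then have "\<forall>\<^sub>F t in at_right 0. (\<psi> (\<Phi> x t) - \<psi> x) / t = (shift t \<psi> x - \<psi> x) / t"
          by eventually_elim simp
        with * have "((\<lambda>t. (shift t \<psi> x - \<psi> x) / t) \<longlongrightarrow> flow_deriv \<Phi> \<psi> x) (at_right 0)"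
          by (rule Lim_transform_eventually)
        then show "((\<lambda>t. f x * ((shift t \<psi> x - \<psi> x) / t)) \<longlongrightarrow> f x * flow_deriv \<Phi> \<psi> x) (at_right 0)"
          by (rule tendsto_mult_left)
      qed
      show "\<forall>\<^sub>F t in at_right 0. AE x in m. \<bar>f x * ((shift t \<psi> x - \<psi> x) / t)\<bar> \<le> C1 * \<bar>f x\<bar>"
        using eventually_at_right_real[OF d(1)]
      proof eventually_elim
        case (elim t)
        then have t: "0 < t" "t < d" by auto
        show ?case
          using AE_ess_support[of \<psi>] AE_space
        proof eventually_elim
          case (elim x)
          have C1_nonneg: "0 \<le> C1" using C1[of x] elim by auto
          have "\<bar>shift t \<psi> x - \<psi> x\<bar> \<le> C1 * t"
          proof (cases "stays x t")
            case True
            then show ?thesis using test_function_increment[OF \<psi> C1 True t(1)] by simp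
          next
            case False
            then have "x \<notin> ?K" using d(2)[of x t] t by auto
            with False elim show ?thesis using C1_nonneg t by simp
          qed
          then have "\<bar>(shift t \<psi> x - \<psi> x) / t\<bar> \<le> C1"
            using t by (simp add: field_simps)
          then show ?case by (rule abs_mult_le_const)
        qed
      qed
    qed (use f dm in auto)
    from lim2 have "((\<lambda>t. LINT x|m. ?q t x * \<psi> x) \<longlongrightarrow> (LINT x|m. f x * flow_deriv \<Phi> \<psi> x)) (at_right 0)"
      by (simp only: swap)
    from tendsto_unique[OF _ lim1 this] show ?thesis by simp
  qed
  with f g show ?thesis by (simp add: T_max_def)
qed

end

section \<open>Integrated transport equation along orbits\<close>

lemma (in complete_measure) measurable_AE_cong:
  assumes g: "g \<in> measurable M N" and ae: "AE x in M. f x = g x" and f: "f \<in> space M \<rightarrow> space N"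
  shows "f \<in> measurable M N"
proof (rule measurableI)
  show "f x \<in> space N" if "x \<in> space M" for x using f that by auto
  fix A assume A: "A \<in> sets N"
  show "f -` A \<inter> space M \<in> sets M"
  proof (rule in_sets_AE[where A="g -` A \<inter> space M"])
    show "AE x in M. (x \<in> g -` A \<inter> space M) = (x \<in> f -` A \<inter> space M)"
      using ae by eventually_elim auto
  qed (use measurable_sets[OF g A] in auto)
qed

lemma integral_lebesgue_eq_lborel:
  fixes f g :: "real \<Rightarrow> real"
  assumes g: "g \<in> borel_measurable borel" and ae: "AE x in lborel. f x = g x"
  shows "(LINT x|lebesgue. f x) = (LINT x|lborel. g x)"
proof -
  have ae': "AE x in lebesgue. f x = g x"
    using ae by (rule AE_completion)
  have g': "g \<in> borel_measurable lebesgue"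
    using g by (intro measurable_completion) simp
  have "(LINT x|lebesgue. f x) = (LINT x|lebesgue. g x)"
    by (rule integral_cong_AE[OF completion.measurable_AE_cong[OF g' ae'] g' ae']) auto
  also have "\<dots> = (LINT x|lborel. g x)"
    using g by (intro integral_completion) simp
  finally show ?thesis .
qed

context invariant_flow
begin

text \<open>Tonelli's theorem turns bounds on spatial integrals at fixed times into bounds on
  integrals along orbits.\<close>

lemma tonelli_weighted:
  fixes k :: "real ^ 'n \<Rightarrow> real \<Rightarrow> ennreal" and w :: "real \<Rightarrow> ennreal"
  assumes k: "(\<lambda>z. k (fst z) (snd z)) \<in> borel_measurable (m \<Otimes>\<^sub>M lborel)"
    and w[measurable]: "w \<in> borel_measurable borel"
    and le: "\<And>s. w s \<noteq> 0 \<Longrightarrow> (\<integral>\<^sup>+x. k x s \<partial>m) \<le> c"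
  shows "(\<integral>\<^sup>+x. (\<integral>\<^sup>+s. w s * k x s \<partial>lborel) \<partial>m) \<le> c * (\<integral>\<^sup>+s. w s \<partial>lborel)"
proof -
  have wk: "(\<lambda>z. w (snd z) * k (fst z) (snd z)) \<in> borel_measurable (m \<Otimes>\<^sub>M lborel)"
    using k by measurable
  have ks: "(\<lambda>x. k x s) \<in> borel_measurable m" for s
    using measurable_compose[OF measurable_Pair2'[of s lborel m] k] by simp
  have "(\<integral>\<^sup>+x. (\<integral>\<^sup>+s. w s * k x s \<partial>lborel) \<partial>m) = (\<integral>\<^sup>+s. (\<integral>\<^sup>+x. w s * k x s \<partial>m) \<partial>lborel)"
    using mt.Fubini'[of "\<lambda>x s. w s * k x s"] wk by (simp add: case_prod_beta')
  also have "\<dots> = (\<integral>\<^sup>+s. w s * (\<integral>\<^sup>+x. k x s \<partial>m) \<partial>lborel)"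
    using ks by (intro nn_integral_cong nn_integral_cmult) auto
  also have "\<dots> \<le> (\<integral>\<^sup>+s. w s * c \<partial>lborel)"
  proof (rule nn_integral_mono)
    fix s show "w s * (\<integral>\<^sup>+x. k x s \<partial>m) \<le> w s * c"
      using le[of s] by (cases "w s = 0") (auto intro: mult_left_mono)
  qed
  also have "\<dots> = c * (\<integral>\<^sup>+s. w s \<partial>lborel)"
    by (subst nn_integral_multc) (auto simp: mult.commute)
  finally show ?thesis .
qed

lemma measurable_shift_time [measurable]:
  "f \<in> borel_measurable borel \<Longrightarrow> (\<lambda>s. shift s f x) \<in> borel_measurable borel"
  by (rule measurable_shift_pair) simp_all

lemma measurable_shift_pair_m:
  assumes "f \<in> borel_measurable borel"
  shows "(\<lambda>z. shift (snd z) f (fst z)) \<in> borel_measurable (m \<Otimes>\<^sub>M lborel)"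
  by (rule measurable_shift_pair[OF assms _ measurable_fst_borel]) measurable

lemma AE_integrable_orbit:
  fixes w :: "real \<Rightarrow> real"
  assumes f[measurable]: "f \<in> borel_measurable borel" "integrable m f"
    and w: "integrable lborel w"
  shows "AE x in m. integrable lborel (\<lambda>s. w s * shift s f x)"
proof -
  let ?c = "\<integral>\<^sup>+x. ennreal \<bar>f x\<bar> \<partial>m"
  have [measurable]: "w \<in> borel_measurable borel" using w by auto
  have meas: "(\<lambda>z. ennreal \<bar>shift (snd z) f (fst z)\<bar>) \<in> borel_measurable (m \<Otimes>\<^sub>M lborel)"
    using measurable_shift_pair_m[OF f(1)] by measurable
  have "(\<integral>\<^sup>+x. (\<integral>\<^sup>+s. ennreal \<bar>w s\<bar> * ennreal \<bar>shift s f x\<bar> \<partial>lborel) \<partial>m) \<le> ?c * (\<integral>\<^sup>+s. ennreal \<bar>w s\<bar> \<partial>lborel)"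
    using f(2) by (intro tonelli_weighted[OF meas] nn_integral_shift_le) auto
  also have "\<dots> < \<infinity>"
    using f(2) w by (auto simp: integrable_iff_bounded ennreal_mult_less_top)
  finally have fin: "(\<integral>\<^sup>+x. (\<integral>\<^sup>+s. ennreal \<bar>w s\<bar> * ennreal \<bar>shift s f x\<bar> \<partial>lborel) \<partial>m) \<noteq> \<infinity>" by simp
  have "AE x in m. (\<integral>\<^sup>+s. ennreal \<bar>w s\<bar> * ennreal \<bar>shift s f x\<bar> \<partial>lborel) \<noteq> \<infinity>"
  proof (rule nn_integral_PInf_AE[OF _ fin])
    have "(\<lambda>z. ennreal \<bar>w (snd z)\<bar> * ennreal \<bar>shift (snd z) f (fst z)\<bar>) \<in> borel_measurable (m \<Otimes>\<^sub>M lborel)"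
      using meas by measurable
    then show "(\<lambda>x. \<integral>\<^sup>+s. ennreal \<bar>w s\<bar> * ennreal \<bar>shift s f x\<bar> \<partial>lborel) \<in> borel_measurable m"
      by (intro lborel.borel_measurable_nn_integral) (simp add: case_prod_beta')
  qed
  then show ?thesis
  proof eventually_elim
    case (elim x)
    then show ?case
      by (auto simp: integrable_iff_bounded abs_mult ennreal_mult less_top)
  qed
qed

definition orbit_eq :: "(real ^ 'n \<Rightarrow> real) \<Rightarrow> (real ^ 'n \<Rightarrow> real) \<Rightarrow> real ^ 'n \<Rightarrow> bool" where
  "orbit_eq h g x \<longleftrightarrow> (\<forall>t1 t2. stays x t1 \<and> t1 \<le> t2 \<and> stays x t2 \<longrightarrow>
     h (\<Phi> x t1) - h (\<Phi> x t2) = (LINT s:{t1..t2}|lebesgue. g (\<Phi> x s)))"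

text \<open>The trace condition seen from a point \<open>x\<close> of \<open>\<Omega>\<close> whose orbit has entered \<open>\<Omega>\<close>, at the boundary
  point \<open>\<Phi> x (- a)\<close>; it says nothing about orbits that never entered.\<close>

definition zero_at_entry :: "(real ^ 'n \<Rightarrow> real) \<Rightarrow> real ^ 'n \<Rightarrow> bool" where
  "zero_at_entry h x \<longleftrightarrow> (\<forall>a. tau_minus \<Phi> \<Omega> x = ereal a \<longrightarrow>
     ((\<lambda>t. h (\<Phi> (\<Phi> x (- a)) t)) \<longlongrightarrow> 0) (at_right 0))"

text \<open>With a Borel version of \<open>g\<close> the integral along the orbit may be taken with respect to
  \<open>lborel\<close>, where Fubini's theorem is available.\<close>

lemma orbit_eq_borel:
  assumes eq: "orbit_eq h g x" and g'[measurable]: "g' \<in> borel_measurable borel"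
    and ae: "AE s in lborel. stays x s \<longrightarrow> g (\<Phi> x s) = g' (\<Phi> x s)"
    and st: "stays x t1" "t1 \<le> t2" "stays x t2"
  shows "h (\<Phi> x t1) - h (\<Phi> x t2) = (LINT s|lborel. indicator {t1..t2} s * shift s g' x)"
proof -
  have "h (\<Phi> x t1) - h (\<Phi> x t2) = (LINT s|lebesgue. indicator {t1..t2} s * g (\<Phi> x s))"
    using eq st by (simp add: orbit_eq_def set_lebesgue_integral_def)
  also have "\<dots> = (LINT s|lborel. indicator {t1..t2} s * shift s g' x)"
  proof (rule integral_lebesgue_eq_lborel)
    show "AE s in lborel. indicator {t1..t2} s * g (\<Phi> x s) = indicator {t1..t2} s * shift s g' x"
      using ae
    proof eventually_elim
      case (elim s)
      then show ?case
        using stays_interval[OF st(1,3), of s] by (auto simp: indicator_def)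
    qed
  qed measurable
  finally show ?thesis .
qed

text \<open>This is \<open>U t h - h = \<integral> U s g ds\<close> over \<open>0 < s < t\<close>, with \<open>s\<close> replaced by \<open>- s\<close>.  If the orbit entered
  \<open>\<Omega>\<close> less than \<open>t\<close> ago, the equation is integrated from the entry point on, where \<open>h\<close> contributes
  nothing; this is where the zero trace is used.\<close>

lemma orbit_eq_duhamel:
  assumes eq: "orbit_eq h g x" and z: "zero_at_entry h x" and x: "x \<in> \<Omega>" and t: "0 < t"
    and g'[measurable]: "g' \<in> borel_measurable borel"
    and ae: "AE s in lborel. stays x s \<longrightarrow> g (\<Phi> x s) = g' (\<Phi> x s)"
    and int: "integrable lborel (\<lambda>s. indicator {- t..0} s * shift s g' x)"
  shows "shift (- t) h x - h x = (LINT s|lborel. indicator {- t..0} s * shift s g' x)"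
proof (cases "stays x (- t)")
  case True
  then show ?thesis
    using orbit_eq_borel[OF eq g' ae True, of 0] t x by simp
next
  case False
  then have "\<not> ereal t < tau_minus \<Phi> \<Omega> x"
    using tau_minus_gt_iff[OF x, of t] t by simp
  then obtain a where a: "tau_minus \<Phi> \<Omega> x = ereal a" "0 < a" "a \<le> t"
    using tau_minus_pos[OF x] by (cases "tau_minus \<Phi> \<Omega> x") auto
  have st: "stays x s \<longleftrightarrow> - a < s" if "s \<le> 0" for s
    using tau_minus_gt_iff[OF x, of "- s"] that a by auto
  let ?v = "\<lambda>s. shift s g' x"
  have "((\<lambda>e. LINT s|lborel. indicator {e - a..0} s * ?v s) \<longlongrightarrow>
      (LINT s|lborel. indicator {- t..0} s * ?v s)) (at_right 0)"
  proof (rule dominated_convergence_at_right[where w="\<lambda>s. \<bar>indicator {- t..0} s * ?v s\<bar>"])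
    show "AE s in lborel. ((\<lambda>e. indicator {e - a..0} s * ?v s) \<longlongrightarrow> indicator {- t..0} s * ?v s) (at_right 0)"
    proof (rule AE_I2, rule tendsto_eventually)
      fix s
      consider "0 < s" | "s \<le> - a" | "- a < s" "s \<le> 0" by linarith
      then show "\<forall>\<^sub>F e in at_right 0. indicator {e - a..0} s * ?v s = indicator {- t..0} s * ?v s"
      proof cases
        case 3
        then have "\<forall>\<^sub>F e in at_right 0. e \<in> {0<..<s + a}"
          by (intro eventually_at_right_real) simp
        then show ?thesis
          by eventually_elim (use 3 a in \<open>simp add: indicator_def\<close>)
      next
        case 2
        with st[of s] a have "?v s = 0" by simp
        then show ?thesis by simp
      qed simp
    qed
    show "\<forall>\<^sub>F e in at_right 0. AE s in lborel. \<bar>indicator {e - a..0} s * ?v s\<bar> \<le> \<bar>indicator {- t..0} s * ?v s\<bar>"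
      using eventually_at_right_less
      by eventually_elim (use a in \<open>simp add: indicator_def\<close>)
  qed (use int in auto)
  moreover have "((\<lambda>e. LINT s|lborel. indicator {e - a..0} s * ?v s) \<longlongrightarrow> 0 - h x) (at_right 0)"
  proof (rule Lim_transform_eventually)
    show "((\<lambda>e. h (\<Phi> (\<Phi> x (- a)) e) - h x) \<longlongrightarrow> 0 - h x) (at_right 0)"
      using z a(1) by (intro tendsto_diff tendsto_const) (simp add: zero_at_entry_def)
    show "\<forall>\<^sub>F e in at_right 0. h (\<Phi> (\<Phi> x (- a)) e) - h x = (LINT s|lborel. indicator {e - a..0} s * ?v s)"
      using eventually_at_right_real[OF a(2)]
    proof eventually_elim
      case (elim e)
      then show ?case
        using orbit_eq_borel[OF eq g' ae, of "e - a" 0] st[of "e - a"] x by (simp add: add.commute)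
    qed
  qed
  ultimately have "(LINT s|lborel. indicator {- t..0} s * ?v s) = 0 - h x"
    by (rule tendsto_unique[rotated]) simp
  with False show ?thesis by simp
qed

text \<open>By the previous formula the difference quotient minus \<open>g\<close> is the mean of \<open>U s g - g\<close> over
  \<open>0 < s < t\<close>, whose norm is at most the supremum of the norms of \<open>U s g - g\<close>.  Strong continuity
  makes it small.\<close>

lemma orbit_eq_imp_generator:
  assumes f: "integrable m f" and g: "integrable m g"
    and h: "h \<in> borel_measurable m" "AE x in m. h x = f x"
    and eq: "AE x in m. orbit_eq h g x" and z: "AE x in m. zero_at_entry h x"
  shows "(f, g) \<in> gen"
proof -
  obtain g' where g'[measurable]: "g' \<in> borel_measurable borel" "AE x in m. g x = g' x"
    using borel_version[OF borel_measurable_integrable[OF g]] by blast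
  have g'_int: "integrable m g'"
    by (rule integrable_cong_AE_imp[OF g _ g'(2)]) (rule borel_measurable_m, measurable)
  have h_int: "integrable m h"
    using h f by (intro integrable_cong_AE_imp[OF f h(1)]) (auto simp: eq_commute)
  let ?q = "\<lambda>t x. (shift (- t) h x - h x) / t - g' x"
  have "((\<lambda>t. LINT x|m. \<bar>?q t x\<bar>) \<longlongrightarrow> 0) (at_right 0)"
  proof (rule order_tendstoI)
    fix a :: real assume "a < 0"
    then show "\<forall>\<^sub>F t in at_right 0. a < (LINT x|m. \<bar>?q t x\<bar>)"
      by (auto intro!: always_eventually less_le_trans[of a 0] integral_nonneg_AE)
  next
    fix a :: real assume a: "0 < a"
    have "\<forall>\<^sub>F t in at_right 0. (LINT x|m. \<bar>shift (- t) g' x - g' x\<bar>) < a / 2"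
      using order_tendstoD(2)[OF strongly_cont_integrable[OF g'_int, unfolded strongly_cont_def], of "a / 2"] a by simp
    then obtain d where d: "0 < d" "\<And>t. 0 < t \<Longrightarrow> t < d \<Longrightarrow> (LINT x|m. \<bar>shift (- t) g' x - g' x\<bar>) < a / 2"
      by (auto simp: eventually_at_right_field)
    have d': "(\<integral>\<^sup>+x. ennreal \<bar>shift s g' x - g' x\<bar> \<partial>m) \<le> ennreal (a / 2)" if "- d < s" "s \<le> 0" for s
    proof (cases "s = 0")
      case True
      then have "(\<integral>\<^sup>+x. ennreal \<bar>shift s g' x - g' x\<bar> \<partial>m) = (\<integral>\<^sup>+x. 0 \<partial>m)"
        by (intro nn_integral_cong) simp
      then show ?thesis by simp
    next
      case False
      then show ?thesis
        using d(2)[of "- s"] that integrable_shift_diff[OF g'_int, of s] a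
        by (simp add: nn_integral_eq_integral)
    qed
    have "(LINT x|m. \<bar>?q t x\<bar>) < a" if t: "0 < t" "t < d" for t
    proof -
      let ?I = "\<lambda>s. indicator {- t..0} s :: real"
      have I: "integrable lborel ?I" "(LINT s|lborel. ?I s) = t"
        using t by (auto intro: integrable_real_indicator)
      have orbit_int: "AE x in m. integrable lborel (\<lambda>s. ?I s * shift s g' x)"
        by (rule AE_integrable_orbit[OF g'(1) g'_int I(1)])
      have "AE x in m. ennreal \<bar>?q t x\<bar>
          \<le> (\<integral>\<^sup>+s. ennreal (?I s / t) * ennreal \<bar>shift s g' x - g' x\<bar> \<partial>lborel)"
        using orbit_int eq z AE_orbit[OF g'(2)] AE_space
      proof eventually_elim
        case (elim x)
        have int2: "integrable lborel (\<lambda>s. ?I s * g' x)"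
          using I(1) by simp
        have "?q t x = ((LINT s|lborel. ?I s * shift s g' x) - (LINT s|lborel. ?I s * g' x)) / t"
          using orbit_eq_duhamel[of h g x t g'] elim t I(2) by (simp add: field_simps)
        also have "\<dots> = (LINT s|lborel. ?I s * shift s g' x - ?I s * g' x) / t"
          by (subst Bochner_Integration.integral_diff[OF elim(1) int2]) simp
        also have "\<dots> = (LINT s|lborel. (?I s * shift s g' x - ?I s * g' x) / t)"
          by simp
        also have "\<dots> = (LINT s|lborel. (?I s / t) * (shift s g' x - g' x))"
          by (simp only: times_divide_eq_left right_diff_distrib diff_divide_distrib)
        finally have "ennreal \<bar>?q t x\<bar> = ennreal (norm (LINT s|lborel. (?I s / t) * (shift s g' x - g' x)))"
          by simp
        also have "\<dots> \<le> (\<integral>\<^sup>+s. ennreal (norm ((?I s / t) * (shift s g' x - g' x))) \<partial>lborel)"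
        proof (rule integral_norm_bound_ennreal)
          have "integrable lborel (\<lambda>s. (?I s * shift s g' x - ?I s * g' x) / t)"
            using elim(1) int2 by auto
          then show "integrable lborel (\<lambda>s. (?I s / t) * (shift s g' x - g' x))"
            by (simp only: times_divide_eq_left right_diff_distrib diff_divide_distrib)
        qed
        also have "\<dots> = (\<integral>\<^sup>+s. ennreal (?I s / t) * ennreal \<bar>shift s g' x - g' x\<bar> \<partial>lborel)"
          using t by (intro nn_integral_cong) (simp add: abs_mult flip: ennreal_mult)
        finally show ?case .
      qed
      then have "(\<integral>\<^sup>+x. ennreal \<bar>?q t x\<bar> \<partial>m)
          \<le> (\<integral>\<^sup>+x. (\<integral>\<^sup>+s. ennreal (?I s / t) * ennreal \<bar>shift s g' x - g' x\<bar> \<partial>lborel) \<partial>m)"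
        by (rule nn_integral_mono_AE)
      also have "\<dots> \<le> ennreal (a / 2) * (\<integral>\<^sup>+s. ennreal (?I s / t) \<partial>lborel)"
      proof (rule tonelli_weighted)
        have "(\<lambda>z. g' (fst z)) \<in> borel_measurable (m \<Otimes>\<^sub>M lborel)"
          by (rule measurable_compose[OF measurable_fst_borel g'(1)])
        with measurable_shift_pair_m[OF g'(1)]
        show "(\<lambda>z. ennreal \<bar>shift (snd z) g' (fst z) - g' (fst z)\<bar>) \<in> borel_measurable (m \<Otimes>\<^sub>M lborel)"
          by measurable
        show "(\<integral>\<^sup>+x. ennreal \<bar>shift s g' x - g' x\<bar> \<partial>m) \<le> ennreal (a / 2)" if "ennreal (?I s / t) \<noteq> 0" for s
          using that t by (intro d') (auto simp: indicator_def split: if_splits)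
      qed measurable
      also have "(\<integral>\<^sup>+s. ennreal (?I s / t) \<partial>lborel) = 1"
        using t I by (subst nn_integral_eq_integral) auto
      finally have "ennreal (LINT x|m. \<bar>?q t x\<bar>) \<le> ennreal (a / 2)"
        using integrable_abs[OF integrable_quotient[OF h_int g'_int, of "- t" t]]
        by (subst (asm) nn_integral_eq_integral) auto
      then have "(LINT x|m. \<bar>?q t x\<bar>) \<le> a / 2"
        using a by (subst (asm) ennreal_le_iff) auto
      then show ?thesis using a by simp
    qed
    then show "\<forall>\<^sub>F t in at_right 0. (LINT x|m. \<bar>?q t x\<bar>) < a"
      using d(1) by (auto simp: eventually_at_right_field)
  qed
  then have "(h, g') \<in> gen"
    using h_int g'_int by (simp add: generator_iff)
  then show ?thesis
    by (rule generator_cong_AE[OF _ f h(2) g]) (use g'(2) in \<open>auto elim: eventually_mono\<close>)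
qed

end

section \<open>The resolvent at 1\<close>

lemma nn_integral_exp_atMost:
  "(\<integral>\<^sup>+s. ennreal (indicator {..r} s * exp s) \<partial>lborel) = ennreal (exp r)" for r :: real
proof -
  have lim: "((\<lambda>y::real. - exp (r - y)) \<longlongrightarrow> 0) at_top"
  proof -
    have "((\<lambda>y::real. exp (- y)) \<longlongrightarrow> 0) at_top"
      by (rule filterlim_compose[OF exp_at_bot filterlim_uminus_at_bot_at_top])
    from tendsto_mult_left[OF this, of "- exp r"] show ?thesis
      by (simp add: exp_diff exp_minus field_simps)
  qed
  have "(\<integral>\<^sup>+s. ennreal (indicator {..r} s * exp s) \<partial>lborel)
      = (\<integral>\<^sup>+y. ennreal (exp (r - y)) * indicator {0..} y \<partial>lborel)"
    by (subst nn_integral_real_affine[where c="- 1" and t=r])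
       (auto intro!: nn_integral_cong simp: indicator_def)
  also have "\<dots> = ennreal (0 - (- exp (r - 0)))"
    by (intro nn_integral_FTC_atLeast lim) (auto intro!: derivative_eq_intros)
  finally show ?thesis by simp
qed

lemma integrable_exp_atMost: "integrable lborel (\<lambda>s. indicator {..r} s * exp s)" for r :: real
  by (rule integrableI_bounded)
     (auto simp: nn_integral_exp_atMost abs_mult)

lemma integrable_pair_mult:
  fixes a :: "'a \<Rightarrow> real" and b :: "'b \<Rightarrow> real"
  assumes N: "sigma_finite_measure N" and a: "integrable M a" and b: "integrable N b"
  shows "integrable (M \<Otimes>\<^sub>M N) (\<lambda>(s, r). a s * b r)"
proof (rule integrableI_bounded)
  interpret N: sigma_finite_measure N by fact
  have [measurable]: "a \<in> borel_measurable M" "b \<in> borel_measurable N"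
    using a b by auto
  show "(\<lambda>(s, r). a s * b r) \<in> borel_measurable (M \<Otimes>\<^sub>M N)"
    by measurable
  have "(\<integral>\<^sup>+z. ennreal (norm (case z of (s, r) \<Rightarrow> a s * b r)) \<partial>(M \<Otimes>\<^sub>M N))
      = (\<integral>\<^sup>+s. \<integral>\<^sup>+r. ennreal (norm (a s)) * ennreal (norm (b r)) \<partial>N \<partial>M)"
    by (subst N.nn_integral_fst[symmetric]) (auto simp: abs_mult ennreal_mult)
  also have "\<dots> = (\<integral>\<^sup>+s. ennreal (norm (a s)) \<partial>M) * (\<integral>\<^sup>+r. ennreal (norm (b r)) \<partial>N)"
    by (simp add: nn_integral_cmult nn_integral_multc)
  also have "\<dots> < \<infinity>"
    using a b by (auto simp: integrable_iff_bounded ennreal_mult_less_top)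
  finally show "(\<integral>\<^sup>+z. ennreal (norm (case z of (s, r) \<Rightarrow> a s * b r)) \<partial>(M \<Otimes>\<^sub>M N)) < \<infinity>" .
qed

text \<open>The particular solution of \<open>W' = v - W\<close> given by variation of constants over the whole past.\<close>

definition exp_mean :: "(real \<Rightarrow> real) \<Rightarrow> real \<Rightarrow> real" where
  "exp_mean v r = (LINT s|lborel. indicator {..r} s * exp (s - r) * v s)"

lemma integral_exp_Icc:
  fixes a b :: real
  assumes "a \<le> b"
  shows "(LINT s|lborel. indicator {a..b} s * exp (- s)) = exp (- a) - exp (- b)"
    and "integrable lborel (\<lambda>s. indicator {a..b} s * exp (- s))"
proof -
  have "has_bochner_integral lborel (\<lambda>s. exp (- s) * indicator {a..b} s) (- exp (- b) - (- exp (- a)))"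
    by (rule has_bochner_integral_FTC_Icc_real[OF assms])
       (auto intro!: derivative_eq_intros continuous_intros)
  then show "(LINT s|lborel. indicator {a..b} s * exp (- s)) = exp (- a) - exp (- b)"
    "integrable lborel (\<lambda>s. indicator {a..b} s * exp (- s))"
    by (auto simp: mult.commute has_bochner_integral_iff)
qed

text \<open>For merely integrable \<open>v\<close> there is no pointwise differential equation; its integrated form
  comes from exchanging the order of integration.\<close>

lemma exp_mean_increment:
  assumes v[measurable]: "v \<in> borel_measurable borel"
    and int: "integrable lborel (\<lambda>s. indicator {..t2} s * exp s * v s)"
    and t: "t1 \<le> t2"
  shows "exp_mean v t1 - exp_mean v t2 = (LINT s|lborel. indicator {t1..t2} s * (exp_mean v s - v s))"
proof -
  define E where "E r = indicator {..t2} r * exp r * v r" for r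
  have E[measurable]: "E \<in> borel_measurable borel" and E_int: "integrable lborel E"
    using int by (auto simp: E_def[abs_def])
  define G where "G s r = indicator {t1..t2} s * exp (- s) * (indicator {..s} r * E r)" for s r
  have pair: "integrable (lborel \<Otimes>\<^sub>M lborel) (\<lambda>(s, r). (indicator {t1..t2} s * exp (- s)) * E r)"
    by (intro integrable_pair_mult lborel.sigma_finite_measure_axioms integral_exp_Icc t E_int)
  have G_int: "integrable (lborel \<Otimes>\<^sub>M lborel) (\<lambda>(s, r). G s r)"
  proof (rule Bochner_Integration.integrable_bound[OF pair])
    have "Measurable.pred (borel \<Otimes>\<^sub>M borel) (\<lambda>z::real \<times> real. snd z \<le> fst z)"
      by measurable
    then have "(\<lambda>z. indicator {t1..t2} (fst z) * exp (- fst z) * ((if snd z \<le> fst z then 1 else 0) * E (snd z)))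
        \<in> borel_measurable (borel \<Otimes>\<^sub>M borel)"
      by measurable
    then show "(\<lambda>(s, r). G s r) \<in> borel_measurable (lborel \<Otimes>\<^sub>M lborel)"
      by (simp add: G_def case_prod_beta' indicator_def of_bool_def cong: if_cong)
    show "AE z in lborel \<Otimes>\<^sub>M lborel. norm (case z of (s, r) \<Rightarrow> G s r)
        \<le> norm (case z of (s, r) \<Rightarrow> (indicator {t1..t2} s * exp (- s)) * E r)"
      by (intro AE_I2) (auto simp: G_def indicator_def)
  qed
  have W: "exp_mean v s = exp (- s) * (LINT r|lborel. indicator {..s} r * E r)" if "s \<le> t2" for s
  proof -
    have "exp_mean v s = (LINT r|lborel. exp (- s) * (indicator {..s} r * E r))"
      unfolding exp_mean_def using that
      by (intro Bochner_Integration.integral_cong) (auto simp: E_def indicator_def exp_diff exp_minus field_simps)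
    then show ?thesis by simp
  qed
  have cut: "integrable lborel (\<lambda>r. indicator {..s} r * E r)" for s
    by (rule Bochner_Integration.integrable_bound[OF E_int]) (auto simp: indicator_def)
  have v_int: "integrable lborel (\<lambda>s. indicator {t1..t2} s * v s)"
  proof (rule Bochner_Integration.integrable_bound)
    show "integrable lborel (\<lambda>s. exp (- t1) * E s)" using E_int by simp
    have "\<bar>v s\<bar> \<le> exp (- t1) * (exp s * \<bar>v s\<bar>)" if "t1 \<le> s" for s
    proof -
      have "1 * \<bar>v s\<bar> \<le> exp (s - t1) * \<bar>v s\<bar>" using that by (intro mult_right_mono) auto
      then show ?thesis by (simp add: exp_diff exp_minus field_simps)
    qed
    then show "AE s in lborel. norm (indicator {t1..t2} s * v s) \<le> norm (exp (- t1) * E s)"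
      by (intro AE_I2) (auto simp: E_def indicator_def abs_mult)
  qed measurable
  have W_G: "indicator {t1..t2} s * exp_mean v s = (LINT r|lborel. G s r)" for s
    by (cases "s \<in> {t1..t2}") (auto simp: G_def W)
  have W_int: "integrable lborel (\<lambda>s. indicator {t1..t2} s * exp_mean v s)"
    unfolding W_G using lborel_pair.integrable_fst'[OF G_int] by simp
  have "(LINT s|lborel. indicator {t1..t2} s * exp_mean v s) = (LINT s|lborel. LINT r|lborel. G s r)"
    by (simp only: W_G)
  also have "\<dots> = (LINT r|lborel. LINT s|lborel. G s r)"
    using lborel_pair.Fubini_integral[of G] G_int by simp
  also have "\<dots> = (LINT r|lborel. exp (- t1) * (indicator {..t1} r * E r)
      + (indicator {t1..t2} r * v r - exp (- t2) * (indicator {..t2} r * E r)))"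
  proof (rule integral_cong_AE)
    show "(\<lambda>r. LINT s|lborel. G s r) \<in> borel_measurable lborel"
      using lborel_pair.integrable_snd[OF G_int] by (intro borel_measurable_integrable) simp
    \<comment> \<open>At \<open>r = t1\<close> the first two terms on the right count the same mass twice; that single point is null.\<close>
    have "(LINT s|lborel. G s r) = exp (- t1) * (indicator {..t1} r * E r)
      + (indicator {t1..t2} r * v r - exp (- t2) * (indicator {..t2} r * E r))" if "r \<noteq> t1" for r
    proof (cases "r \<le> t2")
      case True
      have "(LINT s|lborel. G s r) = (LINT s|lborel. E r * (indicator {max t1 r..t2} s * exp (- s)))"
        by (intro Bochner_Integration.integral_cong) (auto simp: G_def indicator_def)
      also have "\<dots> = E r * (exp (- max t1 r) - exp (- t2))"
        using integral_exp_Icc(1)[of "max t1 r" t2] True t by simp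
      also have "\<dots> = exp (- t1) * (indicator {..t1} r * E r)
          + (indicator {t1..t2} r * v r - exp (- t2) * (indicator {..t2} r * E r))"
        using that True by (auto simp: E_def indicator_def max_def exp_minus field_simps)
      finally show ?thesis .
    next
      case False
      then have "G s r = 0" for s by (auto simp: G_def E_def)
      with False t show ?thesis by (simp add: E_def)
    qed
    then show "AE r in lborel. (LINT s|lborel. G s r) = exp (- t1) * (indicator {..t1} r * E r)
      + (indicator {t1..t2} r * v r - exp (- t2) * (indicator {..t2} r * E r))"
      using AE_lborel_singleton[of t1] by (auto elim: eventually_mono)
  qed measurable
  also have "\<dots> = exp_mean v t1 + ((LINT s|lborel. indicator {t1..t2} s * v s) - exp_mean v t2)"
    using cut[of t1] cut[of t2] v_int t by (simp add: W)
  finally show ?thesis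
    using W_int v_int by (simp add: right_diff_distrib)
qed

context invariant_flow
begin

text \<open>The Laplace transform \<open>\<integral> exp (- s) U s u ds\<close> over \<open>s > 0\<close> of the semigroup at \<open>1\<close>, with \<open>s\<close> replaced
  by \<open>- s\<close> so that along an orbit it becomes an exponential mean over the past.\<close>

definition resolvent :: "(real ^ 'n \<Rightarrow> real) \<Rightarrow> real ^ 'n \<Rightarrow> real" where
  "resolvent u x = (LINT s|lborel. indicator {..0} s * exp s * shift s u x)"

lemma measurable_resolvent [measurable]:
  assumes u: "u \<in> borel_measurable borel"
  shows "resolvent u \<in> borel_measurable borel"
proof -
  have "(\<lambda>z. shift (snd z) u (fst z)) \<in> borel_measurable (borel \<Otimes>\<^sub>M lborel)"
    by (rule measurable_shift_pair[OF u]) measurable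
  then have "(\<lambda>z. indicator {..0} (snd z) * exp (snd z) * shift (snd z) u (fst z)) \<in> borel_measurable (borel \<Otimes>\<^sub>M lborel)"
    by measurable
  then show ?thesis
    unfolding resolvent_def[abs_def]
    by (intro lborel.borel_measurable_lebesgue_integral) (simp add: case_prod_beta')
qed

lemma integrable_resolvent:
  assumes u: "u \<in> borel_measurable borel" "integrable m u"
  shows "integrable m (resolvent u)"
proof (rule integrableI_bounded)
  show "resolvent u \<in> borel_measurable m"
    by (intro borel_measurable_m measurable_resolvent u)
  let ?w = "\<lambda>s::real. indicator {..0} s * exp s"
  have "(\<integral>\<^sup>+x. ennreal (norm (resolvent u x)) \<partial>m)
      \<le> (\<integral>\<^sup>+x. (\<integral>\<^sup>+s. ennreal (?w s) * ennreal \<bar>shift s u x\<bar> \<partial>lborel) \<partial>m)"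
  proof (rule nn_integral_mono_AE)
    show "AE x in m. ennreal (norm (resolvent u x)) \<le> (\<integral>\<^sup>+s. ennreal (?w s) * ennreal \<bar>shift s u x\<bar> \<partial>lborel)"
      using AE_integrable_orbit[OF u integrable_exp_atMost[of 0]]
    proof eventually_elim
      case (elim x)
      from integral_norm_bound_ennreal[OF elim]
      show ?case by (simp add: resolvent_def abs_mult ennreal_mult)
    qed
  qed
  also have "\<dots> \<le> (\<integral>\<^sup>+x. ennreal \<bar>u x\<bar> \<partial>m) * (\<integral>\<^sup>+s. ennreal (?w s) \<partial>lborel)"
    using measurable_shift_pair_m[OF u(1)] u(2)
    by (intro tonelli_weighted nn_integral_shift_le) auto
  also have "\<dots> < \<infinity>"
    using u(2) by (auto simp: nn_integral_exp_atMost integrable_iff_bounded ennreal_mult_less_top)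
  finally show "(\<integral>\<^sup>+x. ennreal (norm (resolvent u x)) \<partial>m) < \<infinity>" .
qed

lemma resolvent_along_orbit:
  assumes "stays x r"
  shows "resolvent u (\<Phi> x r) = exp_mean (\<lambda>s. shift s u x) r"
proof -
  have eq: "shift s u (\<Phi> x r) = shift (r + s) u x" for s
    using stays_shift[OF assms, of s] by (simp add: shift_def indicator_def)
  show ?thesis
    unfolding resolvent_def exp_mean_def eq
    by (subst lborel_integral_real_affine[where c=1 and t=r and f="\<lambda>s. indicator {..r} s * exp (s - r) * shift s u x"])
       (auto intro!: Bochner_Integration.integral_cong simp: indicator_def)
qed

text \<open>Along almost every orbit \<open>u\<close> is integrable up to every finite time against the exponential
  weight; the union over integer times keeps the exceptional set null.\<close>

lemma resolvent_orbit_eq: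
  assumes u[measurable]: "u \<in> borel_measurable borel" "integrable m u"
  shows "AE x in m. orbit_eq (resolvent u) (\<lambda>x. resolvent u x - u x) x"
proof -
  have "AE x in m. \<forall>k::nat. integrable lborel (\<lambda>s. indicator {..real k} s * exp s * shift s u x)"
    unfolding AE_all_countable by (intro allI AE_integrable_orbit u integrable_exp_atMost)
  then show ?thesis
  proof eventually_elim
    case (elim x)
    show ?case
      unfolding orbit_eq_def
    proof (intro allI impI, elim conjE)
      fix t1 t2 assume st: "stays x t1" "t1 \<le> t2" "stays x t2"
      obtain k :: nat where k: "t2 \<le> real k" using real_arch_simple by blast
      have int: "integrable lborel (\<lambda>s. indicator {..t2} s * exp s * shift s u x)"
        by (rule Bochner_Integration.integrable_bound[OF elim[rule_format, of k]])
           (use k in \<open>auto simp: indicator_def\<close>)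
      have "resolvent u (\<Phi> x t1) - resolvent u (\<Phi> x t2)
          = (LINT s|lborel. indicator {t1..t2} s * (exp_mean (\<lambda>s. shift s u x) s - shift s u x))"
        using exp_mean_increment[OF _ int st(2)] st by (simp add: resolvent_along_orbit)
      also have "\<dots> = (LINT s|lborel. indicator {t1..t2} s * (resolvent u (\<Phi> x s) - u (\<Phi> x s)))"
      proof (intro Bochner_Integration.integral_cong refl)
        fix s
        show "indicator {t1..t2} s * (exp_mean (\<lambda>s. shift s u x) s - shift s u x)
            = indicator {t1..t2} s * (resolvent u (\<Phi> x s) - u (\<Phi> x s))"
          using stays_interval[OF st(1,3), of s] by (cases "s \<in> {t1..t2}") (auto simp: resolvent_along_orbit)
      qed
      also have "\<dots> = (LINT s|lebesgue. indicator {t1..t2} s * (resolvent u (\<Phi> x s) - u (\<Phi> x s)))"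
        by (intro integral_lebesgue_eq_lborel[symmetric]) auto
      finally show "resolvent u (\<Phi> x t1) - resolvent u (\<Phi> x t2)
          = (LINT s:{t1..t2}|lebesgue. resolvent u (\<Phi> x s) - u (\<Phi> x s))"
        by (simp add: set_lebesgue_integral_def)
    qed
  qed
qed

text \<open>Shortly after entry only the short time since entry is seen, so the resolvent is dominated by
  the integral of \<open>\<bar>u\<bar>\<close> over that time.\<close>

lemma resolvent_at_entry:
  assumes u[measurable]: "u \<in> borel_measurable borel"
    and d: "0 < d" "\<And>t. 0 < t \<Longrightarrow> t < d \<Longrightarrow> \<Phi> y t \<in> \<Omega>" "\<And>t. 0 < t \<Longrightarrow> t < d \<Longrightarrow> tau_minus \<Phi> \<Omega> (\<Phi> y t) = ereal t"
    and int: "integrable lborel (\<lambda>s. indicator {0<..<d} s * u (\<Phi> y s))"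
  shows "((\<lambda>t. resolvent u (\<Phi> y t)) \<longlongrightarrow> 0) (at_right 0)"
proof (rule Lim_null_comparison)
  let ?w = "\<lambda>t s. indicator {0<..t} s * \<bar>u (\<Phi> y s)\<bar>"
  have [measurable]: "(\<lambda>s. u (\<Phi> y s)) \<in> borel_measurable borel" by measurable
  have int': "integrable lborel (\<lambda>s. indicator {0<..<d} s * \<bar>u (\<Phi> y s)\<bar>)"
    using integrable_abs[OF int] by (simp add: abs_mult)
  have "((\<lambda>t. LINT s|lborel. ?w t s) \<longlongrightarrow> (LINT s::real|lborel. 0)) (at_right 0)"
  proof (rule dominated_convergence_at_right[where s="?w" and f="\<lambda>_. 0", OF _ _ int'])
    show "AE s in lborel. ((\<lambda>t. ?w t s) \<longlongrightarrow> 0) (at_right 0)"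
    proof (rule AE_I2, rule tendsto_eventually)
      fix s :: real
      show "\<forall>\<^sub>F t in at_right 0. ?w t s = 0"
      proof (cases "0 < s")
        case True
        from eventually_at_right_real[OF this] show ?thesis
          by eventually_elim auto
      qed simp
    qed
    show "\<forall>\<^sub>F t in at_right 0. AE s in lborel. \<bar>?w t s\<bar> \<le> indicator {0<..<d} s * \<bar>u (\<Phi> y s)\<bar>"
      using eventually_at_right_real[OF d(1)]
      by eventually_elim (auto simp: indicator_def)
  qed measurable
  then show "((\<lambda>t. LINT s|lborel. ?w t s) \<longlongrightarrow> 0) (at_right 0)" by simp
  show "\<forall>\<^sub>F t in at_right 0. norm (resolvent u (\<Phi> y t)) \<le> (LINT s|lborel. ?w t s)"
    using eventually_at_right_real[OF d(1)]
  proof eventually_elim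
    case (elim t)
    then have t: "0 < t" "t < d" by auto
    let ?f = "\<lambda>s. indicator {0<..t} s * exp (s - t) * u (\<Phi> y s)"
    have "resolvent u (\<Phi> y t) = (LINT s|lborel. ?f (t + 1 * s))"
      unfolding resolvent_def
    proof (intro Bochner_Integration.integral_cong refl)
      fix s
      show "indicator {..0} s * exp s * shift s u (\<Phi> y t) = ?f (t + 1 * s)"
      proof (cases "s \<le> 0")
        case True
        then have "stays (\<Phi> y t) s \<longleftrightarrow> - t < s"
          using tau_minus_gt_iff[OF d(2)[OF t], of "- s"] d(3)[OF t] by auto
        with True show ?thesis
          by (cases "- t < s") (auto simp: indicator_def)
      qed simp
    qed
    also have "\<dots> = (LINT s|lborel. ?f s)"
      by (subst lborel_integral_real_affine[where c=1 and t=t and f="?f"]) simp_all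
    also have "norm \<dots> \<le> (LINT s|lborel. norm (?f s))"
      by (rule integral_norm_bound)
    also have "\<dots> \<le> (LINT s|lborel. ?w t s)"
    proof (rule integral_mono')
      show "integrable lborel (?w t)"
        by (rule Bochner_Integration.integrable_bound[OF int']) (use t in \<open>auto simp: indicator_def\<close>)
      show "norm (?f s) \<le> ?w t s" for s
      proof (cases "s \<in> {0<..t}")
        case True
        then have "exp (s - t) * \<bar>u (\<Phi> y s)\<bar> \<le> 1 * \<bar>u (\<Phi> y s)\<bar>"
          by (intro mult_right_mono) auto
        with True show ?thesis by (simp add: abs_mult)
      qed auto
    qed auto
    finally show ?case .
  qed
qed

end

section \<open>Test functions separate integrable functions\<close>

lemma has_real_derivative_window:
  fixes c :: "real \<Rightarrow> real"
  assumes c: "continuous_on UNIV c" and e: "0 \<le> e"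
  shows "((\<lambda>t. integral {0..e} (\<lambda>s. c (t + s))) has_real_derivative c (t + e) - c t) (at t)"
proof -
  have sub: "continuous_on S c" for S using c continuous_on_subset by blast
  define I where "I u = integral {t - 1..u} c" for u
  have dI: "(I has_real_derivative c r) (at r)" if "t - 1 < r" for r
  proof -
    have "(I has_real_derivative c r) (at r within {t - 1..r + 1})"
      unfolding I_def using that by (intro integral_has_real_derivative sub) auto
    then show ?thesis
      using that by (simp add: at_within_Icc_at)
  qed
  have window: "integral {0..e} (\<lambda>s. c (r + s)) = I (r + e) - I r" if "t - 1 < r" for r
  proof -
    have "integral {0..e} (\<lambda>s. c (r + s)) = integral {r..r + e} c"
      using integral_shift[OF sub, of 0 e r] by (simp add: o_def add.commute)
    moreover have "I r + integral {r..r + e} c = I (r + e)"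
      unfolding I_def using that e by (intro Henstock_Kurzweil_Integration.integral_combine integrable_continuous_real sub) auto
    ultimately show ?thesis by simp
  qed
  have "((\<lambda>r. I (r + e) - I r) has_real_derivative c (t + e) - c t) (at t)"
    using DERIV_shift[of I "c (t + e)" t e] e by (intro DERIV_diff) (auto intro!: dI)
  then show ?thesis
  proof (rule has_field_derivative_transform_within_open[where S="{t - 1<..}"])
    show "I (r + e) - I r = integral {0..e} (\<lambda>s. c (r + s))" if "r \<in> {t - 1<..}" for r
      using window[of r] that by simp
  qed auto
qed

context invariant_flow
begin

text \<open>Averaging a continuous function over a short piece of orbit makes it differentiable along
  the flow, which is all the smoothness that a test function needs.\<close>

lemma orbit_average_test_function:
  fixes \<phi> :: "real ^ 'n \<Rightarrow> real"
  assumes \<phi>: "continuous_on UNIV \<phi>" "\<And>x. x \<notin> K \<Longrightarrow> \<phi> x = 0" "\<And>x. \<bar>\<phi> x\<bar> \<le> B"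
    and K: "compact K" and e: "0 \<le> e" and st: "\<And>x s. x \<in> K \<Longrightarrow> 0 \<le> s \<Longrightarrow> s \<le> e \<Longrightarrow> \<Phi> x (- s) \<in> \<Omega>"
  defines "\<psi> \<equiv> \<lambda>x. integral {0..e} (\<lambda>s. \<phi> (\<Phi> x s))"
  shows "\<psi> \<in> test_functions M \<Phi> \<Omega>" and "flow_deriv \<Phi> \<psi> x = \<phi> (\<Phi> x e) - \<phi> x"
proof -
  have \<phi>_cont: "continuous_on S (\<lambda>x. \<phi> (f x))" if "continuous_on S f" for S :: "'b::topological_space set" and f
    using continuous_on_compose2[OF \<phi>(1) that] by simp
  have cont: "continuous_on UNIV \<psi>"
  proof -
    have "continuous_on (UNIV \<times> cbox 0 e) (\<lambda>(x, s). \<phi> (\<Phi> x s))"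
      unfolding case_prod_beta' by (intro \<phi>_cont continuous_intros)
    from integral_continuous_on_param[OF this] show ?thesis by (simp add: \<psi>_def)
  qed
  have deriv: "((\<lambda>t. \<psi> (\<Phi> x t)) has_real_derivative \<phi> (\<Phi> x (t + e)) - \<phi> (\<Phi> x t)) (at t)" for x t
  proof -
    have "continuous_on UNIV (\<lambda>s. \<phi> (\<Phi> x s))" by (intro \<phi>_cont continuous_intros)
    from has_real_derivative_window[OF this e, of t] show ?thesis by (simp add: \<psi>_def)
  qed
  show fd: "flow_deriv \<Phi> \<psi> x = \<phi> (\<Phi> x e) - \<phi> x" for x
    unfolding flow_deriv_def using DERIV_imp_deriv[OF deriv[of x 0]] by simp
  define K' where "K' = (\<lambda>z. \<Phi> (fst z) (- snd z)) ` (K \<times> {0..e})"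
  have K': "compact K'" "K' \<subseteq> \<Omega>"
    unfolding K'_def using K st by (auto intro!: compact_continuous_image compact_Times continuous_intros)
  have zero: "\<psi> x = 0" if "x \<notin> K'" for x
  proof -
    have "\<phi> (\<Phi> x s) = 0" if s: "s \<in> {0..e}" for s
    proof (rule \<phi>(2))
      have "\<Phi> x s \<in> K \<Longrightarrow> x \<in> K'"
        unfolding K'_def using s by (intro image_eqI[of _ _ "(\<Phi> x s, s)"]) auto
      then show "\<Phi> x s \<notin> K" using \<open>x \<notin> K'\<close> by blast
    qed
    then have "\<psi> x = integral {0..e} (\<lambda>s. 0)"
      unfolding \<psi>_def by (intro Henstock_Kurzweil_Integration.integral_cong) auto
    then show ?thesis by simp
  qed
  have "compact (ess_support M \<Omega> \<psi>)"
  proof -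
    let ?F = "{V. open V \<and> V \<subseteq> \<Omega> \<and> (AE x\<in>V in M. \<psi> x = 0)}"
    have "\<Omega> - K' \<in> ?F"
      using zero K'(1) open_dom by (auto intro!: open_Diff compact_imp_closed)
    then have "ess_support M \<Omega> \<psi> = K' \<inter> - \<Union>?F"
      using K'(2) by (auto simp: ess_support_def)
    moreover have "closed (- \<Union>?F)" by (auto intro!: open_Union)
    ultimately show ?thesis using K'(1) by (simp add: compact_Int_closed)
  qed
  moreover have "\<psi> \<in> borel_measurable m"
    using cont by (intro borel_measurable_m borel_measurable_continuous_onI)
  moreover have "bounded (\<psi> ` \<Omega>)"
  proof -
    have "norm (\<psi> x) \<le> B * (e - 0)" for x
      unfolding \<psi>_def using e \<phi>(3) by (intro integral_bound \<phi>_cont continuous_intros) auto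
    then show ?thesis by (auto simp: bounded_iff)
  qed
  moreover have "(\<lambda>s. \<psi> (\<Phi> x s)) C1_differentiable_on S" for x S
    unfolding C1_differentiable_on_def
  proof (intro exI[of _ "\<lambda>t. \<phi> (\<Phi> x (t + e)) - \<phi> (\<Phi> x t)"] conjI ballI)
    show "continuous_on S (\<lambda>t. \<phi> (\<Phi> x (t + e)) - \<phi> (\<Phi> x t))"
      by (intro continuous_on_diff \<phi>_cont continuous_intros)
  qed (use deriv in \<open>simp add: has_real_derivative_iff_has_vector_derivative\<close>)
  moreover have "flow_deriv \<Phi> \<psi> \<in> borel_measurable m"
    unfolding fd[abs_def]
    by (intro borel_measurable_m borel_measurable_continuous_onI continuous_on_diff \<phi>_cont continuous_intros)
  moreover have "bounded (flow_deriv \<Phi> \<psi> ` \<Omega>)"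
  proof -
    have "norm (flow_deriv \<Phi> \<psi> x) \<le> 2 * B" for x
      using \<phi>(3)[of "\<Phi> x e"] \<phi>(3)[of x] unfolding fd by (simp add: abs_le_iff)
    then show ?thesis by (auto simp: bounded_iff)
  qed
  ultimately show "\<psi> \<in> test_functions M \<Phi> \<Omega>"
    by (simp add: test_functions_def)
qed

text \<open>The test functions obtained by averaging \<open>\<phi>\<close> over orbit pieces of length \<open>e\<close> converge
  boundedly to \<open>\<phi>\<close> after division by \<open>e\<close>.\<close>

lemma integral_continuous_eq_0:
  fixes \<phi> :: "real ^ 'n \<Rightarrow> real"
  assumes d: "integrable m d" and orth: "\<And>\<psi>. \<psi> \<in> test_functions M \<Phi> \<Omega> \<Longrightarrow> (LINT x|m. d x * \<psi> x) = 0"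
    and \<phi>: "continuous_on UNIV \<phi>" "\<And>x. x \<notin> K \<Longrightarrow> \<phi> x = 0" "\<And>x. \<bar>\<phi> x\<bar> \<le> B"
    and K: "compact K" "K \<subseteq> \<Omega>"
  shows "(LINT x|m. d x * \<phi> x) = 0"
proof -
  obtain e0 where e0: "0 < e0" "\<And>x t. x \<in> K \<Longrightarrow> \<bar>t\<bar> < e0 \<Longrightarrow> stays x t"
    using compact_stays[OF K] by blast
  define \<psi> where "\<psi> e x = integral {0..e} (\<lambda>s. \<phi> (\<Phi> x s))" for e x
  have c: "continuous_on S (\<lambda>s. \<phi> (\<Phi> x s))" for x S
    by (rule continuous_on_compose2[OF \<phi>(1)]) (auto intro!: continuous_on_flow continuous_intros)
  have test: "\<psi> e \<in> test_functions M \<Phi> \<Omega>" if "0 < e" "e < e0" for e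
    unfolding \<psi>_def[abs_def] using that e0
    by (intro orbit_average_test_function[OF \<phi> K(1)]) (auto intro!: stays_imp_end)
  have \<psi>_cont: "continuous_on UNIV (\<psi> e)" for e
  proof -
    have "continuous_on (UNIV \<times> cbox 0 e) (\<lambda>(x, s). \<phi> (\<Phi> x s))"
      unfolding case_prod_beta'
      by (rule continuous_on_compose2[OF \<phi>(1)]) (auto intro!: continuous_on_flow continuous_intros)
    from integral_continuous_on_param[OF this] show ?thesis by (simp add: \<psi>_def[abs_def])
  qed
  have "((\<lambda>e. LINT x|m. d x * (\<psi> e x / e)) \<longlongrightarrow> (LINT x|m. d x * \<phi> x)) (at_right 0)"
  proof (rule dominated_convergence_at_right[where w="\<lambda>x. B * \<bar>d x\<bar>"])
    show "(\<lambda>x. d x * \<phi> x) \<in> borel_measurable m"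
      using d borel_measurable_m[OF borel_measurable_continuous_onI[OF \<phi>(1)]] by auto
    show "(\<lambda>x. d x * (\<psi> e x / e)) \<in> borel_measurable m" for e
      using d borel_measurable_m[OF borel_measurable_continuous_onI[OF \<psi>_cont[of e]]] by auto
    show "integrable m (\<lambda>x. B * \<bar>d x\<bar>)" using d by simp
    show "AE x in m. ((\<lambda>e. d x * (\<psi> e x / e)) \<longlongrightarrow> d x * \<phi> x) (at_right 0)"
    proof (rule AE_I2, rule tendsto_mult_left)
      fix x
      have "((\<lambda>e. \<psi> e x) has_real_derivative \<phi> (\<Phi> x 0)) (at 0 within {0..1})"
        unfolding \<psi>_def by (intro integral_has_real_derivative c) auto
      then have "((\<lambda>e. (\<psi> e x - \<psi> 0 x) / (e - 0)) \<longlongrightarrow> \<phi> x) (at 0 within {0..1})"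
        by (simp add: has_field_derivative_iff)
      moreover have "\<psi> 0 x = 0" by (simp add: \<psi>_def)
      ultimately show "((\<lambda>e. \<psi> e x / e) \<longlongrightarrow> \<phi> x) (at_right 0)"
        by (simp add: at_within_Icc_at_right)
    qed
    show "\<forall>\<^sub>F e in at_right 0. AE x in m. \<bar>d x * (\<psi> e x / e)\<bar> \<le> B * \<bar>d x\<bar>"
      using eventually_at_right_less
    proof eventually_elim
      case (elim e)
      have "\<bar>\<psi> e x\<bar> \<le> B * e" for x
        using integral_bound[of 0 e "\<lambda>s. \<phi> (\<Phi> x s)" B] elim \<phi>(3) c by (simp add: \<psi>_def)
      then have "\<bar>\<psi> e x / e\<bar> \<le> B" for x
        using elim by (simp add: field_simps)
      then show ?case by (intro AE_I2 abs_mult_le_const)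
    qed
  qed
  moreover have "\<forall>\<^sub>F e in at_right 0. (LINT x|m. d x * (\<psi> e x / e)) = 0"
    using eventually_at_right_real[OF e0(1)]
  proof eventually_elim
    case (elim e)
    then show ?case using orth[OF test[of e]] by simp
  qed
  ultimately have "((\<lambda>e. 0) \<longlongrightarrow> (LINT x|m. d x * \<phi> x)) (at_right (0::real))"
    by (rule Lim_transform_eventually)
  then show ?thesis by (simp add: tendsto_const_iff)
qed

lemma integral_open_eq_0:
  assumes d: "integrable m d" and orth: "\<And>\<psi>. \<psi> \<in> test_functions M \<Phi> \<Omega> \<Longrightarrow> (LINT x|m. d x * \<psi> x) = 0"
    and V: "open V" "V \<subseteq> \<Omega>" "bounded V"
  shows "(LINT x|m. d x * indicator V x) = 0"
proof -
  have ne: "- V \<noteq> {}" using V(3) not_bounded_UNIV by (metis Compl_empty_eq double_complement)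
  define \<rho> where "\<rho> x = infdist x (- V)" for x
  have \<rho>: "\<rho> x = 0 \<longleftrightarrow> x \<notin> V" "0 \<le> \<rho> x" for x
    using in_closed_iff_infdist_zero[of "- V" x] V(1) ne by (auto simp: \<rho>_def infdist_nonneg)
  have \<rho>_cont: "continuous_on S \<rho>" for S
    unfolding \<rho>_def[abs_def] by (intro continuous_on_infdist continuous_on_id)
  \<comment> \<open>Continuous functions that increase to the indicator of \<open>V\<close>; subtracting \<open>1\<close> makes each of them
    vanish near the boundary of \<open>V\<close>, hence have compact support.\<close>
  define \<phi> where "\<phi> k x = min 1 (max 0 (real (Suc k) * \<rho> x - 1))" for k x
  have "(\<lambda>k. LINT x|m. d x * \<phi> k x) \<longlonglongrightarrow> (LINT x|m. d x * indicator V x)"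
  proof (rule integral_dominated_convergence[where w="\<lambda>x. \<bar>d x\<bar>"])
    have "(indicator V :: _ \<Rightarrow> real) \<in> borel_measurable m"
      using V by (intro borel_measurable_m) auto
    then show "(\<lambda>x. d x * indicator V x) \<in> borel_measurable m"
      using d by auto
    show "(\<lambda>x. d x * \<phi> k x) \<in> borel_measurable m" for k
    proof -
      have "continuous_on UNIV (\<phi> k)"
        unfolding \<phi>_def[abs_def] by (intro continuous_intros \<rho>_cont)
      from borel_measurable_m[OF borel_measurable_continuous_onI[OF this]] show ?thesis
        using d by auto
    qed
    show "AE x in m. (\<lambda>k. d x * \<phi> k x) \<longlonglongrightarrow> d x * indicator V x"
    proof (rule AE_I2, rule tendsto_mult_left)
      fix x
      show "(\<lambda>k. \<phi> k x) \<longlonglongrightarrow> indicator V x"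
      proof (cases "x \<in> V")
        case True
        then have "0 < \<rho> x" using \<rho>[of x] by (simp add: less_le)
        obtain k0 where k0: "2 / \<rho> x \<le> real k0" using real_arch_simple by blast
        have "\<phi> k x = 1" if "k0 \<le> k" for k
        proof -
          have "2 / \<rho> x \<le> real (Suc k)" using k0 that by linarith
          then have "2 \<le> real (Suc k) * \<rho> x" using \<open>0 < \<rho> x\<close> by (simp add: pos_divide_le_eq)
          then show ?thesis by (simp add: \<phi>_def)
        qed
        then show ?thesis
          using True by (intro tendsto_eventually) (auto simp: eventually_sequentially)
      next
        case False
        then show ?thesis using \<rho>(1)[of x] by (simp add: \<phi>_def)
      qed
    qed
    show "AE x in m. norm (d x * \<phi> k x) \<le> \<bar>d x\<bar>" for k
    proof (rule AE_I2)
      fix x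
      have "\<bar>\<phi> k x\<bar> \<le> 1" by (simp add: \<phi>_def)
      from abs_mult_le_const(1)[OF this] show "norm (d x * \<phi> k x) \<le> \<bar>d x\<bar>" by simp
    qed
  qed (use d in auto)
  moreover have "(LINT x|m. d x * \<phi> k x) = 0" for k
  proof (rule integral_continuous_eq_0[OF d orth])
    let ?K = "{x. 1 / real (Suc k) \<le> \<rho> x}"
    show "continuous_on UNIV (\<phi> k)"
      unfolding \<phi>_def[abs_def] by (intro continuous_intros \<rho>_cont)
    show "\<phi> k x = 0" if "x \<notin> ?K" for x
      using that by (simp add: \<phi>_def field_simps)
    show "\<bar>\<phi> k x\<bar> \<le> 1" for x by (simp add: \<phi>_def)
    have sub: "?K \<subseteq> V"
    proof
      fix x assume "x \<in> ?K"
      moreover have "0 < 1 / real (Suc k)" by simp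
      ultimately have "\<rho> x \<noteq> 0" by (metis less_le_not_le mem_Collect_eq)
      then show "x \<in> V" using \<rho>(1) by blast
    qed
    moreover have "closed ?K" by (intro closed_Collect_le continuous_intros \<rho>_cont)
    ultimately show "compact ?K" using V(3) by (auto simp: compact_eq_bounded_closed intro: bounded_subset)
    show "?K \<subseteq> \<Omega>" using sub V(2) by blast
  qed
  ultimately show ?thesis by (simp add: LIMSEQ_const_iff)
qed

theorem AE_eq_0_if_orthogonal_to_test_functions:
  assumes d: "integrable m d" and orth: "\<And>\<psi>. \<psi> \<in> test_functions M \<Phi> \<Omega> \<Longrightarrow> (LINT x|m. d x * \<psi> x) = 0"
  shows "AE x in m. d x = 0"
proof -
  have cut: "integrable m (\<lambda>x. d x * indicator A x)" if "A \<in> sets m" for A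
    using integrable_mult_indicator[OF that d] by (simp add: mult.commute)
  have bd: "(LINT x|m. d x * indicator A x) = 0" if "A \<in> sets m" "bounded A" for A
    using that
  proof (induction rule: bounded_sets_induct)
    case empty
    show ?case by simp
  next
    case ("open" V)
    then show ?case by (intro integral_open_eq_0[OF d orth])
  next
    case (diff V B)
    have "(LINT x|m. d x * indicator (V - B) x) = (LINT x|m. d x * indicator V x - d x * indicator B x)"
      using diff by (intro Bochner_Integration.integral_cong) (auto simp: indicator_def)
    also have "\<dots> = 0"
      using diff cut by simp
    finally show ?case .
  next
    case (union B V)
    have UB: "(\<Union>i. B i) \<in> sets m" using union by auto
    have "(LINT x:(\<Union>i. B i)|m. d x) = (\<Sum>i. (LINT x:B i|m. d x))"
      using union cut[OF UB] by (intro lebesgue_integral_countable_add)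
        (auto simp: set_integrable_def mult.commute disjoint_family_on_def)
    then show ?case
      using union by (simp add: set_lebesgue_integral_def mult.commute)
  next
    case (cong B C)
    from cong(3) have "AE x in m. d x * indicator B x = d x * indicator C x"
      by eventually_elim (simp add: indicator_def)
    then have "(LINT x|m. d x * indicator B x) = (LINT x|m. d x * indicator C x)"
      using cut cong(1,2) by (intro integral_cong_AE) auto
    with cong(4) show ?case by simp
  qed
  show ?thesis
  proof (rule m.density_zero[OF d])
    fix A assume A: "A \<in> sets m"
    have A\<Omega>: "A \<subseteq> \<Omega>" using sets.sets_into_space[OF A] by simp
    have sets: "A \<inter> ball 0 (real k) \<in> sets m" for k
    proof -
      have "A \<inter> (ball 0 (real k) \<inter> \<Omega>) \<in> sets m"
        using A by (intro sets.Int sets_m_borel) auto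
      moreover have "A \<inter> (ball 0 (real k) \<inter> \<Omega>) = A \<inter> ball 0 (real k)" using A\<Omega> by auto
      ultimately show ?thesis by simp
    qed
    have "(\<lambda>k. LINT x|m. d x * indicator (A \<inter> ball 0 (real k)) x) \<longlonglongrightarrow> (LINT x|m. d x * indicator A x)"
    proof (rule integral_dominated_convergence[where w="\<lambda>x. \<bar>d x\<bar>"])
      show "AE x in m. (\<lambda>k. d x * indicator (A \<inter> ball 0 (real k)) x) \<longlonglongrightarrow> d x * indicator A x"
      proof (rule AE_I2, rule tendsto_mult_left, rule tendsto_eventually)
        fix x :: "real ^ 'n"
        obtain k0 :: nat where "norm x < real k0" using reals_Archimedean2 by blast
        then show "\<forall>\<^sub>F k in sequentially. indicator (A \<inter> ball 0 (real k)) x = (indicator A x :: real)"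
          unfolding eventually_sequentially by (intro exI[of _ k0]) (auto simp: indicator_def)
      qed
      show "AE x in m. norm (d x * indicator (A \<inter> ball 0 (real k)) x) \<le> \<bar>d x\<bar>" for k
        by (intro AE_I2) (simp add: indicator_def)
    qed (use d cut[OF A] cut[OF sets] in auto)
    moreover have "(LINT x|m. d x * indicator (A \<inter> ball 0 (real k)) x) = 0" for k
      using sets by (intro bd) auto
    ultimately show "(LINT x:A|m. d x) = 0"
      by (simp add: LIMSEQ_const_iff set_lebesgue_integral_def mult.commute)
  qed
qed

corollary T_max_unique:
  assumes "(f, g) \<in> T_max M \<Phi> \<Omega>" "(f, g') \<in> T_max M \<Phi> \<Omega>"
  shows "AE x in m. g x = g' x"
proof -
  have int: "integrable m g" "integrable m g'" using assms by (auto simp: T_max_def)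
  have "AE x in m. g x - g' x = 0"
  proof (rule AE_eq_0_if_orthogonal_to_test_functions)
    fix \<psi> assume \<psi>: "\<psi> \<in> test_functions M \<Phi> \<Omega>"
    obtain C where C: "\<And>x. x \<in> \<Omega> \<Longrightarrow> \<bar>\<psi> x\<bar> \<le> C"
      using \<psi> by (auto simp: test_functions_def bounded_iff)
    have times_\<psi>: "integrable m (\<lambda>x. h x * \<psi> x)" if "integrable m h" for h
    proof (rule Bochner_Integration.integrable_bound)
      show "integrable m (\<lambda>x. C * h x)" using that by simp
      show "AE x in m. norm (h x * \<psi> x) \<le> norm (C * h x)"
        using C by (intro AE_I2) (simp only: real_norm_def abs_mult_le_const space_m)
      show "(\<lambda>x. h x * \<psi> x) \<in> borel_measurable m"
        using that \<psi> by (auto simp: test_functions_def)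
    qed
    show "(LINT x|m. (g x - g' x) * \<psi> x) = 0"
      using times_\<psi>[OF int(1)] times_\<psi>[OF int(2)] assms \<psi>
      by (simp add: left_diff_distrib T_max_def)
  qed (use int in auto)
  then show ?thesis by simp
qed

end

section \<open>The incoming boundary measure\<close>

lemma set_integral_eq_0:
  assumes "\<And>x. x \<in> A \<Longrightarrow> f x = 0"
  shows "(LINT x:A|N. f x) = 0"
proof -
  have "(\<lambda>x. indicator A x *\<^sub>R f x) = (\<lambda>_. 0)"
    using assms by (auto simp: fun_eq_iff indicator_def)
  then show ?thesis by (simp add: set_lebesgue_integral_def)
qed

context invariant_flow
begin

lemma measurable_tau_minus:
  "(\<lambda>x. if x \<in> \<Omega> then tau_minus \<Phi> \<Omega> x else 0) \<in> borel_measurable borel"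
proof (rule borel_measurableI_greater)
  fix c :: ereal
  let ?\<tau> = "\<lambda>x. if x \<in> \<Omega> then tau_minus \<Phi> \<Omega> x else 0"
  have nonneg: "0 \<le> ?\<tau> x" for x
    using tau_minus_pos[of x] by (auto intro: less_imp_le)
  have "{x. c < ?\<tau> x} \<in> sets borel"
  proof (cases "0 \<le> c")
    case False
    then have "{x. c < ?\<tau> x} = UNIV" using nonneg less_le_trans[of c 0] by auto
    then show ?thesis by simp
  next
    case True
    show ?thesis
    proof (cases c)
      case (real r)
      have "{x. c < ?\<tau> x} = {x. stays x (- r)}"
        using True real by (auto simp: tau_minus_gt_iff dest: stays_imp_start split: if_splits)
      then show ?thesis using open_stays_point by simp
    qed (use True in auto)
  qed
  then show "{x \<in> space borel. c < ?\<tau> x} \<in> sets borel" by simp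
qed

context
  fixes \<mu>m :: "(real ^ 'n) measure"
  assumes incoming: "incoming_measure M \<Phi> \<Omega> \<mu>m"
begin

lemma space_incoming: "space \<mu>m = Gamma_minus \<Phi> \<Omega>"
  using incoming sets_eq_imp_space_eq[of \<mu>m "restrict_space borel (Gamma_minus \<Phi> \<Omega>)"]
  by (auto simp: incoming_measure_def space_restrict_space)

text \<open>The integration formula is applied to the indicator of the points \<open>(x, t)\<close> such that the orbit
  of \<open>x\<close> entered through the exceptional part of the boundary less than \<open>t\<close> ago.  An orbit that
  starts inside \<open>\<Omega>\<close> at time \<open>0\<close> never reaches such a point at time \<open>t\<close>, since its entry lies more than \<open>t\<close> back;
  so the interior term is \<open>0\<close> and only the boundary term is left, which sees nothing outside a
  null set.  With the indicator of the exceptional orbits alone, regardless of the time since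
  entry, the formula would be consistent with a positive measure of such orbits that remain in
  \<open>\<Omega>\<close> forever.\<close>

lemma AE_incoming_imp_AE:
  assumes P: "AE y in \<mu>m. P y"
  shows "AE x in m. \<forall>a. tau_minus \<Phi> \<Omega> x = ereal a \<longrightarrow> P (\<Phi> x (- a))"
proof -
  from P obtain N where N: "N \<in> null_sets \<mu>m" "{y \<in> space \<mu>m. \<not> P y} \<subseteq> N"
    by (auto simp: eventually_ae_filter)
  have "sets \<mu>m = sets (restrict_space borel (Gamma_minus \<Phi> \<Omega>))"
    using incoming by (simp add: incoming_measure_def)
  then obtain N' where N'[measurable]: "N' \<in> sets borel" and NN': "N = Gamma_minus \<Phi> \<Omega> \<inter> N'"
    using N(1) by (auto simp: null_sets_def sets_restrict_space)
  have AE_N: "AE y in \<mu>m. y \<in> Gamma_minus \<Phi> \<Omega> \<and> y \<notin> N'"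
    using AE_not_in[OF N(1)] AE_space by eventually_elim (auto simp: NN' space_incoming)
  define \<tau> where "\<tau> x = (if x \<in> \<Omega> then tau_minus \<Phi> \<Omega> x else 0)" for x
  have \<tau>[measurable]: "\<tau> \<in> borel_measurable borel"
    unfolding \<tau>_def by (rule measurable_tau_minus)
  interpret sM: sigma_finite_measure M by (rule sigma_finite_M)
  interpret MT: pair_sigma_finite M "lborel :: real measure" ..
  \<comment> \<open>The cut-off by \<open>k\<close> makes the indicator integrable.\<close>
  define S where "S k = {z :: (real ^ 'n) \<times> real. fst z \<in> \<Omega> \<and> norm (fst z) < real k \<and>
    \<tau> (fst z) < ereal (snd z) \<and> \<Phi> (fst z) (- real_of_ereal (\<tau> (fst z))) \<in> N'}" for k :: nat
  have S_meas: "S k \<in> sets (borel \<Otimes>\<^sub>M borel)" for k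
  proof -
    have [measurable]: "(\<lambda>z :: (real ^ 'n) \<times> real. \<Phi> (fst z) (- real_of_ereal (\<tau> (fst z)))) \<in> borel_measurable (borel \<Otimes>\<^sub>M borel)"
      by (intro measurable_flow_at) measurable
    have "Measurable.pred (borel \<Otimes>\<^sub>M borel) (\<lambda>z. z \<in> S k)"
      unfolding S_def mem_Collect_eq by measurable
    then show ?thesis by (simp add: pred_def space_pair_measure)
  qed
  have id_meas: "(\<lambda>z. z) \<in> measurable (M \<Otimes>\<^sub>M (lborel :: real measure)) (borel \<Otimes>\<^sub>M borel)"
  proof -
    have f: "fst \<in> borel_measurable (M \<Otimes>\<^sub>M (lborel :: real measure))"
      by (rule measurable_compose[OF measurable_fst measurable_ident_M])
    have g: "snd \<in> borel_measurable (M \<Otimes>\<^sub>M (lborel :: real measure))"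
      using measurable_snd[of M "lborel :: real measure"] by simp
    from measurable_Pair[OF f g] show ?thesis
      by (simp only: prod.collapse)
  qed
  have main: "AE x in M. AE t in lborel. (x, t) \<notin> S k \<inter> \<Omega> \<times> {0<..<real T}" if T: "0 < T" for k T :: nat
  proof -
    let ?T = "real T" and ?f = "indicator (S k) :: _ \<Rightarrow> real"
    have f_meas: "?f \<in> borel_measurable (M \<Otimes>\<^sub>M lborel)"
      using measurable_compose[OF id_meas, of ?f borel] S_meas by simp
    have cyl: "(\<Omega> \<inter> ball 0 (real k)) \<times> {0<..<?T} \<in> sets (M \<Otimes>\<^sub>M lborel)"
      using sets_borel_subset by (intro pair_measureI) auto
    have \<Omega>T: "\<Omega> \<times> {0<..<?T} \<in> sets (M \<Otimes>\<^sub>M lborel)"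
      by (intro pair_measureI) auto
    have f_int: "set_integrable (M \<Otimes>\<^sub>M lborel) (\<Omega> \<times> {0<..<?T}) ?f"
      unfolding set_integrable_def
    proof (rule Bochner_Integration.integrable_bound)
      have "emeasure (M \<Otimes>\<^sub>M lborel) ((\<Omega> \<inter> ball 0 (real k)) \<times> {0<..<?T})
          = emeasure M (\<Omega> \<inter> ball 0 (real k)) * emeasure lborel {0<..<?T}"
        using sets_borel_subset by (intro lborel.emeasure_pair_measure_Times) auto
      also have "\<dots> < \<infinity>"
        using emeasure_bounded_finite[of "\<Omega> \<inter> ball 0 (real k)"] by (simp add: bounded_Int ennreal_mult_less_top)
      finally show "integrable (M \<Otimes>\<^sub>M lborel) (indicator ((\<Omega> \<inter> ball 0 (real k)) \<times> {0<..<?T}) :: _ \<Rightarrow> real)"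
        using cyl by (intro integrable_real_indicator)
      show "AE z in M \<Otimes>\<^sub>M lborel. norm (indicator (\<Omega> \<times> {0<..<?T}) z *\<^sub>R ?f z)
          \<le> norm (indicator ((\<Omega> \<inter> ball 0 (real k)) \<times> {0<..<?T}) z :: real)"
        by (intro AE_I2) (auto simp: S_def indicator_def)
    qed (intro borel_measurable_scaleR borel_measurable_indicator f_meas \<Omega>T)
    define I where "I t y = {s. 0 < s \<and> ereal s < min (tau_plus_bd \<Phi> \<Omega> y) (ereal (?T - t))}" for t y
    define J where "J x = {s. 0 < s \<and> ereal s < min (tau_plus \<Phi> \<Omega> x) (ereal ?T)}" for x
    define p where "p t y = (LINT s:I t y|lebesgue. ?f (\<Phi> y s, t + s))" for t y
    define q where "q x = (LINT s:J x|lebesgue. ?f (\<Phi> x s, s))" for x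
    have formula: "(LINT z:\<Omega> \<times> {0<..<?T}|(M \<Otimes>\<^sub>M lborel). ?f z)
        = (LINT t:{0<..<?T}|lebesgue. LINT y|completion \<mu>m. p t y) + (LINT x:\<Omega>|M. q x)"
      using incoming f_int T unfolding incoming_measure_def Let_def p_def q_def I_def J_def by simp
    have p0: "p t y = 0" if "0 < t" "y \<in> Gamma_minus \<Phi> \<Omega>" "y \<notin> N'" for t y
      unfolding p_def
    proof (rule set_integral_eq_0)
      fix s assume "s \<in> I t y"
      then have s: "0 < s" "ereal s < tau_plus_bd \<Phi> \<Omega> y" by (auto simp: I_def)
      have "(\<Phi> y s, t + s) \<notin> S k"
        using Gamma_minus_orbit[OF that(2) s] that(3) by (auto simp: S_def \<tau>_def)
      then show "?f (\<Phi> y s, t + s) = 0" by simp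
    qed
    have "(LINT y|completion \<mu>m. p t y) = 0" if "0 < t" for t
      using AE_completion[OF AE_N] p0 that by (intro integral_eq_zero_AE) (auto elim: eventually_mono)
    then have boundary: "(LINT t:{0<..<?T}|lebesgue. LINT y|completion \<mu>m. p t y) = 0"
      by (intro set_integral_eq_0) simp
    have q0: "q x = 0" if x: "x \<in> \<Omega>" for x
      unfolding q_def
    proof (rule set_integral_eq_0)
      fix s assume "s \<in> J x"
      then have s: "0 < s" "ereal s < tau_plus \<Phi> \<Omega> x" by (auto simp: J_def)
      then have st: "stays x s" using tau_plus_gt_iff[OF x, of s] by simp
      then have "ereal s < tau_minus \<Phi> \<Omega> (\<Phi> x s)"
        using s tau_minus_gt_iff[of "\<Phi> x s" s] by (simp add: stays_reverse stays_imp_end)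
      then have "(\<Phi> x s, s) \<notin> S k"
        using stays_imp_end[OF st] by (auto simp: S_def \<tau>_def)
      then show "?f (\<Phi> x s, s) = 0" by simp
    qed
    then have "(LINT x:\<Omega>|M. q x) = 0"
      by (rule set_integral_eq_0)
    with formula boundary have "(LINT z|(M \<Otimes>\<^sub>M lborel). indicator (\<Omega> \<times> {0<..<?T}) z *\<^sub>R ?f z) = 0"
      by (simp add: set_lebesgue_integral_def)
    then have "AE z in M \<Otimes>\<^sub>M lborel. indicator (\<Omega> \<times> {0<..<?T}) z *\<^sub>R ?f z = 0"
      using f_int by (subst (asm) integral_nonneg_eq_0_iff_AE) (auto simp: set_integrable_def)
    then have "AE z in M \<Otimes>\<^sub>M lborel. z \<notin> S k \<inter> \<Omega> \<times> {0<..<?T}"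
      by eventually_elim (auto simp: indicator_def)
    from MT.AE_pair[OF this] show ?thesis .
  qed
  have "AE x in M. \<forall>k T. 0 < T \<longrightarrow> (AE t in lborel. (x, t) \<notin> S k \<inter> \<Omega> \<times> {0<..<real T})"
    unfolding AE_all_countable using main by (auto intro: eventually_mono)
  then have "AE x in M. x \<in> \<Omega> \<longrightarrow> (\<forall>a. tau_minus \<Phi> \<Omega> x = ereal a \<longrightarrow> P (\<Phi> x (- a)))"
  proof eventually_elim
    case (elim x)
    show ?case
    proof (intro impI allI)
      fix a assume x: "x \<in> \<Omega>" and a: "tau_minus \<Phi> \<Omega> x = ereal a"
      have a0: "0 < a" using tau_minus_pos[OF x] a by simp
      have y: "\<Phi> x (- a) \<in> Gamma_minus \<Phi> \<Omega>" by (rule entry_point_in_Gamma_minus[OF x a])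
      show "P (\<Phi> x (- a))"
      proof (rule ccontr)
        assume "\<not> P (\<Phi> x (- a))"
        then have yN: "\<Phi> x (- a) \<in> N'"
          using N(2) y NN' by (auto simp: space_incoming)
        obtain k :: nat where k: "norm x < real k" using reals_Archimedean2 by blast
        obtain T :: nat where T: "a < real T" using reals_Archimedean2 by blast
        then have "0 < T" using a0 by (cases T) auto
        with elim have "AE t in lborel. (x, t) \<notin> S k \<inter> \<Omega> \<times> {0<..<real T}" by blast
        then have "AE t in lborel. t \<notin> {a<..<real T}"
          by eventually_elim (use x a a0 k yN in \<open>auto simp: S_def \<tau>_def\<close>)
        then have "emeasure lborel {a<..<real T} = 0"
          by (subst (asm) AE_iff_null_sets[symmetric]) auto
        then show False using T by simp
      qed
    qed
  qed
  then show ?thesis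
    by (simp add: AE_restrict_space_iff)
qed

text \<open>The formula that defines the incoming measure, applied to \<open>u\<close> as a function constant in time,
  contains the integrability of \<open>u\<close> on the beginning of almost every incoming orbit.\<close>

lemma AE_incoming_resolvent:
  assumes u: "u \<in> borel_measurable borel" "integrable m u"
  shows "AE y in \<mu>m. ((\<lambda>t. resolvent u (\<Phi> y t)) \<longlongrightarrow> 0) (at_right 0)"
proof -
  define I where "I t y = {s. 0 < s \<and> ereal s < min (tau_plus_bd \<Phi> \<Omega> y) (ereal (1 - t))}" for t y
  have int: "set_integrable (M \<Otimes>\<^sub>M lborel) (\<Omega> \<times> {0<..<1::real}) (\<lambda>z. u (fst z))"
  proof -
    have "integrable M (\<lambda>x. indicator \<Omega> x * u x)"
      using u(2) by (simp add: integrable_restrict_space)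
    moreover have "integrable lborel (indicator {0<..<1} :: real \<Rightarrow> real)"
      by (intro integrable_real_indicator) auto
    ultimately have "integrable (M \<Otimes>\<^sub>M lborel) (\<lambda>(x, t). (indicator \<Omega> x * u x) * indicator {0<..<1::real} t)"
      by (intro integrable_pair_mult lborel.sigma_finite_measure_axioms)
    also have "(\<lambda>(x, t). (indicator \<Omega> x * u x) * indicator {0<..<1::real} t)
        = (\<lambda>z. indicator (\<Omega> \<times> {0<..<1::real}) z *\<^sub>R u (fst z))"
      by (auto simp: fun_eq_iff indicator_def)
    finally show ?thesis
      by (simp only: set_integrable_def)
  qed
  have "AE t\<in>{0<..<1} in lebesgue. AE y in \<mu>m. set_integrable lebesgue (I t y) (\<lambda>s. u (\<Phi> y s))"
    using incoming int unfolding incoming_measure_def Let_def I_def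
    by (elim conjE allE[of _ "1::real"] impE) auto
  then have "AE t in lborel. t \<in> {0<..<1} \<longrightarrow> (AE y in \<mu>m. set_integrable lebesgue (I t y) (\<lambda>s. u (\<Phi> y s)))"
    by (simp add: AE_completion_iff)
  note AE_t = this
  obtain t where t: "0 < t" "t < 1" "AE y in \<mu>m. set_integrable lebesgue (I t y) (\<lambda>s. u (\<Phi> y s))"
  proof (rule ccontr)
    assume "\<not> thesis"
    with that have "t \<in> {0<..<1} \<Longrightarrow> \<not> (AE y in \<mu>m. set_integrable lebesgue (I t y) (\<lambda>s. u (\<Phi> y s)))" for t
      by auto
    with AE_t have "AE t in lborel. t \<notin> {0<..<1::real}"
      by (auto elim!: eventually_mono)
    then have "emeasure lborel {0<..<1::real} = 0"
      by (subst (asm) AE_iff_null_sets[symmetric]) auto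
    then show False by simp
  qed
  from t(3) AE_space show ?thesis
  proof eventually_elim
    case (elim y)
    then have y: "y \<in> Gamma_minus \<Phi> \<Omega>" by (simp add: space_incoming)
    obtain s0 where s0: "0 < s0" "ereal s0 < tau_plus_bd \<Phi> \<Omega> y"
      using Gamma_minus_tau_plus_bd_pos[OF y] by blast
    define d where "d = min s0 (1 - t)"
    have d: "0 < d" using s0 t by (simp add: d_def)
    have below: "ereal s < tau_plus_bd \<Phi> \<Omega> y" if "s < d" for s
      using that s0(2) less_trans[of "ereal s" "ereal s0"] by (simp add: d_def)
    have [measurable]: "(\<lambda>s. u (\<Phi> y s)) \<in> borel_measurable borel"
      using u(1) by measurable
    have sub: "{0<..<d} \<subseteq> I t y"
      using below by (auto simp: I_def d_def)
    have "set_integrable lebesgue {0<..<d} (\<lambda>s. u (\<Phi> y s))"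
      by (rule set_integrable_subset[OF elim(1) _ sub]) auto
    then have "integrable lborel (\<lambda>s. indicator {0<..<d} s * u (\<Phi> y s))"
      by (simp add: set_integrable_def integrable_completion)
    with d show ?case
      using Gamma_minus_orbit[OF y] below by (intro resolvent_at_entry[OF u(1), of d]) auto
  qed
qed

theorem T_zero_eq_generator: "T_zero M \<Phi> \<Omega> \<mu>m = gen"
proof (intro equalityI subrelI)
  fix f g assume "(f, g) \<in> T_zero M \<Phi> \<Omega> \<mu>m"
  then obtain h g0 where fg: "(f, g) \<in> T_max M \<Phi> \<Omega>" and fg0: "(f, g0) \<in> T_max M \<Phi> \<Omega>"
    and h: "h \<in> borel_measurable m" "AE x in m. h x = f x"
    and eq: "AE x in m. \<forall>t1 t2. - tau_minus \<Phi> \<Omega> x < ereal t1 \<and> t1 \<le> t2 \<and> ereal t2 < tau_plus \<Phi> \<Omega> x \<longrightarrow>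
          h (\<Phi> x t1) - h (\<Phi> x t2) = (LINT s:{t1..t2}|lebesgue. g0 (\<Phi> x s))"
    and tr: "AE y in \<mu>m. ((\<lambda>t. h (\<Phi> y t)) \<longlongrightarrow> 0) (at_right 0)"
    by (auto simp: T_zero_def has_incoming_trace_def sharp_representative_def)
  have int: "integrable m f" "integrable m g" "integrable m g0"
    using fg fg0 by (auto simp: T_max_def)
  have "AE x in m. orbit_eq h g0 x"
    using eq AE_space by eventually_elim (auto simp: orbit_eq_def stays_iff)
  moreover have "AE x in m. zero_at_entry h x"
    using AE_incoming_imp_AE[OF tr] by (simp add: zero_at_entry_def)
  ultimately have "(f, g0) \<in> gen"
    by (rule orbit_eq_imp_generator[OF int(1,3) h])
  then show "(f, g) \<in> gen"
    by (rule generator_cong_AE[OF _ int(1) _ int(2) T_max_unique[OF fg0 fg]]) simp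
next
  fix f g assume fg: "(f, g) \<in> gen"
  then have f: "integrable m f" and g: "integrable m g" by (auto simp: generator_iff)
  \<comment> \<open>If \<open>A\<close> is the generator, then \<open>u = (1 - A) f\<close>, so \<open>f\<close> has to be the resolvent of \<open>u\<close>.\<close>
  obtain u where u: "u \<in> borel_measurable borel" "AE x in m. f x - g x = u x"
    using borel_version[OF borel_measurable_integrable[OF Bochner_Integration.integrable_diff[OF f g]]] by blast
  have u_int: "integrable m u"
    by (rule integrable_cong_AE_imp[OF Bochner_Integration.integrable_diff[OF f g] borel_measurable_m[OF u(1)] u(2)])
  define h where "h = resolvent u"
  let ?g = "\<lambda>x. h x - u x"
  have h: "integrable m h" "h \<in> borel_measurable m" and hu: "integrable m ?g"
    using integrable_resolvent[OF u(1) u_int] u_int by (auto simp: h_def)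
  have eq: "AE x in m. orbit_eq h ?g x"
    unfolding h_def by (rule resolvent_orbit_eq[OF u(1) u_int])
  have tr: "AE y in \<mu>m. ((\<lambda>t. h (\<Phi> y t)) \<longlongrightarrow> 0) (at_right 0)"
    unfolding h_def by (rule AE_incoming_resolvent[OF u(1) u_int])
  have "AE x in m. zero_at_entry h x"
    using AE_incoming_imp_AE[OF tr] by (simp add: zero_at_entry_def)
  with eq have h_gen: "(h, ?g) \<in> gen"
    by (intro orbit_eq_imp_generator[OF h(1) hu h(2)]) auto
  have "((\<lambda>x. f x - h x), (\<lambda>x. f x - h x)) \<in> gen"
    by (rule generator_cong_AE[OF generator_diff[OF fg h_gen]])
       (use f h u(2) in \<open>auto elim!: eventually_mono\<close>)
  from generator_dissipative[OF this] have hf: "AE x in m. h x = f x"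
    by eventually_elim simp
  have "AE x in m. ?g x = g x"
    using hf u(2) by eventually_elim simp
  with hf have "(f, ?g) \<in> gen" "(f, g) \<in> gen"
    using generator_cong_AE[OF h_gen f hf hu] fg by auto
  note T = generator_imp_T_max[OF this(1)] generator_imp_T_max[OF this(2)]
  have "AE x in m. \<forall>t1 t2. - tau_minus \<Phi> \<Omega> x < ereal t1 \<and> t1 \<le> t2 \<and> ereal t2 < tau_plus \<Phi> \<Omega> x \<longrightarrow>
          h (\<Phi> x t1) - h (\<Phi> x t2) = (LINT s:{t1..t2}|lebesgue. ?g (\<Phi> x s))"
    using eq AE_space
  proof eventually_elim
    case (elim x)
    show ?case
    proof (intro allI impI, elim conjE)
      fix t1 t2 assume t: "- tau_minus \<Phi> \<Omega> x < ereal t1" "t1 \<le> t2" "ereal t2 < tau_plus \<Phi> \<Omega> x"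
      have "ereal t1 \<le> ereal t2" using t(2) by simp
      then have "stays x t1" "stays x t2"
        using t elim(2) le_less_trans[of "ereal t1" "ereal t2"] less_le_trans[of _ "ereal t1" "ereal t2"]
        by (auto simp: stays_iff)
      with t(2) elim(1) show "h (\<Phi> x t1) - h (\<Phi> x t2) = (LINT s:{t1..t2}|lebesgue. ?g (\<Phi> x s))"
        by (auto simp: orbit_eq_def)
    qed
  qed
  with T(1) h(2) hf have "sharp_representative M \<Phi> \<Omega> f h"
    by (auto simp: sharp_representative_def intro!: exI[of _ ?g])
  with tr have "has_incoming_trace M \<Phi> \<Omega> \<mu>m f (\<lambda>_. 0)"
    by (auto simp: has_incoming_trace_def)
  with T(2) show "(f, g) \<in> T_zero M \<Phi> \<Omega> \<mu>m"
    by (simp add: T_zero_def)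
qed

end

end

theorem theorem4p1:
  fixes M \<mu>p \<mu>m :: "(real ^ 'n::finite) measure"
    and F :: "real ^ 'n \<Rightarrow> real ^ 'n"
    and \<Phi> :: "real ^ 'n \<Rightarrow> real \<Rightarrow> real ^ 'n"
    and \<Omega> :: "(real ^ 'n) set"
  assumes "radon_measure M"
    and "\<exists>L. L-lipschitz_on UNIV F"
    and "is_flow F \<Phi>"
    and "flow_invariant \<Phi> M"
    and "open \<Omega>"
    and "outgoing_measure M \<Phi> \<Omega> \<mu>p"
    and "incoming_measure M \<Phi> \<Omega> \<mu>m"
  shows "L1_C0_semigroup (restrict_space M \<Omega>) (U_zero \<Phi> \<Omega>) \<and>
         L1_contractive (restrict_space M \<Omega>) (U_zero \<Phi> \<Omega>) \<and>
         L1_nonnegative (restrict_space M \<Omega>) (U_zero \<Phi> \<Omega>) \<and>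
         T_zero M \<Phi> \<Omega> \<mu>m = L1_generator (restrict_space M \<Omega>) (U_zero \<Phi> \<Omega>)"
proof -
  interpret invariant_flow F \<Phi> \<Omega> M
    using assms by unfold_locales
  show ?thesis
    using U_semigroup U_contractive U_nonnegative T_zero_eq_generator[OF assms(7)] by blast
qed

end
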